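(* Let $\mathcal{A}=\mathcal{A}_0\sqcup\mathcal{A}_1$ and $\mathcal{B}=\mathcal{B}_0\sqcup\mathcal{B}_1$ be $\mathbb{Z}_2$-graded sets which are at most countable, and let $d\ge 1$. For every $\lambda\in\mathbb{Z}^d_+$, $$S_{\lambda}^{\mathcal{A}/\mathcal{B}}=\frac{\sum_{w\in\mathcal{W}}(-1)^{\ell(w)}S_{\lambda^{w,+}}(\mathbf{x}_{\mathcal{A}})\,S_{\lambda^{w,-}}(\mathbf{x}_{\mathcal{B}}^{-1})}{\Delta_{\mathcal{A}/\mathcal{B}}},\qquad \Delta_{\mathcal{A}/\mathcal{B}}=\frac{\prod_{|a|=|b|}(1-x_ax_b^{-1})}{\prod_{|a|\neq|b|}(1+x_ax_b^{-1})},$$ where the products run over pairs $(a,b)\in\mathcal{A}\times\mathcal{B}$. Moreover, the following Cauchy type identity holds: $$\prod_{k=1}^{d}\frac{\prod_{a\in\mathcal{A}_1}(1+x_az_k)\prod_{b\in\mathcal{B}_1}(1+x_b^{-1}z_k^{-1})}{\prod_{a\in\mathcal{A}_0}(1-x_az_k)\prod_{b\in\mathcal{B}_0}(1-x_b^{-1}z_k^{-1})}=\sum_{\lambda\in\mathbb{Z}^d_+}S^{\mathcal{A}/\mathcal{B}}_{\lambda}\,s_{\lambda}(z_1,\ldots,z_d).$$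
   Context: Partitions: $\lambda'$ is the conjugate of a partition $\lambda$, $\ell(\lambda)$ its number of nonzero parts; $s_{\lambda/\mu}$ is the skew Schur function ($0$ unless $\mu\subset\lambda$). Super Schur functions: for a $\mathbb{Z}_2$-graded set $\mathcal{A}=\mathcal{A}_0\sqcup\mathcal{A}_1$ (at most countable), $|a|$ is the degree of $a$, $\mathbf{x}_{\mathcal{A}}=\{x_a\mid a\in\mathcal{A}\}$, and $S_{\lambda/\mu}(\mathbf{x}_{\mathcal{A}})=\sum_{\mu\subset\nu\subset\lambda}s_{\nu/\mu}(\mathbf{x}_{\mathcal{A}_0})\,s_{\lambda'/\nu'}(\mathbf{x}_{\mathcal{A}_1})$, $S_\lambda=S_{\lambda/\emptyset}$. $S_{\lambda/\mu}(\mathbf{x}_{\mathcal{B}}^{-1})$ is defined likewise in the variables $x_b^{-1}$, $b\in\mathcal{B}$. Generalized partitions: $\mathbb{Z}^d_+=\{(\lambda_1,\ldots,\lambda_d)\in\mathbb{Z}^d\mid\lambda_1\ge\cdots\ge\lambda_d\}$; $(p^d)=(p,\ldots,p)$. The rational Schur polynomial is $s_\lambda(z_1,\ldots,z_d)=(z_1\cdots z_d)^{-p}s_{\lambda+(p^d)}(z_1,\ldots,z_d)$ for any $p\ge0$ with $\lambda+(p^d)$ a partition. Definition of $S^{\mathcal{A}/\mathcal{B}}_\lambda=S_\lambda(\mathbf{x}_{\mathcal{A}};\mathbf{x}_{\mathcal{B}})$: $S^{\mathcal{A}/\mathcal{B}}_\lambda=\sum S_{(\lambda+(p^d))/\eta}(\mathbf{x}_{\mathcal{A}})\,S_{(p^d)/\eta}(\mathbf{x}_{\mathcal{B}}^{-1})$,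 summed over pairs of skew diagrams $((\lambda+(p^d))/\eta,\ (p^d)/\eta)$ with $p\ge0$, $\lambda+(p^d)$ a partition and $\eta\subset\lambda+(p^d),(p^d)$, where $(p,\eta)$ and $(p+1,\eta+(1^d))$ give the same pair and are counted once; i.e. one term for each $\kappa=\eta-(p^d)\in\mathbb{Z}^d_+$ with $\kappa_i\le\min(\lambda_i,0)$ for all $i$. Here $x_a$ ($a\in\mathcal{A}$) and $x_b^{-1}$ ($b\in\mathcal{B}$) are independent variables; identities are in formal power series in the $x_a$ and $x_b^{-1}$ (with coefficients Laurent polynomials in the $z_k$ where $z_k$ occur), and inverse factors are expanded as geometric series in the $x_a$, $x_b^{-1}$. Group and cosets: let $\mathbb{Z}^\times=\mathbb{Z}\setminus\{0\}$ and $P=\bigoplus_{i\in\mathbb{Z}^\times}\mathbb{Z}\epsilon_i$. Let $r_i$ be the transposition of $\mathbb{Z}^\times$ given by $r_i=(i\ i{+}1)$ for $i>0$, $r_i=(i{-}1\ i)$ for $i<0$, $r_0=(-1\ 1)$. $W$ is the (Coxeter) group generated by all $r_i$, $i\in\mathbb{Z}$, with length $\ell$, acting on $P$ by $w\epsilon_i=\epsilon_{w(i)}$; $W_I=\langle r_i\mid i\in I\rangle$. $\mathcal{W}=\{w\in W\mid\ell(r_iw)>\ell(w)\text{ for all }i\in\mathbb{Z}^\times\}$. Definition of $\lambda^{w,\pm}$: for $\lambda\in\mathbb{Z}^d_+$, $w\in\mathcal{W}$, choose $p,q>0$ large enough that $-p\le\lambda_d\le\lambda_1\le q$ and $w\in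 W_{I(p,q)}$, $I(p,q)=\{k\in\mathbb{Z}\mid -p+1\le k\le q-1\}$. Put $\mu=(\lambda+(p^d))'=(\mu_1,\ldots,\mu_{p+q})$, identified with $\mu_1\epsilon_{-p}+\cdots+\mu_p\epsilon_{-1}+\mu_{p+1}\epsilon_1+\cdots+\mu_{p+q}\epsilon_q$; $\delta_{p,q}=\sum_{i=-p}^{-1}(q-i-1)\epsilon_i+\sum_{j=1}^q(q-j)\epsilon_j$; $\mathbf{1}^-_p=\sum_{i=-p}^{-1}\epsilon_i$. Then $w\circ\lambda=w(\mu+\delta_{p,q})-\delta_{p,q}-d\,\mathbf{1}^-_p$ is independent of $p,q$ and equals $-\sum_{i<0}\sigma_{-i}\epsilon_i+\sum_{j>0}\tau_j\epsilon_j$ for unique partitions $\sigma,\tau$. Set $\lambda^{w,-}=\sigma'$, $\lambda^{w,+}=\tau'$. *)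

theory Defs
  imports
    "HOL-Library.Multiset"
    "HOL-Library.Poly_Mapping"
    "HOL-Library.Countable_Set"
    "HOL-Library.FuncSet"
    "HOL-Combinatorics.Transposition"
    "HOL-Analysis.Infinite_Sum"
begin

section \<open>Formal power series in arbitrarily many variables\<close>

text \<open>
  A monomial in the variables \<^typ>\<open>'v\<close> is a multiset of variables, so a formal power series is
  an arbitrary coefficient function on finite multisets.
\<close>

typedef ('v, 'r) mfps = "UNIV :: ('v multiset \<Rightarrow> 'r) set"
  morphisms mcoeff Abs_mfps
  by simp

lemma mcoeff_Abs [simp]: "mcoeff (Abs_mfps f) M = f M"
  by (simp add: Abs_mfps_inverse)

lemma mfps_eq_iff: "f = g \<longleftrightarrow> (\<forall>M. mcoeff f M = mcoeff g M)"
  by (simp add: mcoeff_inject [symmetric] fun_eq_iff)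

definition mconst :: "'r::zero \<Rightarrow> ('v, 'r) mfps" where
  "mconst c = Abs_mfps (\<lambda>M. if M = {#} then c else 0)"

definition mvar :: "'v \<Rightarrow> ('v, 'r::zero_neq_one) mfps" where
  "mvar v = Abs_mfps (\<lambda>M. if M = {#v#} then 1 else 0)"

definition splits :: "'v multiset \<Rightarrow> ('v multiset \<times> 'v multiset) set" where
  "splits M = {(N, K). N + K = M}"

lemma finite_splits [simp]: "finite (splits M)"
proof -
  have fin: "finite {N. N \<subseteq># M}"
  proof (induction M)
    case empty
    show ?case by simp
  next
    case (add x M)
    have "{N. N \<subseteq># add_mset x M} \<subseteq> {N. N \<subseteq># M} \<union> add_mset x ` {N. N \<subseteq># M}"
    proof
      fix N assume N: "N \<in> {N. N \<subseteq># add_mset x M}"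
      show "N \<in> {N. N \<subseteq># M} \<union> add_mset x ` {N. N \<subseteq># M}"
      proof (cases "x \<in># N")
        case True
        then obtain N' where "N = add_mset x N'" by (meson mset_add)
        with N show ?thesis by auto
      next
        case False
        then have "N - {#x#} = N" by simp
        moreover have "N - {#x#} \<subseteq># M"
          using N by (simp add: subset_eq_diff_conv)
        ultimately show ?thesis by simp
      qed
    qed
    then show ?case using add finite_subset by blast
  qed
  have "splits M \<subseteq> (\<lambda>N. (N, M - N)) ` {N. N \<subseteq># M}"
    by (auto simp: splits_def)
  with fin show ?thesis by (meson finite_imageI finite_subset)
qed

instantiation mfps :: (type, comm_ring_1) comm_ring_1
begin

definition zero_mfps :: "('a, 'b) mfps" where "0 = mconst 0"
definition one_mfps :: "('a, 'b) mfps" where "1 = mconst 1"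
definition plus_mfps :: "('a, 'b) mfps \<Rightarrow> ('a, 'b) mfps \<Rightarrow> ('a, 'b) mfps" where
  "f + g = Abs_mfps (\<lambda>M. mcoeff f M + mcoeff g M)"
definition uminus_mfps :: "('a, 'b) mfps \<Rightarrow> ('a, 'b) mfps" where
  "- f = Abs_mfps (\<lambda>M. - mcoeff f M)"
definition minus_mfps :: "('a, 'b) mfps \<Rightarrow> ('a, 'b) mfps \<Rightarrow> ('a, 'b) mfps" where
  "f - g = Abs_mfps (\<lambda>M. mcoeff f M - mcoeff g M)"
definition times_mfps :: "('a, 'b) mfps \<Rightarrow> ('a, 'b) mfps \<Rightarrow> ('a, 'b) mfps" where
  "f * g = Abs_mfps (\<lambda>M. \<Sum>(N, K)\<in>splits M. mcoeff f N * mcoeff g K)"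

instance
proof
  fix f g h :: "('a, 'b) mfps"
  show "f + g + h = f + (g + h)" "f + g = g + f" "0 + f = f" "- f + f = 0" "f - g = f + - g"
    by (simp_all add: mfps_eq_iff plus_mfps_def zero_mfps_def mconst_def uminus_mfps_def
        minus_mfps_def add_ac)
  show "(0 :: ('a, 'b) mfps) \<noteq> 1"
    by (auto simp: mfps_eq_iff zero_mfps_def one_mfps_def mconst_def)
  show "(f + g) * h = f * h + g * h"
    by (simp add: mfps_eq_iff plus_mfps_def times_mfps_def distrib_right case_prod_unfold
        sum.distrib)
  show "f * g = g * f"
    unfolding mfps_eq_iff times_mfps_def mcoeff_Abs
    by (intro allI sum.reindex_bij_witness [where i = prod.swap and j = prod.swap])
       (auto simp: splits_def add.commute intro: mult.commute)
  show "1 * f = f"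
    unfolding mfps_eq_iff
  proof
    fix M
    have "mcoeff (1 * f) M = (\<Sum>(N, K)\<in>splits M. if N = {#} then mcoeff f K else 0)"
      by (auto simp: times_mfps_def one_mfps_def mconst_def intro!: sum.cong)
    also have "\<dots> = (\<Sum>(N, K)\<in>{({#} :: 'a multiset, M)}. if N = {#} then mcoeff f K else 0)"
      using finite_splits [of M]
      by (intro sum.mono_neutral_right) (auto simp: splits_def split: if_splits)
    finally show "mcoeff (1 * f) M = mcoeff f M" by simp
  qed
  show "f * g * h = f * (g * h)"
    unfolding mfps_eq_iff
  proof
    fix M
    have "mcoeff (f * g * h) M =
        (\<Sum>((N, K), (P, Q))\<in>Sigma (splits M) (\<lambda>(N, K). splits N).
           mcoeff f P * mcoeff g Q * mcoeff h K)"
      by (simp add: times_mfps_def sum_distrib_right case_prod_unfold sum.Sigma)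
    also have "\<dots> = (\<Sum>((P, R), (Q, K))\<in>Sigma (splits M) (\<lambda>(P, R). splits R).
           mcoeff f P * (mcoeff g Q * mcoeff h K))"
      by (rule sum.reindex_bij_witness
          [where i = "\<lambda>((P, R), (Q, K)). ((P + Q, K), (P, Q))"
             and j = "\<lambda>((N, K), (P, Q)). ((P, Q + K), (Q, K))"])
         (auto simp: splits_def add.assoc mult.assoc)
    also have "\<dots> = mcoeff (f * (g * h)) M"
      by (simp add: times_mfps_def sum_distrib_left case_prod_unfold sum.Sigma)
    finally show "mcoeff (f * g * h) M = mcoeff (f * (g * h)) M" .
  qed
qed

end

text \<open>
  A series with invertible constant term is a unit; its inverse is the one given by the geometric
  series expansion. Non-units get the junk value \<open>0\<close>.
\<close>

instantiation mfps :: (type, comm_ring_1) inverse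
begin

definition inverse_mfps :: "('a, 'b) mfps \<Rightarrow> ('a, 'b) mfps" where
  "inverse_mfps f = (if f dvd 1 then THE g. f * g = 1 else 0)"
definition divide_mfps :: "('a, 'b) mfps \<Rightarrow> ('a, 'b) mfps \<Rightarrow> ('a, 'b) mfps" where
  "divide_mfps f g = f * inverse g"

instance ..

end

text \<open>
  The topology of coefficientwise stabilisation (product of discrete topologies). It gives meaning
  to infinite sums and products of formal power series.
\<close>

instantiation mfps :: (type, type) topological_space
begin

definition open_mfps :: "('a, 'b) mfps set \<Rightarrow> bool" where
  "open U \<longleftrightarrow> (\<forall>f\<in>U. \<exists>F. finite F \<and> (\<forall>g. (\<forall>M\<in>F. mcoeff g M = mcoeff f M) \<longrightarrow> g \<in> U))"

instance
proof
  show "open (UNIV :: ('a, 'b) mfps set)"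
    by (auto simp: open_mfps_def)
next
  fix S T :: "('a, 'b) mfps set"
  assume ST: "open S" "open T"
  show "open (S \<inter> T)"
    unfolding open_mfps_def
  proof
    fix f assume "f \<in> S \<inter> T"
    then have f: "f \<in> S" "f \<in> T" by simp_all
    obtain F where F: "finite F" "\<And>g. (\<forall>M\<in>F. mcoeff g M = mcoeff f M) \<Longrightarrow> g \<in> S"
      using ST(1) f(1) unfolding open_mfps_def by blast
    obtain G where G: "finite G" "\<And>g. (\<forall>M\<in>G. mcoeff g M = mcoeff f M) \<Longrightarrow> g \<in> T"
      using ST(2) f(2) unfolding open_mfps_def by blast
    from F G show "\<exists>F. finite F \<and> (\<forall>g. (\<forall>M\<in>F. mcoeff g M = mcoeff f M) \<longrightarrow> g \<in> S \<inter> T)"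
      by (intro exI [of _ "F \<union> G"]) auto
  qed
next
  fix K :: "('a, 'b) mfps set set"
  assume "\<forall>S\<in>K. open S"
  then show "open (\<Union>K)"
    unfolding open_mfps_def
  proof (intro ballI)
    fix f assume "f \<in> \<Union>K" and K: "\<forall>S\<in>K. \<forall>f\<in>S. \<exists>F. finite F \<and>
        (\<forall>g. (\<forall>M\<in>F. mcoeff g M = mcoeff f M) \<longrightarrow> g \<in> S)"
    then obtain S where S: "S \<in> K" "f \<in> S" by blast
    with K obtain F where "finite F" "\<forall>g. (\<forall>M\<in>F. mcoeff g M = mcoeff f M) \<longrightarrow> g \<in> S"
      by (metis (no_types, lifting))
    with S show "\<exists>F. finite F \<and> (\<forall>g. (\<forall>M\<in>F. mcoeff g M = mcoeff f M) \<longrightarrow> g \<in> \<Union>K)"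
      by (intro exI [of _ F]) blast
  qed
qed

end

instance mfps :: (type, type) t2_space
proof
  fix f g :: "('a, 'b) mfps"
  assume "f \<noteq> g"
  then obtain M where M: "mcoeff f M \<noteq> mcoeff g M"
    by (auto simp: mfps_eq_iff)
  have "open {h :: ('a, 'b) mfps. mcoeff h M = c}" for c
    by (auto simp: open_mfps_def intro!: exI [of _ "{M}"])
  with M show "\<exists>U V. open U \<and> open V \<and> f \<in> U \<and> g \<in> V \<and> U \<inter> V = {}"
    by (intro exI [of _ "{h. mcoeff h M = mcoeff f M}"] exI [of _ "{h. mcoeff h M = mcoeff g M}"])
       auto
qed

definition infprod :: "('i \<Rightarrow> 'c::{comm_monoid_mult, t2_space}) \<Rightarrow> 'i set \<Rightarrow> 'c" where
  "infprod f I = Lim (finite_subsets_at_top I) (prod f)"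


section \<open>Partitions\<close>

text \<open>
  A partition is a weakly decreasing, eventually zero function; indices start at \<open>0\<close>, so the
  part \<open>\<lambda>\<^sub>i\<close> is \<open>la (i - 1)\<close>. Containment of diagrams is the pointwise order \<open>\<le>\<close> on functions.
\<close>

definition is_partition :: "(nat \<Rightarrow> nat) \<Rightarrow> bool" where
  "is_partition la \<longleftrightarrow> antimono la \<and> finite {i. la i \<noteq> 0}"

definition empty_partition :: "nat \<Rightarrow> nat" where
  "empty_partition = (\<lambda>_. 0)"

definition conj_partition :: "(nat \<Rightarrow> nat) \<Rightarrow> nat \<Rightarrow> nat" where
  "conj_partition la j = card {i. j < la i}"

definition skew_diagram :: "(nat \<Rightarrow> nat) \<Rightarrow> (nat \<Rightarrow> nat) \<Rightarrow> (nat \<times> nat) set" where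
  "skew_diagram la mu = {(i, j). mu i \<le> j \<and> j < la i}"

text \<open>
  Elements of \<open>\<int>\<^sup>d\<^sub>+\<close>; again \<open>\<lambda>\<^sub>i\<close> is \<open>l ! (i - 1)\<close>.
\<close>

definition gen_partitions :: "nat \<Rightarrow> int list set" where
  "gen_partitions d = {l. length l = d \<and> sorted_wrt (\<ge>) l}"

text \<open>\<open>\<lambda> + (p\<^sup>d)\<close>, meaningful only if all \<open>\<lambda>\<^sub>i + p\<close> are nonnegative.\<close>

definition shift :: "int list \<Rightarrow> nat \<Rightarrow> nat \<Rightarrow> nat" where
  "shift l p i = (if i < length l then nat (l ! i + int p) else 0)"

definition rect :: "nat \<Rightarrow> nat \<Rightarrow> nat \<Rightarrow> nat" where
  "rect d p i = (if i < d then p else 0)"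

definition min_shift :: "int list \<Rightarrow> nat" where
  "min_shift l = (LEAST p. \<forall>i<length l. 0 \<le> l ! i + int p)"


section \<open>Schur functions\<close>

text \<open>
  Semistandard tableaux of shape \<open>la / mu\<close> with entries in a countable alphabet \<open>I\<close>, which is linearly
  ordered through the library's enumeration \<^const>\<open>to_nat_on\<close>. (Skew Schur functions are symmetric, so
  they do not depend on the order.)
\<close>

definition ssyt :: "'i set \<Rightarrow> (nat \<Rightarrow> nat) \<Rightarrow> (nat \<Rightarrow> nat) \<Rightarrow> (nat \<times> nat \<Rightarrow> 'i) set" where
  "ssyt I la mu = {T \<in> skew_diagram la mu \<rightarrow>\<^sub>E I.
     (\<forall>i j j'. (i, j) \<in> skew_diagram la mu \<and> (i, j') \<in> skew_diagram la mu \<and> j < j' \<longrightarrow>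
        to_nat_on I (T (i, j)) \<le> to_nat_on I (T (i, j'))) \<and>
     (\<forall>i i' j. (i, j) \<in> skew_diagram la mu \<and> (i', j) \<in> skew_diagram la mu \<and> i < i' \<longrightarrow>
        to_nat_on I (T (i, j)) < to_nat_on I (T (i', j)))}"

text \<open>\<open>s\<^bsub>la/mu\<^esub>\<close> in the family of variables \<open>x i\<close>, \<open>i \<in> I\<close>.\<close>

definition skew_schur ::
    "('i \<Rightarrow> 'c::{comm_ring_1, t2_space}) \<Rightarrow> 'i set \<Rightarrow> (nat \<Rightarrow> nat) \<Rightarrow> (nat \<Rightarrow> nat) \<Rightarrow> 'c" where
  "skew_schur x I la mu =
     (if mu \<le> la then \<Sum>\<^sub>\<infinity>T\<in>ssyt I la mu. \<Prod>c\<in>skew_diagram la mu. x (T c) else 0)"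

definition skew_super_schur ::
    "('i \<Rightarrow> 'c::{comm_ring_1, t2_space}) \<Rightarrow> 'i set \<Rightarrow> 'i set \<Rightarrow>
      (nat \<Rightarrow> nat) \<Rightarrow> (nat \<Rightarrow> nat) \<Rightarrow> 'c" where
  "skew_super_schur x I0 I1 la mu =
     (\<Sum>nu | is_partition nu \<and> mu \<le> nu \<and> nu \<le> la.
        skew_schur x I0 nu mu * skew_schur x I1 (conj_partition la) (conj_partition nu))"

definition super_schur ::
    "('i \<Rightarrow> 'c::{comm_ring_1, t2_space}) \<Rightarrow> 'i set \<Rightarrow> 'i set \<Rightarrow> (nat \<Rightarrow> nat) \<Rightarrow> 'c" where
  "super_schur x I0 I1 la = skew_super_schur x I0 I1 la empty_partition"

text \<open>
  The independent variables \<open>x\<^sub>a\<close> (\<open>a \<in> \<A>\<close>) and \<open>x\<^sub>b\<^sup>-\<^sup>1\<close> (\<open>b \<in> \<B>\<close>); the sum type keeps them apart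
  even if \<open>\<A>\<close> and \<open>\<B>\<close> are not disjoint.
\<close>

definition xA :: "'a \<Rightarrow> ('a + 'b, 'r::comm_ring_1) mfps" where
  "xA a = mvar (Inl a)"

definition xB_inv :: "'b \<Rightarrow> ('a + 'b, 'r::comm_ring_1) mfps" where
  "xB_inv b = mvar (Inr b)"

text \<open>
  \<open>S\<^sub>\<lambda>\<^bsup>\<A>/\<B>\<^esup>\<close>: the class of \<open>(p, \<eta>)\<close> modulo \<open>(p, \<eta>) \<sim> (p + 1, \<eta> + (1\<^sup>d))\<close> is given by
  \<open>k = \<eta> - (p\<^sup>d)\<close>, and the summand is evaluated at the representative with the least \<open>p\<close>.
\<close>

definition rational_super_schur ::
    "'a set \<Rightarrow> 'a set \<Rightarrow> 'b set \<Rightarrow> 'b set \<Rightarrow> nat \<Rightarrow> int list \<Rightarrow> ('a + 'b, 'r::comm_ring_1) mfps" where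
  "rational_super_schur A0 A1 B0 B1 d l =
     (\<Sum>\<^sub>\<infinity>k \<in> {k \<in> gen_partitions d. \<forall>i<d. k ! i \<le> min (l ! i) 0}.
        let p = min_shift k; eta = shift k p in
          skew_super_schur xA A0 A1 (shift l p) eta *
          skew_super_schur xB_inv B0 B1 (rect d p) eta)"

definition Delta ::
    "'a set \<Rightarrow> 'a set \<Rightarrow> 'b set \<Rightarrow> 'b set \<Rightarrow> ('a + 'b, 'r::comm_ring_1) mfps" where
  "Delta A0 A1 B0 B1 =
     infprod (\<lambda>(a, b). 1 - xA a * xB_inv b) (A0 \<times> B0 \<union> A1 \<times> B1) /
     infprod (\<lambda>(a, b). 1 + xA a * xB_inv b) (A0 \<times> B1 \<union> A1 \<times> B0)"

text \<open>
  Laurent polynomials over \<open>\<int>\<close> in \<open>z\<^sub>1, z\<^sub>2, \<dots>\<close>, regarded as constants of the power series ring.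
\<close>

type_synonym laurent = "(nat \<Rightarrow>\<^sub>0 int) \<Rightarrow>\<^sub>0 int"

definition zvar :: "nat \<Rightarrow> ('v, laurent) mfps" where
  "zvar k = mconst (Poly_Mapping.single (Poly_Mapping.single k 1) 1)"

definition zvar_inv :: "nat \<Rightarrow> ('v, laurent) mfps" where
  "zvar_inv k = mconst (Poly_Mapping.single (Poly_Mapping.single k (- 1)) 1)"

definition rational_schur :: "nat \<Rightarrow> int list \<Rightarrow> ('v, laurent) mfps" where
  "rational_schur d l =
     (let p = min_shift l in
        (\<Prod>k\<in>{1..d}. zvar_inv k) ^ p * skew_schur zvar {1..d} (shift l p) empty_partition)"


section \<open>The Coxeter group and the action on weights\<close>

text \<open>Permutations of \<open>\<int>\<^sup>\<times>\<close> are represented as permutations of \<^typ>\<open>int\<close> fixing \<open>0\<close>.\<close>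

definition reflect :: "int \<Rightarrow> int \<Rightarrow> int" where
  "reflect i = (if i > 0 then transpose i (i + 1)
             else if i < 0 then transpose (i - 1) i
             else transpose (- 1) 1)"

definition word_perm :: "int list \<Rightarrow> int \<Rightarrow> int" where
  "word_perm ws = foldr (\<lambda>i w. reflect i \<circ> w) ws id"

definition W_on :: "int set \<Rightarrow> (int \<Rightarrow> int) set" where
  "W_on I = word_perm ` lists I"

definition cox_length :: "(int \<Rightarrow> int) \<Rightarrow> nat" where
  "cox_length w = (LEAST n. \<exists>ws. length ws = n \<and> word_perm ws = w)"

definition coset_reps :: "(int \<Rightarrow> int) set" where
  "coset_reps = {w \<in> W_on UNIV. \<forall>i. i \<noteq> 0 \<longrightarrow> cox_length (reflect i \<circ> w) > cox_length w}"

text \<open>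
  Weights \<open>\<Sum>\<^sub>i v\<^sub>i \<epsilon>\<^sub>i\<close> are represented by their coefficient functions; \<open>w \<epsilon>\<^sub>i = \<epsilon>\<^bsub>w(i)\<^esub>\<close> means that the
  coefficient of \<open>\<epsilon>\<^sub>j\<close> in \<open>w v\<close> is the coefficient of \<open>\<epsilon>\<^bsub>w\<^sup>-\<^sup>1(j)\<^esub>\<close> in \<open>v\<close>.
\<close>

definition weight_act :: "(int \<Rightarrow> int) \<Rightarrow> (int \<Rightarrow> int) \<Rightarrow> int \<Rightarrow> int" where
  "weight_act w v = v \<circ> inv w"

definition partition_weight :: "nat \<Rightarrow> nat \<Rightarrow> (nat \<Rightarrow> nat) \<Rightarrow> int \<Rightarrow> int" where
  "partition_weight p q mu i =
     (if - int p \<le> i \<and> i < 0 then int (mu (nat (i + int p)))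
      else if 0 < i \<and> i \<le> int q then int (mu (nat (i + int p - 1)))
      else 0)"

definition delta_weight :: "nat \<Rightarrow> nat \<Rightarrow> int \<Rightarrow> int" where
  "delta_weight p q i =
     (if - int p \<le> i \<and> i < 0 then int q - i - 1
      else if 0 < i \<and> i \<le> int q then int q - i
      else 0)"

definition ones_neg :: "nat \<Rightarrow> int \<Rightarrow> int" where
  "ones_neg p i = (if - int p \<le> i \<and> i < 0 then 1 else 0)"

definition large_enough :: "(int \<Rightarrow> int) \<Rightarrow> int list \<Rightarrow> nat \<times> nat \<Rightarrow> bool" where
  "large_enough w l = (\<lambda>(p, q). p > 0 \<and> q > 0 \<and>
     (\<forall>x\<in>set l. - int p \<le> x \<and> x \<le> int q) \<and> w \<in> W_on {- int p + 1 .. int q - 1})"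

text \<open>\<open>w \<circ> \<lambda>\<close>; the value does not depend on the choice of \<open>(p, q)\<close>.\<close>

definition circ_act :: "(int \<Rightarrow> int) \<Rightarrow> int list \<Rightarrow> int \<Rightarrow> int" where
  "circ_act w l =
     (let (p, q) = (SOME pq. large_enough w l pq);
          mu = conj_partition (shift l p)
      in (\<lambda>i. weight_act w (\<lambda>j. partition_weight p q mu j + delta_weight p q j) i
              - delta_weight p q i - int (length l) * ones_neg p i))"

text \<open>
  \<open>w \<circ> \<lambda> = - \<Sum>\<^bsub>i<0\<^esub> \<sigma>\<^bsub>-i\<^esub> \<epsilon>\<^sub>i + \<Sum>\<^bsub>j>0\<^esub> \<tau>\<^sub>j \<epsilon>\<^sub>j\<close> for \<open>w\<close> in \<^const>\<open>coset_reps\<close>, so that \<^const>\<open>nat\<close> does not truncate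
  below.
\<close>

definition lam_minus :: "(int \<Rightarrow> int) \<Rightarrow> int list \<Rightarrow> nat \<Rightarrow> nat" where
  "lam_minus w l = conj_partition (\<lambda>i. nat (- circ_act w l (- int i - 1)))"

definition lam_plus :: "(int \<Rightarrow> int) \<Rightarrow> int list \<Rightarrow> nat \<Rightarrow> nat" where
  "lam_plus w l = conj_partition (\<lambda>j. nat (circ_act w l (int j + 1)))"

end

theory Submission
  imports Defs "HOL-Combinatorics.Permutations" "HOL-Computational_Algebra.Formal_Power_Series"
begin

text \<open>
  The proof turns every object of the statement into a determinant in the coefficients of the
  series \<open>H\<^sub>A(t) = \<Prod>\<^bsub>A1\<^esub> (1 + x\<^sub>a t) / \<Prod>\<^bsub>A0\<^esub> (1 - x\<^sub>a t) = \<Sum> h\<^sub>n t\<^sup>n\<close> and \<open>H\<^sub>B(t)\<close>, the latter in the variables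
  \<open>x\<^sub>b\<^sup>-\<^sup>1\<close>. Put \<open>F(t) = H\<^sub>A(t) H\<^sub>B(1/t) = \<Sum> f\<^sub>n t\<^sup>n\<close>, with \<open>n\<close> running over all integers.

  Removing the letters of a tableau one at a time gives the Jacobi-Trudi identity
  \<open>S\<^bsub>\<lambda>/\<mu>\<^esub> = det (h\<^bsub>\<lambda>\<^sub>i - \<mu>\<^sub>j - i + j\<^esub>)\<close> and, for the conjugate shape, \<open>S\<^bsub>\<lambda>'\<^esub> = det (e\<^bsub>\<lambda>\<^sub>i - i + j\<^esub>)\<close> with
  \<open>\<Sum> e\<^sub>n t\<^sup>n = 1 / H(- t)\<close>; the Cauchy-Binet formula composes the one-letter steps. Applied to the sum over
  \<open>\<kappa>\<close> that defines the rational super Schur function, Cauchy-Binet yields the \<open>d \<times> d\<close> determinant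
  \<open>S\<^sub>\<lambda> = det (f\<^bsub>\<lambda>\<^sub>i - i + j\<^esub>)\<close> (\<open>rational_super_schur_det\<close>).

  The Cauchy identity is one more use of Cauchy-Binet. By the bialternant formula \<open>s\<^sub>\<lambda>(z)\<close> times the
  Vandermonde determinant is \<open>det (z\<^sub>k\<^bsup>\<lambda>\<^sub>i + d - i\<^esup>)\<close>, and the sum over \<open>\<lambda>\<close> of \<open>S\<^sub>\<lambda>\<close> times these alternants is
  \<open>det (z\<^sub>k\<^bsup>d - i\<^esup> F(z\<^sub>k))\<close>, the Vandermonde determinant times \<open>\<Prod> F(z\<^sub>k)\<close>. The Vandermonde determinant cancels
  because Laurent polynomials over the integers have no zero divisors.

  For the character formula, the coset representatives are the permutations \<open>w\<close> of finite support of the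
  nonzero integers whose inverse increases on the positive and on the negative numbers, and \<open>(- 1)\<^bsup>\<ell>(w)\<^esup>\<close> is the sign of \<open>w\<close>.
  So the alternating sum of products of two conjugate Jacobi-Trudi determinants is the Laplace
  expansion of a single determinant (\<open>numerator_det\<close>). Its columns belong to a decreasing sequence of
  integers that misses exactly the \<open>d\<close> numbers \<open>i - 1 - \<lambda>\<^sub>i\<close>. Adding \<open>d\<close> rows that pick out the missing
  numbers gives a matrix indexed by an interval of integers whose rows are, up to signs, coefficients
  of \<open>t\<^sup>r / H\<^sub>A(t)\<close>, coefficients of \<open>t\<^sup>r / H\<^sub>B(1/t)\<close>, and unit vectors. Its product with the Toeplitz matrix
  \<open>T = (f\<^bsub>c - r\<^esub>)\<close> is block triangular with unit diagonal, except for the block \<open>(f\<^bsub>\<lambda>\<^sub>i - i + j\<^esub>)\<close>. Hence the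
  alternating sum times \<open>det T\<close> is \<open>S\<^sub>\<lambda>\<close> (\<open>col_matrix_det\<close>). Finally \<open>det T\<close> is the inverse of \<open>\<Delta>\<close>
  (\<open>Toeplitz_Delta\<close>, a limit theorem of Szego type): a new letter of \<open>A\<close> changes the symbol by a linear
  factor in \<open>t\<close> or its inverse, and thereby \<open>det T\<close> by a value of the series \<open>1 / H\<^sub>B\<close> or its inverse.

  The last two steps hold for infinite matrices only. They are carried out on finite intervals,
  where they are true up to terms of high degree: all identities are proved modulo the monomials
  that do not divide a given monomial \<open>M\<close> (\<open>mcong\<close>), for every \<open>M\<close>. Modulo \<open>M\<close> only finitely many letters
  matter, which also reduces countable alphabets to finite ones.
\<close>

unbundle fps_syntax

section \<open>Determinants over finite index sets\<close>

text \<open>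
  The Leibniz formula over an arbitrary finite index set. The matrices below are indexed by
  intervals of integers whose length depends on the degree of truncation.
\<close>

definition DET :: "'i set \<Rightarrow> ('i \<Rightarrow> 'i \<Rightarrow> 'c::comm_ring_1) \<Rightarrow> 'c" where
  "DET I M = (\<Sum>p | p permutes I. of_int (sign p) * (\<Prod>i\<in>I. M i (p i)))"

lemma DET_cong:
  assumes "\<And>i j. i \<in> I \<Longrightarrow> j \<in> I \<Longrightarrow> M i j = M' i j"
  shows "DET I M = DET I M'"
  unfolding DET_def
  by (intro sum.cong refl arg_cong2 [where f = "(*)"] prod.cong)
     (auto simp: assms permutes_in_image)

lemma DET_empty [simp]: "DET {} M = 1"
  by (simp add: DET_def)

lemma DET_transpose:
  assumes "finite I"
  shows "DET I (\<lambda>i j. M j i) = DET I M"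
proof -
  have "DET I (\<lambda>i j. M j i)
      = (\<Sum>p | p permutes I. of_int (sign (inv p)) * (\<Prod>i\<in>I. M (inv p i) i))"
    unfolding DET_def by (rule sum_permutations_inverse)
  also have "\<dots> = DET I M"
    unfolding DET_def
  proof (rule sum.cong [OF refl])
    fix p assume "p \<in> {p. p permutes I}"
    then have p: "p permutes I" by simp
    have "(\<Prod>i\<in>I. M (inv p i) i) = (\<Prod>i\<in>I. M (inv p (p i)) (p i))"
        using prod.permute [OF p, of "\<lambda>i. M (inv p i) i"] by (simp add: o_def)
    also have "\<dots> = (\<Prod>i\<in>I. M i (p i))"
      by (simp add: permutes_inverses [OF p])
    finally show "of_int (sign (inv p)) * (\<Prod>i\<in>I. M (inv p i) i)
        = of_int (sign p) * (\<Prod>i\<in>I. M i (p i))"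
      using p assms by (simp add: sign_inverse permutes_imp_permutation)
  qed
  finally show ?thesis .
qed

lemma DET_permute_columns:
  assumes "finite I" and q: "q permutes I"
  shows "DET I (\<lambda>i j. M i (q j)) = of_int (sign q) * DET I M"
proof -
  have "DET I M = (\<Sum>p | p permutes I. of_int (sign (q \<circ> p)) * (\<Prod>i\<in>I. M i ((q \<circ> p) i)))"
    unfolding DET_def by (rule setum_permutations_compose_left [OF q])
  also have "\<dots> = (\<Sum>p | p permutes I. of_int (sign q) * (of_int (sign p) * (\<Prod>i\<in>I. M i (q (p i)))))"
    using assms by (intro sum.cong refl) (auto simp: sign_compose permutes_imp_permutation mult.assoc)
  finally have "of_int (sign q) * DET I M
      = of_int (sign q) * (of_int (sign q) * DET I (\<lambda>i j. M i (q j)))"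
    by (simp add: DET_def sum_distrib_left)
  then show ?thesis by (cases q rule: sign_cases) auto
qed

lemma DET_permute_rows:
  assumes "finite I" and q: "q permutes I"
  shows "DET I (\<lambda>i j. M (q i) j) = of_int (sign q) * DET I M"
  using DET_permute_columns [OF assms, of "\<lambda>i j. M j i"] DET_transpose [OF assms(1)]
  by metis

text \<open>
  The permutations \<open>p\<close> and \<open>p \<circ> (a b)\<close> have equal products and opposite signs. Splitting the sum by
  parity instead of comparing it with its negative covers rings of characteristic 2.
\<close>

lemma DET_equal_rows:
  assumes I: "finite I" "a \<in> I" "b \<in> I" "a \<noteq> b"
    and eq: "\<And>j. j \<in> I \<Longrightarrow> M a j = M b j"
  shows "DET I M = 0"
proof -
  let ?t = "transpose a b"
  let ?E = "{p. p permutes I \<and> evenperm p}" and ?O = "{p. p permutes I \<and> \<not> evenperm p}"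
  have t: "?t permutes I" using I by (simp add: permutes_swap_id)
  have fin: "finite {p. p permutes I}" using I by (simp add: finite_permutations)
  have sgn: "evenperm (p \<circ> ?t) \<longleftrightarrow> \<not> evenperm p" if "p permutes I" for p
    using that I by (subst evenperm_comp)
      (auto simp: permutes_imp_permutation [OF I(1)] permutation_swap_id evenperm_swap)
  have prd: "(\<Prod>i\<in>I. M i ((p \<circ> ?t) i)) = (\<Prod>i\<in>I. M i (p i))" if p: "p permutes I" for p
  proof -
    have "(\<Prod>i\<in>I. M i ((p \<circ> ?t) i)) = (\<Prod>i\<in>I. M (?t i) ((p \<circ> ?t) (?t i)))"
      using prod.permute [OF t, of "\<lambda>i. M i ((p \<circ> ?t) i)"] by (simp add: o_def)
    also have "\<dots> = (\<Prod>i\<in>I. M i (p i))"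
      using p I eq by (intro prod.cong refl) (auto simp: transpose_def permutes_in_image)
    finally show ?thesis .
  qed
  have split: "{p. p permutes I} = ?E \<union> ?O" by auto
  have "DET I M = (\<Sum>p\<in>?E. of_int (sign p) * (\<Prod>i\<in>I. M i (p i)))
      + (\<Sum>p\<in>?O. of_int (sign p) * (\<Prod>i\<in>I. M i (p i)))"
    unfolding DET_def using fin by (subst split, intro sum.union_disjoint) auto
  also have "(\<Sum>p\<in>?O. of_int (sign p) * (\<Prod>i\<in>I. M i (p i)))
      = (\<Sum>p\<in>?E. of_int (sign (p \<circ> ?t)) * (\<Prod>i\<in>I. M i ((p \<circ> ?t) i)))"
    by (rule sum.reindex_bij_witness [where i = "\<lambda>p. p \<circ> ?t" and j = "\<lambda>p. p \<circ> ?t"])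
       (auto simp: sgn permutes_compose [OF t] o_assoc [symmetric])
  also have "\<dots> = - (\<Sum>p\<in>?E. of_int (sign p) * (\<Prod>i\<in>I. M i (p i)))"
    unfolding sum_negf [symmetric]
  proof (intro sum.cong refl)
    fix p assume p: "p \<in> ?E"
    then have "sign (p \<circ> ?t) = - sign p" using sgn [of p] by (simp add: sign_def)
    then show "of_int (sign (p \<circ> ?t)) * (\<Prod>i\<in>I. M i ((p \<circ> ?t) i))
        = - (of_int (sign p) * (\<Prod>i\<in>I. M i (p i)))"
      using prd [of p] p by simp
  qed
  finally show ?thesis by simp
qed

lemma DET_scale_rows:
  "DET I (\<lambda>i j. a i * M i j) = (\<Prod>i\<in>I. a i) * DET I M"
  by (simp add: DET_def prod.distrib sum_distrib_left mult_ac)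

lemma DET_scale_columns:
  assumes "finite I"
  shows "DET I (\<lambda>i j. a j * M i j) = (\<Prod>i\<in>I. a i) * DET I M"
  using DET_scale_rows [of I a "\<lambda>i j. M j i"] DET_transpose [OF assms, of "\<lambda>i j. a j * M i j"]
    DET_transpose [OF assms, of M]
  by simp

lemma DET_zero_row:
  assumes "finite I" "r \<in> I" "\<And>c. c \<in> I \<Longrightarrow> M r c = 0"
  shows "DET I M = 0"
  unfolding DET_def
proof (intro sum.neutral ballI)
  fix p assume "p \<in> {p. p permutes I}"
  then have "M r (p r) = 0" using assms by (simp add: permutes_in_image)
  then have "(\<Prod>i\<in>I. M i (p i)) = 0" using assms(1,2) by (intro prod_zero) auto
  then show "of_int (sign p) * (\<Prod>i\<in>I. M i (p i)) = 0" by simp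
qed

lemma DET_remove:
  assumes I: "finite I" "r \<in> I" and z: "\<And>c. c \<in> I \<Longrightarrow> c \<noteq> r \<Longrightarrow> M r c = 0"
  shows "DET I M = M r r * DET (I - {r}) M"
proof -
  have "{p. p permutes I - {r}} \<subseteq> {p. p permutes I}"
    by (auto intro: permutes_subset)
  moreover have "finite {p. p permutes I}" using I by (simp add: finite_permutations)
  moreover have "of_int (sign p) * (\<Prod>i\<in>I. M i (p i)) = 0"
    if p: "p \<in> {p. p permutes I} - {p. p permutes I - {r}}" for p
  proof -
    have "p r \<noteq> r" using p permutes_superset [of p I "I - {r}"] by auto
    then have "M r (p r) = 0" using z p I by (auto simp: permutes_in_image)
    then have "(\<Prod>i\<in>I. M i (p i)) = 0" using I by (intro prod_zero) auto
    then show ?thesis by simp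
  qed
  ultimately have "DET I M = (\<Sum>p | p permutes I - {r}. of_int (sign p) * (\<Prod>i\<in>I. M i (p i)))"
    unfolding DET_def by (intro sum.mono_neutral_right) auto
  also have "\<dots> = (\<Sum>p | p permutes I - {r}. M r r * (of_int (sign p) * (\<Prod>i\<in>I - {r}. M i (p i))))"
    using I by (intro sum.cong refl) (auto simp: prod.remove permutes_not_in mult_ac)
  finally show ?thesis by (simp add: DET_def sum_distrib_left)
qed

lemma DET_remove_column:
  assumes I: "finite I" "r \<in> I" and z: "\<And>c. c \<in> I \<Longrightarrow> c \<noteq> r \<Longrightarrow> M c r = 0"
  shows "DET I M = M r r * DET (I - {r}) M"
proof -
  have "DET I M = DET I (\<lambda>i j. M j i)" using DET_transpose [OF I(1)] by metis
  also have "\<dots> = M r r * DET (I - {r}) (\<lambda>i j. M j i)"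
    using DET_remove [of I r "\<lambda>i j. M j i"] assms by blast
  also have "DET (I - {r}) (\<lambda>i j. M j i) = DET (I - {r}) M"
    using I by (intro DET_transpose) simp
  finally show ?thesis .
qed

lemma DET_lower_triangular:
  fixes I :: "'i::linorder set"
  assumes "finite I" "\<And>r c. r \<in> I \<Longrightarrow> c \<in> I \<Longrightarrow> r < c \<Longrightarrow> M r c = 0"
  shows "DET I M = (\<Prod>r\<in>I. M r r)"
  using assms
proof (induction I rule: finite_linorder_max_induct)
  case empty
  then show ?case by simp
next
  case (insert b A)
  have "b \<notin> A" using insert.hyps by auto
  have "DET (insert b A) M = M b b * DET (insert b A - {b}) M"
    using insert by (intro DET_remove_column) auto
  with insert \<open>b \<notin> A\<close> show ?case by simp
qed

lemma DET_upper_triangular: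
  fixes I :: "'i::linorder set"
  assumes "finite I" "\<And>r c. r \<in> I \<Longrightarrow> c \<in> I \<Longrightarrow> c < r \<Longrightarrow> M r c = 0"
  shows "DET I M = (\<Prod>r\<in>I. M r r)"
  using DET_lower_triangular [of I "\<lambda>i j. M j i"] DET_transpose [of I M] assms by metis

lemma DET_reindex:
  assumes f: "bij_betw f I J" and I: "finite I"
  shows "DET J M = DET I (\<lambda>i j. M (f i) (f j))"
proof -
  have inj: "inj_on f I" and J: "J = f ` I" using f by (auto simp: bij_betw_def)
  let ?m = "map_permutation I f"
  have "DET I (\<lambda>i j. M (f i) (f j))
      = (\<Sum>p | p permutes I. of_int (sign (?m p)) * (\<Prod>j\<in>J. M j (?m p j)))"
    unfolding DET_def
  proof (intro sum.cong refl)
    fix p assume "p \<in> {p. p permutes I}"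
    then have p: "p permutes I" by simp
    have "(\<Prod>j\<in>J. M j (?m p j)) = (\<Prod>i\<in>I. M (f i) (?m p (f i)))"
      unfolding J by (subst prod.reindex [OF inj]) (simp add: o_def)
    also have "\<dots> = (\<Prod>i\<in>I. M (f i) (f (p i)))"
      by (intro prod.cong refl) (simp add: map_permutation_apply [OF inj])
    finally show "of_int (sign p) * (\<Prod>i\<in>I. M (f i) (f (p i)))
        = of_int (sign (?m p)) * (\<Prod>j\<in>J. M j (?m p j))"
      by (simp add: sign_map_permutation [OF inj p I])
  qed
  also have "\<dots> = DET J M"
    unfolding DET_def
  proof (rule sum.reindex_bij_witness [where i = "map_permutation J (inv_into I f)" and j = ?m])
    fix p assume "p \<in> {p. p permutes I}"
    then have p: "p permutes I" by simp
    show "map_permutation J (inv_into I f) (?m p) = p"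
      using map_permutation_compose_inv [OF f p, of "inv_into I f"] inj by simp
    show "?m p \<in> {p. p permutes J}"
      using map_permutation_permutes [OF f p] by simp
  next
    fix p assume "p \<in> {p. p permutes J}"
    then have p: "p permutes J" by simp
    have g: "bij_betw (inv_into I f) J I" by (rule bij_betw_inv_into [OF f])
    show "?m (map_permutation J (inv_into I f) p) = p"
      using map_permutation_compose_inv [OF g p, of f] inj J by (simp add: f_inv_into_f)
    show "map_permutation J (inv_into I f) p \<in> {p. p permutes I}"
      using map_permutation_permutes [OF g p] by simp
  qed auto
  finally show ?thesis by simp
qed

text \<open>
  Sorting supplies canonical representatives in the expansions of determinants below: an
  injective family can be put in increasing order, and by \<open>sort_unique\<close> in one way only.
\<close>

lemma sort_injective:
  fixes I :: "'i::linorder set" and g :: "'i \<Rightarrow> 'b::linorder"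
  assumes "finite I" "inj_on g I"
  shows "\<exists>u. u permutes I \<and> strict_mono_on I (g \<circ> u)"
  using assms
proof (induction I arbitrary: g rule: finite_linorder_max_induct)
  case empty
  then show ?case by (intro exI [of _ id]) (auto simp: strict_mono_on_def)
next
  case (insert b A)
  let ?I = "insert b A"
  have "Max (g ` ?I) \<in> g ` ?I" using insert.hyps by (intro Max_in) auto
  then obtain a where a: "a \<in> ?I" "Max (g ` ?I) = g a" by auto
  then have ge: "g x \<le> g a" if "x \<in> ?I" for x
    using that insert.hyps(1) by (metis Max_ge finite_imageI finite_insert imageI)
  let ?t = "transpose b a"
  have t: "?t permutes ?I" using a by (intro permutes_swap_id) auto
  have "inj_on (g \<circ> ?t) ?I"
    using insert.prems permutes_image [OF t] permutes_inj_on [OF t] by (intro comp_inj_on) auto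
  then have "inj_on (g \<circ> ?t) A" by (rule inj_on_subset) auto
  from insert.IH [OF this] obtain u where
    u: "u permutes A" "strict_mono_on A (g \<circ> ?t \<circ> u)" by blast
  have u': "u permutes ?I" using u(1) by (rule permutes_subset) auto
  have "b \<notin> A" using insert.hyps by auto
  then have ub: "u b = b" using u(1) by (simp add: permutes_not_in)
  have tu: "?t \<circ> u permutes ?I" by (rule permutes_compose [OF u' t])
  have "strict_mono_on ?I (g \<circ> (?t \<circ> u))"
  proof (intro strict_mono_onI)
    fix r s assume rs: "r \<in> ?I" "s \<in> ?I" "r < s"
    then have r: "r \<in> A" using insert.hyps by (auto dest: less_asym)
    show "(g \<circ> (?t \<circ> u)) r < (g \<circ> (?t \<circ> u)) s"
    proof (cases "s = b")
      case True
      have "(?t \<circ> u) r \<noteq> (?t \<circ> u) b"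
        using permutes_inj [OF tu] rs True by (metis injD less_irrefl)
      moreover have "(?t \<circ> u) b = a" by (simp add: ub)
      moreover have "(?t \<circ> u) r \<in> ?I" using permutes_in_image [OF tu] r by auto
      ultimately have "g ((?t \<circ> u) r) < g a"
        using ge insert.prems a(1) by (metis inj_onD order_le_less)
      then show ?thesis by (simp add: True ub)
    next
      case False
      then show ?thesis using u(2) rs r by (auto simp: strict_mono_on_def o_assoc)
    qed
  qed
  with tu show ?case by blast
qed

lemma strict_mono_on_permutes_id:
  fixes I :: "'i::linorder set"
  assumes "finite I" "u permutes I" "strict_mono_on I u"
  shows "u = id"
  using assms
proof (induction I rule: finite_linorder_max_induct)
  case empty
  then show ?case by simp
next
  case (insert b A)
  have "b \<in> u ` insert b A" using permutes_image [OF insert.prems(1)] by simp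
  then obtain x where x: "x \<in> insert b A" "u x = b" by (metis imageE)
  have ub: "u b \<in> insert b A" using permutes_in_image [OF insert.prems(1)] by simp
  have "x = b"
  proof (rule ccontr)
    assume "x \<noteq> b"
    then have "x < b" using x insert.hyps by auto
    then have "b < u b" using insert.prems(2) x by (auto simp: strict_mono_on_def)
    then show False using ub insert.hyps by auto
  qed
  with x have "u y = y" if "y \<in> insert b A - A" for y using that by auto
  with insert.prems(1) have "u permutes A" by (rule permutes_superset)
  moreover have "strict_mono_on A u"
    using insert.prems(2) by (auto simp: strict_mono_on_def)
  ultimately show ?case using insert.IH by blast
qed

lemma sort_unique:
  fixes I :: "'i::linorder set" and g g' :: "'i \<Rightarrow> 'b::linorder"
  assumes I: "finite I" and u: "u permutes I" "u' permutes I"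
    and g: "strict_mono_on I g" "strict_mono_on I g'" and eq: "\<And>s. s \<in> I \<Longrightarrow> g (u s) = g' (u' s)"
  shows "u = u'"
proof -
  let ?v = "u' \<circ> inv u"
  have v: "?v permutes I" using u by (intro permutes_compose permutes_inv)
  have gv: "g' (?v r) = g r" if "r \<in> I" for r
    using eq [of "inv u r"] that permutes_in_image [OF permutes_inv [OF u(1)]]
    by (simp add: permutes_inverses [OF u(1)])
  have "strict_mono_on I ?v"
  proof (intro strict_mono_onI)
    fix r s assume rs: "r \<in> I" "s \<in> I" "r < s"
    then have "g' (?v r) < g' (?v s)"
      unfolding gv [OF rs(1)] gv [OF rs(2)] using g(1) by (simp add: strict_mono_on_def)
    moreover have "?v r \<in> I" "?v s \<in> I" using rs permutes_in_image [OF v] by auto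
    ultimately show "?v r < ?v s"
      using strict_mono_onD [OF g(2), of "?v s" "?v r"] by (metis less_asym linorder_neqE)
  qed
  then have "?v = id" using I v by (intro strict_mono_on_permutes_id)
  then have "u' \<circ> (inv u \<circ> u) = u" by (simp only: o_assoc id_comp)
  then show ?thesis by (simp add: permutes_inv_o [OF u(1)])
qed

lemma DET_expand_rows:
  assumes "finite I" "finite C"
  shows "DET I (\<lambda>i j. \<Sum>c\<in>C. P i c * Q c j)
       = (\<Sum>k\<in>I \<rightarrow>\<^sub>E C. (\<Prod>i\<in>I. P i (k i)) * DET I (\<lambda>i j. Q (k i) j))"
proof -
  have "DET I (\<lambda>i j. \<Sum>c\<in>C. P i c * Q c j)
      = (\<Sum>p | p permutes I. of_int (sign p) * (\<Sum>k\<in>I \<rightarrow>\<^sub>E C. \<Prod>i\<in>I. P i (k i) * Q (k i) (p i)))"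
    unfolding DET_def using assms by (simp add: prod_sum_PiE)
  also have "\<dots> = (\<Sum>k\<in>I \<rightarrow>\<^sub>E C. \<Sum>p | p permutes I.
      of_int (sign p) * (\<Prod>i\<in>I. P i (k i) * Q (k i) (p i)))"
    by (simp add: sum_distrib_left sum.swap [of _ _ "{p. p permutes I}"])
  finally show ?thesis
    by (simp add: DET_def prod.distrib sum_distrib_left mult_ac)
qed

text \<open>
  Expanding the rows gives a sum over all maps \<open>I \<rightarrow> C\<close>. A map that is not injective contributes a
  determinant with equal rows; an injective one is a sorted map composed with a permutation, whose sign
  collects the products of entries of \<open>P\<close> into a determinant. The key \<open>f\<close> makes the statement usable for
  increasing and for decreasing index sequences.
\<close>

lemma Cauchy_Binet:
  fixes I :: "'i::linorder set" and f :: "'c \<Rightarrow> 'b::linorder"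
  assumes I: "finite I" and C: "finite C" and f: "inj_on f C"
  shows "DET I (\<lambda>i j. \<Sum>c\<in>C. P i c * Q c j)
       = (\<Sum>k | k \<in> I \<rightarrow>\<^sub>E C \<and> strict_mono_on I (f \<circ> k).
            DET I (\<lambda>i j. P i (k j)) * DET I (\<lambda>i j. Q (k i) j))"
proof -
  let ?K = "{k \<in> I \<rightarrow>\<^sub>E C. strict_mono_on I (f \<circ> k)}"
  let ?J = "{k \<in> I \<rightarrow>\<^sub>E C. inj_on k I}"
  let ?S = "{u. u permutes I}"
  let ?g = "\<lambda>k. (\<Prod>i\<in>I. P i (k i)) * DET I (\<lambda>i j. Q (k i) j)"
  have finK: "finite (I \<rightarrow>\<^sub>E C)" using I C by (intro finite_PiE) auto
  have comp: "k \<circ> u \<in> I \<rightarrow>\<^sub>E C" if "k \<in> I \<rightarrow>\<^sub>E C" "u permutes I" for k u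
    using that by (auto simp: PiE_def extensional_def permutes_in_image permutes_not_in)
  have injf: "inj_on k I" if "k \<in> ?K" for k
    using strict_mono_on_imp_inj_on [of I "f \<circ> k"] that inj_on_imageI2 by blast
  have bij: "bij_betw (\<lambda>(k, u). k \<circ> u) (?K \<times> ?S) ?J"
  proof (intro bij_betw_imageI)
    show "inj_on (\<lambda>(k, u). k \<circ> u) (?K \<times> ?S)"
    proof (rule inj_onI, clarify)
      fix k u k' u'
      assume *: "k \<in> I \<rightarrow>\<^sub>E C" "strict_mono_on I (f \<circ> k)" "k' \<in> I \<rightarrow>\<^sub>E C" "strict_mono_on I (f \<circ> k')"
        and u: "u permutes I" "u' permutes I" and eq: "k \<circ> u = k' \<circ> u'"
      have "u = u'"
        using sort_unique [OF I u *(2,4)] fun_cong [OF eq] by simp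
      then have "k \<circ> (u \<circ> inv u) = k' \<circ> (u \<circ> inv u)" using eq unfolding o_assoc by simp
      then show "k = k' \<and> u = u'" using \<open>u = u'\<close> unfolding permutes_inv_o(1) [OF u(1)] by simp
    qed
    show "(\<lambda>(k, u). k \<circ> u) ` (?K \<times> ?S) = ?J"
    proof (intro equalityI subsetI)
      fix h assume "h \<in> (\<lambda>(k, u). k \<circ> u) ` (?K \<times> ?S)"
      then obtain k u where h: "h = k \<circ> u" "k \<in> ?K" "u permutes I" by auto
      then show "h \<in> ?J"
        using comp [of k u] injf [of k] permutes_image [of u I] permutes_inj_on [of u I I]
        by (auto intro!: comp_inj_on)
    next
      fix h assume "h \<in> ?J"
      then have h: "h \<in> I \<rightarrow>\<^sub>E C" "inj_on h I" by auto
      have "inj_on (f \<circ> h) I"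
        using h f by (intro comp_inj_on) (auto intro: inj_on_subset)
      from sort_injective [OF I this] obtain u where
        u: "u permutes I" "strict_mono_on I (f \<circ> h \<circ> u)" by auto
      have "h \<circ> u \<in> ?K" using comp [OF h(1) u(1)] u(2) by (simp add: o_assoc)
      moreover have "h = (h \<circ> u) \<circ> inv u" using u(1) by (simp add: o_assoc [symmetric] permutes_inv_o)
      ultimately show "h \<in> (\<lambda>(k, u). k \<circ> u) ` (?K \<times> ?S)"
        using permutes_inv [OF u(1)] by (auto intro!: image_eqI [where x = "(h \<circ> u, inv u)"])
    qed
  qed
  have "DET I (\<lambda>i j. \<Sum>c\<in>C. P i c * Q c j) = (\<Sum>k\<in>I \<rightarrow>\<^sub>E C. ?g k)"
    by (rule DET_expand_rows [OF I C])
  also have "\<dots> = (\<Sum>k\<in>?J. ?g k)"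
  proof (intro sum.mono_neutral_right finK ballI)
    fix k assume "k \<in> (I \<rightarrow>\<^sub>E C) - ?J"
    then obtain a b where "a \<in> I" "b \<in> I" "a \<noteq> b" "k a = k b" by (auto simp: inj_on_def)
    then have "DET I (\<lambda>i j. Q (k i) j) = 0" using I by (intro DET_equal_rows [of I a b]) auto
    then show "?g k = 0" by simp
  qed auto
  also have "\<dots> = (\<Sum>(k, u)\<in>?K \<times> ?S. ?g (k \<circ> u))"
    by (subst sum.reindex_bij_betw [OF bij, symmetric]) (simp add: case_prod_unfold)
  also have "\<dots> = (\<Sum>k\<in>?K. \<Sum>u\<in>?S. ?g (k \<circ> u))"
    by (simp add: sum.cartesian_product)
  also have "\<dots> = (\<Sum>k\<in>?K. DET I (\<lambda>i j. P i (k j)) * DET I (\<lambda>i j. Q (k i) j))"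
  proof (intro sum.cong refl)
    fix k
    have "(\<Sum>u\<in>?S. ?g (k \<circ> u))
        = (\<Sum>u\<in>?S. (of_int (sign u) * (\<Prod>i\<in>I. P i (k (u i)))) * DET I (\<lambda>i j. Q (k i) j))"
    proof (intro sum.cong refl)
      fix u assume "u \<in> ?S"
      then have "DET I (\<lambda>i j. Q ((k \<circ> u) i) j) = of_int (sign u) * DET I (\<lambda>i j. Q (k i) j)"
        using DET_permute_rows [OF I, of u "\<lambda>i j. Q (k i) j"] by simp
      then show "?g (k \<circ> u)
          = (of_int (sign u) * (\<Prod>i\<in>I. P i (k (u i)))) * DET I (\<lambda>i j. Q (k i) j)"
        by (simp add: mult_ac)
    qed
    also have "\<dots> = DET I (\<lambda>i j. P i (k j)) * DET I (\<lambda>i j. Q (k i) j)"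
      by (simp add: DET_def [of I "\<lambda>i j. P i (k j)"] sum_distrib_right)
    finally show "(\<Sum>u\<in>?S. ?g (k \<circ> u)) = DET I (\<lambda>i j. P i (k j)) * DET I (\<lambda>i j. Q (k i) j)" .
  qed
  finally show ?thesis by simp
qed

text \<open>
  Cauchy-Binet with \<open>C = I\<close>: the identity is the only increasing map from \<open>I\<close> to itself.
\<close>

lemma DET_mult:
  fixes I :: "'i::linorder set"
  assumes I: "finite I"
  shows "DET I (\<lambda>i j. \<Sum>c\<in>I. P i c * Q c j) = DET I P * DET I Q"
proof -
  have "k = restrict id I" if k: "k \<in> I \<rightarrow>\<^sub>E I" "strict_mono_on I k" for k
  proof -
    define u where "u = (\<lambda>i. if i \<in> I then k i else i)"
    have "inj_on k I" using k(2) by (rule strict_mono_on_imp_inj_on)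
    moreover have "k ` I \<subseteq> I" using k(1) by auto
    ultimately have "bij_betw k I I" using I by (simp add: bij_betw_def endo_inj_surj)
    then have "bij_betw u I I" by (rule bij_betw_cong [THEN iffD1, rotated]) (simp add: u_def)
    then have u: "u permutes I" by (rule bij_imp_permutes) (simp add: u_def)
    have "strict_mono_on I u" using k(2) by (auto simp: strict_mono_on_def u_def)
    with u I have "u = id" by (intro strict_mono_on_permutes_id) auto
    then show ?thesis using k(1) by (auto simp: u_def fun_eq_iff PiE_def extensional_def split: if_splits)
  qed
  then have "{k. k \<in> I \<rightarrow>\<^sub>E I \<and> strict_mono_on I (id \<circ> k)} = {restrict id I}"
    by (auto simp: strict_mono_on_def)
  moreover have "DET I (\<lambda>i j. P i (restrict id I j)) = DET I P"
    "DET I (\<lambda>i j. Q (restrict id I i) j) = DET I Q"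
    by (auto intro: DET_cong)
  ultimately show ?thesis
    using Cauchy_Binet [OF I I, of id P Q] by simp
qed

text \<open>
  A permutation of \<open>P \<union> N\<close> is in a unique way \<open>inv w \<circ> (u \<circ> v)\<close> with \<open>u\<close> permuting \<open>P\<close>, \<open>v\<close> permuting \<open>N\<close> and
  \<open>inv w\<close> increasing on both. With \<open>P\<close> and \<open>N\<close> the positive and the negative numbers of a window, these \<open>w\<close>
  are the coset representatives of the character formula.
\<close>

lemma DET_Laplace:
  fixes P N :: "'i::linorder set"
  assumes fin: "finite P" "finite N" and disj: "P \<inter> N = {}"
  shows "DET (P \<union> N) M =
    (\<Sum>w | w permutes (P \<union> N) \<and> strict_mono_on P (inv w) \<and> strict_mono_on N (inv w).
       of_int (sign w) * DET P (\<lambda>s t. M s (inv w t)) * DET N (\<lambda>s t. M s (inv w t)))"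
proof -
  let ?I = "P \<union> N"
  let ?W = "{w. w permutes ?I \<and> strict_mono_on P (inv w) \<and> strict_mono_on N (inv w)}"
  let ?SP = "{u. u permutes P}" and ?SN = "{u. u permutes N}"
  let ?g = "\<lambda>p. of_int (sign p) * (\<Prod>i\<in>?I. M i (p i))"
  have sub: "u permutes ?I" if "u \<in> ?SP \<or> u \<in> ?SN" for u
    using that by (auto intro: permutes_subset)
  have onP: "(u \<circ> v) s = u s" "(u \<circ> v) s \<in> P" if "u \<in> ?SP" "v \<in> ?SN" "s \<in> P" for u v s
    using that disj by (auto simp: permutes_not_in permutes_in_image disjoint_iff)
  have onN: "(u \<circ> v) s = v s" "(u \<circ> v) s \<in> N" if "u \<in> ?SP" "v \<in> ?SN" "s \<in> N" for u v s
  proof -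
    have "v s \<in> N" using that by (simp add: permutes_in_image)
    then have "v s \<notin> P" using disj by auto
    then show "(u \<circ> v) s = v s" using that by (simp add: permutes_not_in)
    with \<open>v s \<in> N\<close> show "(u \<circ> v) s \<in> N" by simp
  qed
  have bij: "bij_betw (\<lambda>(w, u, v). inv w \<circ> (u \<circ> v)) (?W \<times> ?SP \<times> ?SN) {p. p permutes ?I}"
  proof (intro bij_betw_imageI)
    show "inj_on (\<lambda>(w, u, v). inv w \<circ> (u \<circ> v)) (?W \<times> ?SP \<times> ?SN)"
    proof (rule inj_onI)
      fix x y assume xy: "x \<in> ?W \<times> ?SP \<times> ?SN" "y \<in> ?W \<times> ?SP \<times> ?SN"
        "(case x of (w, u, v) \<Rightarrow> inv w \<circ> (u \<circ> v)) = (case y of (w, u, v) \<Rightarrow> inv w \<circ> (u \<circ> v))"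
      obtain w u v w' u' v' where x: "x = (w, u, v)" and y: "y = (w', u', v')"
        by (cases x, cases y) auto
      have w: "w permutes ?I" "strict_mono_on P (inv w)" "strict_mono_on N (inv w)"
        and w': "w' permutes ?I" "strict_mono_on P (inv w')" "strict_mono_on N (inv w')"
        and u: "u permutes P" "v permutes N" and u': "u' permutes P" "v' permutes N"
        and eq: "inv w \<circ> (u \<circ> v) = inv w' \<circ> (u' \<circ> v')"
        using xy by (auto simp: x y)
      have eqs: "inv w (u s) = inv w' (u' s)" if "s \<in> P" for s
        using fun_cong [OF eq, of s] onP(1)[of u v s] onP(1)[of u' v' s] u u' that by simp
      have eqt: "inv w (v s) = inv w' (v' s)" if "s \<in> N" for s
        using fun_cong [OF eq, of s] onN(1)[of u v s] onN(1)[of u' v' s] u u' that by simp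
      have uu: "u' = u" using sort_unique [OF fin(1) u(1) u'(1) w(2) w'(2) eqs] by simp
      have vv: "v' = v" using sort_unique [OF fin(2) u(2) u'(2) w(3) w'(3) eqt] by simp
      have uv: "u \<circ> v permutes ?I" using sub u by (intro permutes_compose) auto
      have "inv w = inv w'"
        using eq uu vv permutes_surj [OF uv] by (metis comp_id o_assoc permutes_inv_o(1) uv)
      then have "w = w'" using w(1) w'(1) by (metis permutes_inv_inv)
      with uu vv show "x = y" by (simp add: x y)
    qed
    show "(\<lambda>(w, u, v). inv w \<circ> (u \<circ> v)) ` (?W \<times> ?SP \<times> ?SN) = {p. p permutes ?I}"
    proof (intro equalityI subsetI)
      fix p assume "p \<in> (\<lambda>(w, u, v). inv w \<circ> (u \<circ> v)) ` (?W \<times> ?SP \<times> ?SN)"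
      then show "p \<in> {p. p permutes ?I}"
        using sub by (auto intro!: permutes_compose permutes_inv)
    next
      fix p assume "p \<in> {p. p permutes ?I}"
      then have p: "p permutes ?I" by simp
      obtain u where u: "u permutes P" "strict_mono_on P (p \<circ> u)"
        using sort_injective [OF fin(1) permutes_inj_on [OF p]] by blast
      obtain v where v: "v permutes N" "strict_mono_on N (p \<circ> v)"
        using sort_injective [OF fin(2) permutes_inj_on [OF p]] by blast
      have uv: "u \<circ> v permutes ?I" using sub u v by (intro permutes_compose) auto
      have vu: "inv u \<circ> inv v = inv (u \<circ> v)"
      proof -
        have "u \<circ> v = v \<circ> u"
        proof
          fix s
          consider "s \<in> P" | "s \<in> N" | "s \<notin> ?I" by auto
          then show "(u \<circ> v) s = (v \<circ> u) s"
          proof cases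
            case 1
            then have "u s \<in> P" using u by (simp add: permutes_in_image)
            then have "u s \<notin> N" "s \<notin> N" using disj 1 by auto
            then show ?thesis using v by (simp add: permutes_not_in)
          next
            case 2
            then have "v s \<in> N" using v by (simp add: permutes_in_image)
            then have "v s \<notin> P" "s \<notin> P" using disj 2 by auto
            then show ?thesis using u by (simp add: permutes_not_in)
          next
            case 3
            then show ?thesis using u v by (simp add: permutes_not_in)
          qed
        qed
        then show ?thesis
          using o_inv_distrib [OF permutes_bij [OF v(1)] permutes_bij [OF u(1)]] by simp
      qed
      define w where "w = inv (p \<circ> (u \<circ> v))"
      have puv: "p \<circ> (u \<circ> v) permutes ?I" by (rule permutes_compose [OF uv p])
      then have w: "w permutes ?I" "inv w = p \<circ> (u \<circ> v)"
        by (auto simp: w_def permutes_inv permutes_inv_inv)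
      have "strict_mono_on P (inv w)"
        unfolding w(2) using u(2) onP(1) [of u v] u(1) v(1) by (simp add: strict_mono_on_def)
      moreover have "strict_mono_on N (inv w)"
        unfolding w(2) using v(2) onN(1) [of u v] u(1) v(1) by (simp add: strict_mono_on_def)
      moreover have "p = inv w \<circ> (inv u \<circ> inv v)"
        unfolding w(2) vu using permutes_inv_o(1) [OF uv] by (metis comp_id o_assoc)
      ultimately show "p \<in> (\<lambda>(w, u, v). inv w \<circ> (u \<circ> v)) ` (?W \<times> ?SP \<times> ?SN)"
        using w(1) permutes_inv [OF u(1)] permutes_inv [OF v(1)]
        by (auto intro!: image_eqI [where x = "(w, inv u, inv v)"])
    qed
  qed
  have "DET ?I M = (\<Sum>(w, u, v)\<in>?W \<times> ?SP \<times> ?SN. ?g (inv w \<circ> (u \<circ> v)))"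
    unfolding DET_def
    by (subst sum.reindex_bij_betw [OF bij, symmetric]) (simp add: case_prod_unfold)
  also have "\<dots> = (\<Sum>(w, u, v)\<in>?W \<times> ?SP \<times> ?SN. of_int (sign w) *
      (of_int (sign u) * (\<Prod>s\<in>P. M s (inv w (u s)))) *
      (of_int (sign v) * (\<Prod>s\<in>N. M s (inv w (v s)))))"
  proof (intro sum.cong refl, clarify)
    fix w u v assume w: "w permutes ?I" and u: "u permutes P" and v: "v permutes N"
    have uv: "u permutes ?I" "v permutes ?I" using sub u v by auto
    have fI: "finite ?I" using fin by simp
    have perm: "permutation w" "permutation (inv w)" "permutation u" "permutation v"
      using w uv permutes_imp_permutation [OF fI] permutes_inv [OF w] by auto
    have "sign (inv w \<circ> (u \<circ> v)) = sign w * (sign u * sign v)"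
      using perm by (simp add: sign_compose sign_inverse permutation_compose)
    moreover have "(\<Prod>i\<in>?I. M i ((inv w \<circ> (u \<circ> v)) i))
        = (\<Prod>s\<in>P. M s (inv w (u s))) * (\<Prod>s\<in>N. M s (inv w (v s)))"
      using onP(1) [of u v] onN(1) [of u v] u v
      by (subst prod.union_disjoint [OF fin disj]) (auto intro!: arg_cong2 [where f = "(*)"] prod.cong)
    ultimately show "?g (inv w \<circ> (u \<circ> v)) = of_int (sign w) *
      (of_int (sign u) * (\<Prod>s\<in>P. M s (inv w (u s)))) *
      (of_int (sign v) * (\<Prod>s\<in>N. M s (inv w (v s))))"
      by (simp add: mult_ac)
  qed
  also have "\<dots> = (\<Sum>w\<in>?W. \<Sum>u\<in>?SP. \<Sum>v\<in>?SN. of_int (sign w) *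
      (of_int (sign u) * (\<Prod>s\<in>P. M s (inv w (u s)))) *
      (of_int (sign v) * (\<Prod>s\<in>N. M s (inv w (v s)))))"
    by (simp add: sum.cartesian_product)
  also have "\<dots> = (\<Sum>w\<in>?W. of_int (sign w) * DET P (\<lambda>s t. M s (inv w t)) * DET N (\<lambda>s t. M s (inv w t)))"
    by (simp add: DET_def mult.assoc sum_product) (simp add: sum_distrib_left)
  finally show ?thesis .
qed

section \<open>Truncation of formal power series\<close>

lemma mcoeff_plus [simp]: "mcoeff (f + g) M = mcoeff f M + mcoeff g M"
  by (simp add: plus_mfps_def)

lemma mcoeff_minus [simp]: "mcoeff (f - g) M = mcoeff f M - mcoeff (g :: ('v, 'r::comm_ring_1) mfps) M"
  by (simp add: minus_mfps_def)

lemma mcoeff_uminus [simp]: "mcoeff (- f) M = - mcoeff (f :: ('v, 'r::comm_ring_1) mfps) M"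
  by (simp add: uminus_mfps_def)

lemma mcoeff_zero [simp]: "mcoeff 0 M = (0 :: 'r::comm_ring_1)"
  by (simp add: zero_mfps_def mconst_def)

lemma mcoeff_one: "mcoeff 1 M = (if M = {#} then 1 else 0 :: 'r::comm_ring_1)"
  by (simp add: one_mfps_def mconst_def)

lemma mcoeff_times: "mcoeff (f * g) M = (\<Sum>(N, K)\<in>splits M. mcoeff f N * mcoeff g K)"
  by (simp add: times_mfps_def)

lemma mcoeff_sum: "mcoeff (\<Sum>i\<in>I. f i :: ('v, 'r::comm_ring_1) mfps) M = (\<Sum>i\<in>I. mcoeff (f i) M)"
  by (induction I rule: infinite_finite_induct) auto

text \<open>
  Equality modulo all monomials that do not divide \<open>M\<close>. Series are equal if they are congruent for
  every \<open>M\<close>, and for fixed \<open>M\<close> the congruence respects the ring operations while infinite sums and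
  products become finite.
\<close>

definition mcong :: "'v multiset \<Rightarrow> ('v, 'r) mfps \<Rightarrow> ('v, 'r) mfps \<Rightarrow> bool" where
  "mcong M f g \<longleftrightarrow> (\<forall>N. N \<subseteq># M \<longrightarrow> mcoeff f N = mcoeff g N)"

lemma mcong_refl [simp, intro]: "mcong M f f"
  by (simp add: mcong_def)

lemma mcong_sym: "mcong M f g \<Longrightarrow> mcong M g f"
  by (simp add: mcong_def)

lemma mcong_trans [trans]: "mcong M f g \<Longrightarrow> mcong M g h \<Longrightarrow> mcong M f h"
  by (simp add: mcong_def)

lemma mcong_imp_coeff: "mcong M f g \<Longrightarrow> mcoeff f M = mcoeff g M"
  by (simp add: mcong_def)

lemma mcong_mono: "mcong M f g \<Longrightarrow> N \<subseteq># M \<Longrightarrow> mcong N f g"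
  by (auto simp: mcong_def)

lemma mfps_eqI: "(\<And>M. mcong M f g) \<Longrightarrow> f = g"
  by (auto simp: mfps_eq_iff intro: mcong_imp_coeff)

lemma mcong_add: "mcong M f f' \<Longrightarrow> mcong M g g' \<Longrightarrow> mcong M (f + g) (f' + g')"
  for f f' g g' :: "('v, 'r::comm_ring_1) mfps"
  by (simp add: mcong_def)

lemma mcong_diff: "mcong M f f' \<Longrightarrow> mcong M g g' \<Longrightarrow> mcong M (f - g) (f' - g')"
  for f f' g g' :: "('v, 'r::comm_ring_1) mfps"
  by (simp add: mcong_def)

lemma mcong_mult:
  fixes f f' g g' :: "('v, 'r::comm_ring_1) mfps"
  assumes "mcong M f f'" "mcong M g g'"
  shows "mcong M (f * g) (f' * g')"
  unfolding mcong_def mcoeff_times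
proof (intro allI impI sum.cong refl)
  fix N x assume "N \<subseteq># M" "x \<in> splits N"
  then obtain P Q where x: "x = (P, Q)" "P + Q = N" by (auto simp: splits_def)
  then have "P \<subseteq># M" "Q \<subseteq># M"
    using \<open>N \<subseteq># M\<close>
    by (metis mset_subset_eq_add_left mset_subset_eq_add_right subset_mset.order_trans)+
  then show "(case x of (P, Q) \<Rightarrow> mcoeff f P * mcoeff g Q) =
      (case x of (P, Q) \<Rightarrow> mcoeff f' P * mcoeff g' Q)"
    using assms x by (simp add: mcong_def)
qed

lemma mcong_sum:
  fixes f g :: "'i \<Rightarrow> ('v, 'r::comm_ring_1) mfps"
  shows "(\<And>i. i \<in> I \<Longrightarrow> mcong M (f i) (g i)) \<Longrightarrow> mcong M (sum f I) (sum g I)"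
  by (simp add: mcong_def mcoeff_sum)

lemma mcong_prod:
  fixes f g :: "'i \<Rightarrow> ('v, 'r::comm_ring_1) mfps"
  shows "(\<And>i. i \<in> I \<Longrightarrow> mcong M (f i) (g i)) \<Longrightarrow> mcong M (prod f I) (prod g I)"
  by (induction I rule: infinite_finite_induct) (auto intro: mcong_mult)

lemma mcong_DET:
  fixes A B :: "'i \<Rightarrow> 'i \<Rightarrow> ('v, 'r::comm_ring_1) mfps"
  shows "(\<And>i j. i \<in> I \<Longrightarrow> j \<in> I \<Longrightarrow> mcong M (A i j) (B i j)) \<Longrightarrow> mcong M (DET I A) (DET I B)"
  unfolding DET_def
  by (intro mcong_sum mcong_mult mcong_prod) (auto simp: permutes_in_image)

lemma mcong_sum_neutral:
  fixes f :: "'i \<Rightarrow> ('v, 'r::comm_ring_1) mfps"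
  assumes "finite J" "I \<subseteq> J" "\<And>i. i \<in> J - I \<Longrightarrow> mcong M (f i) 0"
  shows "mcong M (sum f J) (sum f I)"
proof -
  have "sum f J = sum f I + sum f (J - I)"
    using assms by (metis add.commute sum.subset_diff)
  moreover have "mcong M (sum f I + sum f (J - I)) (sum f I + (\<Sum>i\<in>J - I. 0))"
    using assms by (intro mcong_add mcong_sum) auto
  ultimately show ?thesis by simp
qed

lemma mcong_prod_neutral:
  fixes f :: "'i \<Rightarrow> ('v, 'r::comm_ring_1) mfps"
  assumes "finite J" "I \<subseteq> J" "\<And>i. i \<in> J - I \<Longrightarrow> mcong M (f i) 1"
  shows "mcong M (prod f J) (prod f I)"
proof -
  have "prod f J = prod f I * prod f (J - I)"
    using assms by (metis mult.commute prod.subset_diff)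
  moreover have "mcong M (prod f I * prod f (J - I)) (prod f I * (\<Prod>i\<in>J - I. 1))"
    using assms by (intro mcong_mult mcong_prod) auto
  ultimately show ?thesis by simp
qed

lemma mcong_prod_zero:
  fixes f :: "'i \<Rightarrow> ('v, 'r::comm_ring_1) mfps"
  assumes "finite I" "i \<in> I" "mcong M (f i) 0"
  shows "mcong M (prod f I) 0"
proof -
  have "mcong M (f i * prod f (I - {i})) (0 * prod f (I - {i}))"
    by (intro mcong_mult assms) simp
  then show ?thesis using assms by (simp add: prod.remove)
qed

definition order_ge :: "nat \<Rightarrow> ('v, 'r::zero) mfps \<Rightarrow> bool" where
  "order_ge k f \<longleftrightarrow> (\<forall>N. size N < k \<longrightarrow> mcoeff f N = 0)"

lemma order_ge_0 [simp]: "order_ge 0 f"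
  by (simp add: order_ge_def)

lemma order_ge_zero [simp]: "order_ge k (0 :: ('v, 'r::comm_ring_1) mfps)"
  by (simp add: order_ge_def)

lemma order_ge_mono: "order_ge k f \<Longrightarrow> l \<le> k \<Longrightarrow> order_ge l f"
  by (auto simp: order_ge_def)

lemma order_ge_mult:
  fixes f g :: "('v, 'r::comm_ring_1) mfps"
  assumes "order_ge k f" "order_ge l g"
  shows "order_ge (k + l) (f * g)"
  unfolding order_ge_def mcoeff_times
proof (intro allI impI sum.neutral ballI)
  fix N :: "'v multiset" and x assume "size N < k + l" "x \<in> splits N"
  then obtain P Q where x: "x = (P, Q)" "P + Q = N" by (auto simp: splits_def)
  then have "size P < k \<or> size Q < l" using \<open>size N < k + l\<close> by auto
  then show "(case x of (P, Q) \<Rightarrow> mcoeff f P * mcoeff g Q) = 0"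
    using assms x by (auto simp: order_ge_def)
qed

lemma order_ge_sum:
  fixes f :: "'i \<Rightarrow> ('v, 'r::comm_ring_1) mfps"
  shows "(\<And>i. i \<in> I \<Longrightarrow> order_ge k (f i)) \<Longrightarrow> order_ge k (sum f I)"
  by (simp add: order_ge_def mcoeff_sum)

lemma order_ge_uminus: "order_ge k f \<Longrightarrow> order_ge k (- f :: ('v, 'r::comm_ring_1) mfps)"
  by (simp add: order_ge_def)

lemma order_ge_prod:
  fixes f :: "'i \<Rightarrow> ('v, 'r::comm_ring_1) mfps"
  assumes "finite I" "\<And>i. i \<in> I \<Longrightarrow> order_ge (k i) (f i)"
  shows "order_ge (\<Sum>i\<in>I. k i) (prod f I)"
  using assms by (induction I rule: finite_induct) (auto intro: order_ge_mult)

lemma order_ge_power: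
  fixes f :: "('v, 'r::comm_ring_1) mfps"
  assumes "order_ge 1 f"
  shows "order_ge n (f ^ n)"
proof (induction n)
  case (Suc n)
  then show ?case using order_ge_mult [OF assms Suc.IH] by simp
qed simp

lemma order_ge_mcong_zero:
  fixes f :: "('v, 'r::comm_ring_1) mfps"
  assumes "order_ge k f" "size M < k"
  shows "mcong M f 0"
  using assms by (auto simp: mcong_def order_ge_def dest!: size_mset_mono)

lemma order_ge_mvar [simp]: "order_ge 1 (mvar v :: ('v, 'r::comm_ring_1) mfps)"
  by (auto simp: order_ge_def mvar_def)

lemma mcong_mvar_zero: "v \<notin># M \<Longrightarrow> mcong M (mvar v) (0 :: ('v, 'r::comm_ring_1) mfps)"
  by (auto simp: mcong_def mvar_def)

text \<open>
  A basic neighbourhood fixes finitely many coefficients, and each of them is eventually constant.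
\<close>

lemma mfps_tendsto_finite_subsets:
  assumes "\<And>M. \<exists>J. finite J \<and> J \<subseteq> I \<and> (\<forall>J'. finite J' \<and> J \<subseteq> J' \<and> J' \<subseteq> I \<longrightarrow> mcong M (h J') s)"
  shows "(h \<longlongrightarrow> s) (finite_subsets_at_top I)"
proof (rule topological_tendstoI)
  fix U assume "open U" "s \<in> U"
  then obtain F where F: "finite F" "\<And>g. (\<forall>M\<in>F. mcoeff g M = mcoeff s M) \<Longrightarrow> g \<in> U"
    by (auto simp: open_mfps_def)
  from assms obtain J where J: "\<And>M. finite (J M)" "\<And>M. J M \<subseteq> I"
    "\<And>M J'. finite J' \<Longrightarrow> J M \<subseteq> J' \<Longrightarrow> J' \<subseteq> I \<Longrightarrow> mcong M (h J') s"
    by metis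
  show "\<forall>\<^sub>F J' in finite_subsets_at_top I. h J' \<in> U"
    unfolding eventually_finite_subsets_at_top
  proof (intro exI conjI allI impI)
    show "finite (\<Union>M\<in>F. J M)" "(\<Union>M\<in>F. J M) \<subseteq> I" using F(1) J by auto
    fix J' assume J': "finite J' \<and> (\<Union>M\<in>F. J M) \<subseteq> J' \<and> J' \<subseteq> I"
    show "h J' \<in> U"
    proof (rule F(2), intro ballI)
      fix M assume "M \<in> F"
      then have "mcong M (h J') s" using J' by (intro J(3)) auto
      then show "mcoeff (h J') M = mcoeff s M" by (rule mcong_imp_coeff)
    qed
  qed
qed

lemma has_sum_mcongI:
  fixes f :: "'i \<Rightarrow> ('v, 'r::comm_ring_1) mfps"
  assumes "\<And>M. \<exists>J. finite J \<and> J \<subseteq> I \<and> (\<forall>i\<in>I - J. mcong M (f i) 0) \<and> mcong M (sum f J) s"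
  shows "(f has_sum s) I"
  unfolding has_sum_def
proof (rule mfps_tendsto_finite_subsets)
  fix M
  from assms obtain J where J: "finite J" "J \<subseteq> I" "\<forall>i\<in>I - J. mcong M (f i) 0" "mcong M (sum f J) s"
    by blast
  show "\<exists>J. finite J \<and> J \<subseteq> I \<and> (\<forall>J'. finite J' \<and> J \<subseteq> J' \<and> J' \<subseteq> I \<longrightarrow> mcong M (sum f J') s)"
  proof (intro exI conjI allI impI)
    fix J' assume "finite J' \<and> J \<subseteq> J' \<and> J' \<subseteq> I"
    then have "mcong M (sum f J') (sum f J)" using J by (intro mcong_sum_neutral) auto
    also note J(4)
    finally show "mcong M (sum f J') s" .
  qed (use J in auto)
qed

text \<open>
  The sum is assembled coefficient by coefficient from the finite sums over the members that do
  not vanish modulo the monomial in question.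
\<close>

lemma
  fixes f :: "'i \<Rightarrow> ('v, 'r::comm_ring_1) mfps"
  assumes fin: "\<And>M. finite {i \<in> I. \<not> mcong M (f i) 0}"
  shows mfps_summable: "f summable_on I"
    and mcong_infsum: "\<And>M J. finite J \<Longrightarrow> J \<subseteq> I \<Longrightarrow> (\<And>i. i \<in> I - J \<Longrightarrow> mcong M (f i) 0) \<Longrightarrow>
      mcong M (infsum f I) (sum f J)"
proof -
  define J0 where "J0 M = {i \<in> I. \<not> mcong M (f i) 0}" for M
  define s where "s = Abs_mfps (\<lambda>M. mcoeff (sum f (J0 M)) M)"
  have s: "mcong M (sum f J) s" if "finite J" "J0 M \<subseteq> J" "J \<subseteq> I" for J M
    unfolding mcong_def
  proof (intro allI impI)
    fix N assume "N \<subseteq># M"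
    then have "J0 N \<subseteq> J0 M" using mcong_mono by (auto simp: J0_def)
    then have "mcong N (sum f J) (sum f (J0 N))"
      using that by (intro mcong_sum_neutral) (auto simp: J0_def)
    then show "mcoeff (sum f J) N = mcoeff s N" by (simp add: s_def mcong_imp_coeff)
  qed
  have hs: "(f has_sum s) I"
  proof (rule has_sum_mcongI)
    fix M
    show "\<exists>J. finite J \<and> J \<subseteq> I \<and> (\<forall>i\<in>I - J. mcong M (f i) 0) \<and> mcong M (sum f J) s"
      using fin s [of "J0 M" M] by (intro exI [of _ "J0 M"]) (auto simp: J0_def)
  qed
  then show "f summable_on I" by (auto simp: summable_on_def)
  fix M J assume J: "finite J" "J \<subseteq> I" "\<And>i. i \<in> I - J \<Longrightarrow> mcong M (f i) 0"
  from hs have "infsum f I = s" by (rule infsumI)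
  moreover have "mcong M (sum f J) s" using J by (intro s) (auto simp: J0_def)
  ultimately show "mcong M (infsum f I) (sum f J)" by (simp add: mcong_sym)
qed

lemma mcong_infprod:
  fixes f :: "'i \<Rightarrow> ('v, 'r::comm_ring_1) mfps"
  assumes fin: "\<And>M. finite {i \<in> I. \<not> mcong M (f i) 1}"
    and J: "finite J" "J \<subseteq> I" "\<And>i. i \<in> I - J \<Longrightarrow> mcong M (f i) 1"
  shows "mcong M (infprod f I) (prod f J)"
proof -
  define J0 where "J0 M = {i \<in> I. \<not> mcong M (f i) 1}" for M
  define s where "s = Abs_mfps (\<lambda>M. mcoeff (prod f (J0 M)) M)"
  have s: "mcong M (prod f J) s" if "finite J" "J0 M \<subseteq> J" "J \<subseteq> I" for J M
    unfolding mcong_def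
  proof (intro allI impI)
    fix N assume "N \<subseteq># M"
    then have "J0 N \<subseteq> J0 M" using mcong_mono by (auto simp: J0_def)
    then have "mcong N (prod f J) (prod f (J0 N))"
      using that by (intro mcong_prod_neutral) (auto simp: J0_def)
    then show "mcoeff (prod f J) N = mcoeff s N" by (simp add: s_def mcong_imp_coeff)
  qed
  have "(prod f \<longlongrightarrow> s) (finite_subsets_at_top I)"
  proof (rule mfps_tendsto_finite_subsets)
    fix M
    show "\<exists>J. finite J \<and> J \<subseteq> I \<and> (\<forall>J'. finite J' \<and> J \<subseteq> J' \<and> J' \<subseteq> I \<longrightarrow> mcong M (prod f J') s)"
      using fin s by (intro exI [of _ "J0 M"]) (auto simp: J0_def)
  qed
  then have "infprod f I = s"
    unfolding infprod_def by (intro tendsto_Lim) auto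
  moreover have "mcong M (prod f J) s" using J by (intro s) (auto simp: J0_def)
  ultimately show ?thesis by (simp add: mcong_sym)
qed

lemma mfps_inverse_unique:
  fixes f :: "('v, 'r::comm_ring_1) mfps"
  assumes "f * g = 1"
  shows "inverse f = g"
proof -
  have "f dvd 1" using assms by (metis dvd_triv_left)
  moreover have "(THE g. f * g = 1) = g"
  proof (intro the_equality)
    fix h assume "f * h = 1"
    have "h * (f * g) = (f * h) * g" by (simp only: mult_ac)
    with assms \<open>f * h = 1\<close> show "h = g" by simp
  qed (rule assms)
  ultimately show ?thesis by (simp add: inverse_mfps_def)
qed

text \<open>
  The geometric series in \<open>u = 1 - f\<close>: since \<open>u\<close> has no constant term, its powers beyond \<open>size M\<close>
  vanish modulo \<open>M\<close>.
\<close>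

lemma mfps_right_inverse:
  fixes f :: "('v, 'r::comm_ring_1) mfps"
  assumes "mcoeff f {#} = 1"
  shows "f * inverse f = 1"
proof -
  define u where "u = 1 - f"
  have u: "order_ge 1 u" using assms by (auto simp: order_ge_def u_def mcoeff_one)
  define g where "g = Abs_mfps (\<lambda>M. mcoeff (\<Sum>n\<le>size M. u ^ n) M)"
  have "f * g = 1"
  proof (rule mfps_eqI)
    fix M
    have "mcong M g (\<Sum>n\<le>size M. u ^ n)"
      unfolding mcong_def
    proof (intro allI impI)
      fix N assume N: "N \<subseteq># M"
      then have "size N \<le> size M" by (rule size_mset_mono)
      then have "mcong N (\<Sum>n\<le>size M. u ^ n) (\<Sum>n\<le>size N. u ^ n)"
        using order_ge_mcong_zero [OF order_ge_power [OF u]] by (intro mcong_sum_neutral) auto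
      then show "mcoeff g N = mcoeff (\<Sum>n\<le>size M. u ^ n) N"
        by (simp add: g_def mcong_imp_coeff)
    qed
    then have "mcong M (f * g) (f * (\<Sum>n\<le>size M. u ^ n))" by (intro mcong_mult) auto
    also have "f * (\<Sum>n\<le>size M. u ^ n) = 1 - u ^ Suc (size M)"
    proof -
      have "(1 - u) * (\<Sum>n\<le>k. u ^ n) = 1 - u ^ Suc k" for k
      proof (induction k)
        case (Suc k)
        have "(1 - u) * (\<Sum>n\<le>Suc k. u ^ n) = (1 - u) * (\<Sum>n\<le>k. u ^ n) + (1 - u) * u ^ Suc k"
          by (simp only: sum.atMost_Suc distrib_left)
        with Suc.IH show ?case by (simp add: algebra_simps)
      qed simp
      then show ?thesis by (simp add: u_def)
    qed
    also have "mcong M (1 - u ^ Suc (size M)) (1 - 0)"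
      using order_ge_power [OF u, of "Suc (size M)"]
      by (intro mcong_diff order_ge_mcong_zero [of "Suc (size M)"]) auto
    finally show "mcong M (f * g) 1" by simp
  qed
  then show ?thesis using mfps_inverse_unique by metis
qed

lemma mcoeff_mconst_mult:
  fixes f :: "('v, 'r::comm_ring_1) mfps"
  shows "mcoeff (mconst c * f) M = c * mcoeff f M"
proof -
  have "mcoeff (mconst c * f) M = (\<Sum>(N, K)\<in>{({#} :: 'v multiset, M)}. mcoeff (mconst c) N * mcoeff f K)"
    unfolding mcoeff_times
    using finite_splits [of M]
    by (intro sum.mono_neutral_right) (auto simp: splits_def mconst_def split: if_splits)
  then show ?thesis by (simp add: mconst_def)
qed

lemma mconst_mult: "mconst (a * b) = mconst a * (mconst b :: ('v, 'r::comm_ring_1) mfps)"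
  by (auto simp: mfps_eq_iff mcoeff_mconst_mult) (auto simp: mconst_def)

lemma mconst_add: "mconst (a + b) = mconst a + (mconst b :: ('v, 'r::comm_ring_1) mfps)"
  by (auto simp: mfps_eq_iff mconst_def)

lemma mconst_uminus: "mconst (- a) = - (mconst a :: ('v, 'r::comm_ring_1) mfps)"
  by (auto simp: mfps_eq_iff mconst_def)

lemma mconst_zero [simp]: "mconst 0 = (0 :: ('v, 'r::comm_ring_1) mfps)"
  by (simp add: zero_mfps_def)

lemma mconst_one [simp]: "mconst 1 = (1 :: ('v, 'r::comm_ring_1) mfps)"
  by (simp add: one_mfps_def)

lemma mconst_sum: "mconst (sum f I) = (\<Sum>i\<in>I. mconst (f i) :: ('v, 'r::comm_ring_1) mfps)"
  by (induction I rule: infinite_finite_induct) (auto simp: mconst_add)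

lemma mconst_prod: "mconst (prod f I) = (\<Prod>i\<in>I. mconst (f i) :: ('v, 'r::comm_ring_1) mfps)"
  by (induction I rule: infinite_finite_induct) (auto simp: mconst_mult)

lemma mconst_of_int: "mconst (of_int k) = (of_int k :: ('v, 'r::comm_ring_1) mfps)"
proof (induction k rule: int_induct [where k = 0])
  case (step2 i)
  have "mconst (of_int i + (- 1)) = (of_int i + (- 1) :: ('v, 'r) mfps)"
    by (simp only: mconst_add mconst_uminus step2 mconst_one)
  then show ?case by simp
qed (auto simp: mconst_add)

lemma mconst_DET: "mconst (DET I A) = DET I (\<lambda>i j. mconst (A i j) :: ('v, 'r::comm_ring_1) mfps)"
  by (simp add: DET_def mconst_sum mconst_mult mconst_of_int mconst_prod)

section \<open>Toeplitz determinants and strips\<close>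

lemma DET_equal_columns:
  assumes I: "finite I" "a \<in> I" "b \<in> I" "a \<noteq> b"
    and eq: "\<And>i. i \<in> I \<Longrightarrow> M i a = M i b"
  shows "DET I M = 0"
  using DET_equal_rows [OF I, of "\<lambda>i j. M j i"] DET_transpose [OF I(1), of M] eq by simp

text \<open>
  With integer indices and zeros below \<open>0\<close>, determinants of coefficients make sense for all pairs of
  shapes, contained in one another or not.
\<close>

definition icoef :: "'c::zero fps \<Rightarrow> int \<Rightarrow> 'c" where
  "icoef F k = (if k < 0 then 0 else F $ nat k)"

lemma icoef_nat [simp]: "icoef F (int k) = F $ k"
  by (simp add: icoef_def)

lemma icoef_neg [simp]: "k < 0 \<Longrightarrow> icoef F k = 0"
  by (simp add: icoef_def)

lemma icoef_0 [simp]: "icoef F 0 = F $ 0"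
  by (simp add: icoef_def)

lemma icoef_one: "icoef 1 k = (if k = 0 then 1 else 0)"
  by (auto simp: icoef_def)

lemma icoef_mult:
  fixes F G :: "'c::comm_ring_1 fps"
  assumes "finite C" "{b..a} \<subseteq> C"
  shows "icoef (F * G) (a - b) = (\<Sum>c\<in>C. icoef F (a - c) * icoef G (c - b))"
proof -
  have "(\<Sum>c\<in>C. icoef F (a - c) * icoef G (c - b)) = (\<Sum>c\<in>{b..a}. icoef F (a - c) * icoef G (c - b))"
    using assms by (intro sum.mono_neutral_right) auto
  also have "\<dots> = icoef (F * G) (a - b)"
  proof (cases "a < b")
    case False
    have "(\<Sum>c\<in>{b..a}. icoef F (a - c) * icoef G (c - b))
        = (\<Sum>i = 0..nat (a - b). F $ i * G $ (nat (a - b) - i))"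
      by (rule sum.reindex_bij_witness [where i = "\<lambda>i. a - int i" and j = "\<lambda>c. nat (a - c)"])
         (use False in \<open>auto simp: icoef_def nat_diff_distrib [symmetric] intro!: arg_cong2 [where f = "(*)"] arg_cong [where f = "fps_nth G"]\<close>)
    then show ?thesis using False by (simp add: icoef_def fps_mult_nth)
  qed auto
  finally show ?thesis by simp
qed

text \<open>
  \<open>1 / (1 - x t)\<close>, the series \<open>H(t)\<close> of a single even letter; \<open>lin x\<close> below is that of an odd one.
\<close>

definition geo :: "'c::comm_ring_1 \<Rightarrow> 'c fps" where
  "geo x = Abs_fps (\<lambda>n. x ^ n)"

definition lin :: "'c::comm_ring_1 \<Rightarrow> 'c fps" where
  "lin x = 1 + fps_const x * fps_X"

lemma geo_nth [simp]: "geo x $ n = x ^ n"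
  by (simp add: geo_def)

lemma lin_nth: "lin x $ n = (if n = 0 then 1 else if n = 1 then x else 0)"
  by (auto simp: lin_def)

lemma geo_lin: "geo x * lin (- x) = 1"
proof (rule fps_ext)
  fix n
  have "(geo x * lin (- x)) $ n = geo x $ n - x * (geo x * fps_X) $ n"
    by (simp add: lin_def algebra_simps flip: fps_const_neg)
  then show "(geo x * lin (- x)) $ n = 1 $ n"
    by (cases n) auto
qed

text \<open>
  The Jacobi-Trudi determinant of the skew shape \<open>la / mu\<close> for the series \<open>F\<close>.
\<close>

definition tdet :: "nat \<Rightarrow> 'c::comm_ring_1 fps \<Rightarrow> (nat \<Rightarrow> nat) \<Rightarrow> (nat \<Rightarrow> nat) \<Rightarrow> 'c" where
  "tdet n F la mu = DET {..<n} (\<lambda>i j. icoef F (int (la i) - int i - (int (mu j) - int j)))"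

lemma tdet_cong: "(\<And>i. i < n \<Longrightarrow> la i = la' i) \<Longrightarrow> (\<And>i. i < n \<Longrightarrow> mu i = mu' i) \<Longrightarrow>
    tdet n F la mu = tdet n F la' mu'"
  unfolding tdet_def by (intro DET_cong) auto

text \<open>
  The entries in the rows from \<open>r\<close> on and the columns up to \<open>r\<close> vanish, and every permutation meets
  this block: it cannot map the \<open>n - r\<close> rows into the \<open>n - r - 1\<close> columns beyond \<open>r\<close>.
\<close>

lemma tdet_zero:
  assumes la: "antimono la" and mu: "antimono mu" and r: "r < n" "la r < mu r"
  shows "tdet n F la mu = 0"
  unfolding tdet_def DET_def
proof (intro sum.neutral ballI)
  fix p assume "p \<in> {p. p permutes {..<n}}"
  then have p: "p permutes {..<n}" by simp
  have "\<exists>i\<in>{r..<n}. p i \<le> r"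
  proof (rule ccontr)
    assume neg: "\<not> ?thesis"
    then have "p ` {r..<n} \<subseteq> {Suc r..<n}"
    proof (intro subsetI, elim imageE)
      fix y i assume i: "y = p i" "i \<in> {r..<n}"
      then have "p i \<in> {..<n}" using permutes_in_image [OF p] by auto
      with i neg show "y \<in> {Suc r..<n}" by (simp add: not_le Suc_le_eq)
    qed
    then have "card (p ` {r..<n}) \<le> card {Suc r..<n}" by (intro card_mono) auto
    moreover have "card (p ` {r..<n}) = card {r..<n}"
      by (intro card_image permutes_inj_on [OF p])
    ultimately show False using r by simp
  qed
  then obtain i where i: "r \<le> i" "i < n" "p i \<le> r" by auto
  have "la i \<le> la r" "mu r \<le> mu (p i)" using la mu i by (simp_all add: antimonoD)
  then have "icoef F (int (la i) - int i - (int (mu (p i)) - int (p i))) = 0"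
    using i r by (intro icoef_neg) auto
  then have "(\<Prod>i\<in>{..<n}. icoef F (int (la i) - int i - (int (mu (p i)) - int (p i)))) = 0"
    using i by (intro prod_zero) auto
  then show "of_int (sign p) * (\<Prod>i\<in>{..<n}. icoef F (int (la i) - int i - (int (mu (p i)) - int (p i)))) = 0"
    by simp
qed

lemma tdet_one:
  assumes la: "antimono la" and mu: "antimono mu"
  shows "tdet n 1 la mu = (if \<forall>i<n. la i = mu i then 1 else 0 :: 'c::comm_ring_1)"
proof (cases "\<forall>i<n. la i = mu i")
  case True
  have "tdet n 1 la mu = (tdet n 1 la la :: 'c)"
    using True by (intro tdet_cong) auto
  also have "\<dots> = (\<Prod>i<n. icoef 1 (int (la i) - int i - (int (la i) - int i)))"
    unfolding tdet_def
  proof (rule DET_lower_triangular)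
    fix r c :: nat assume "r < c"
    moreover have "la c \<le> la r" using la \<open>r < c\<close> by (simp add: antimonoD)
    ultimately show "icoef 1 (int (la r) - int r - (int (la c) - int c)) = 0"
      by (auto simp: icoef_one)
  qed auto
  also have "\<dots> = 1" by simp
  finally show ?thesis using True by simp
next
  case False
  define i where "i = (LEAST i. i < n \<and> la i \<noteq> mu i)"
  have i: "i < n" "la i \<noteq> mu i"
    using False LeastI_ex [of "\<lambda>i. i < n \<and> la i \<noteq> mu i"] by (auto simp: i_def)
  have less: "la j = mu j" if "j < i" for j
    using not_less_Least [of j "\<lambda>i. i < n \<and> la i \<noteq> mu i"] that i by (auto simp: i_def)
  have "tdet n 1 la mu = (0 :: 'c)"
  proof (cases "la i < mu i")
    case True
    with la mu i show ?thesis by (intro tdet_zero) auto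
  next
    case F: False
    show ?thesis
      unfolding tdet_def
    proof (rule DET_zero_row)
      show "i \<in> {..<n}" using i by simp
      fix j assume "j \<in> {..<n}"
      have "int (la i) - int i \<noteq> int (mu j) - int j"
      proof (cases "j < i")
        case True
        then show ?thesis using less [of j] la by (auto dest!: antimonoD [of la j i])
      next
        case False
        then show ?thesis using F i mu by (auto dest!: antimonoD [of mu i j])
      qed
      then show "icoef 1 (int (la i) - int i - (int (mu j) - int j)) = (0 :: 'c)"
        by (simp add: icoef_one)
    qed auto
  qed
  with False show ?thesis by simp
qed

lemma finite_partitions_below:
  assumes "\<And>i. i \<ge> n \<Longrightarrow> la i = 0"
  shows "finite {nu. is_partition nu \<and> mu \<le> nu \<and> nu \<le> la}"
proof (rule finite_subset)
  let ?S = "{f. \<forall>i. (i \<in> {..<n} \<longrightarrow> f i \<in> {..Max (la ` {..<n})}) \<and> (i \<notin> {..<n} \<longrightarrow> f i = (0::nat))}"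
  show "finite ?S" by (intro finite_set_of_finite_funs) auto
  show "{nu. is_partition nu \<and> mu \<le> nu \<and> nu \<le> la} \<subseteq> ?S"
  proof (clarsimp, intro conjI impI)
    fix nu i assume nu: "nu \<le> la"
    have "nu i \<le> la i" using nu by (simp add: le_fun_def)
    moreover have "i < n \<Longrightarrow> la i \<le> Max (la ` {..<n})" by (intro Max_ge) auto
    ultimately show "i < n \<Longrightarrow> nu i \<le> Max (la ` {..<n})" "\<not> i < n \<Longrightarrow> nu i = 0"
      using assms [of i] by (auto intro: order_trans)
  qed
qed

lemma strictly_decreasing_ge:
  fixes k :: "nat \<Rightarrow> nat"
  assumes "\<And>i j. i < j \<Longrightarrow> j < n \<Longrightarrow> k j < k i" "i < n"
  shows "n - 1 - i \<le> k i"
  using assms(2)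
proof (induction "n - 1 - i" arbitrary: i)
  case (Suc m)
  then have "n - 1 - Suc i \<le> k (Suc i)" by (intro Suc.hyps) auto
  moreover have "k (Suc i) < k i" using Suc assms(1) by simp
  ultimately show ?case by simp
qed simp

text \<open>
  The matrix for \<open>F * G\<close> is a product of two rectangular Toeplitz matrices. In Cauchy-Binet the
  decreasing sequences of natural numbers are written as \<open>nu i + (n - 1 - i)\<close> with a partition \<open>nu\<close>; those
  not between \<open>mu\<close> and \<open>la\<close> drop out by \<open>tdet_zero\<close>.
\<close>

lemma tdet_mult:
  fixes F G :: "'c::comm_ring_1 fps"
  assumes la: "antimono la" "\<And>i. i \<ge> n \<Longrightarrow> la i = 0"
    and mu: "antimono mu" "\<And>i. i \<ge> n \<Longrightarrow> mu i = 0"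
  shows "tdet n (F * G) la mu
    = (\<Sum>nu | is_partition nu \<and> mu \<le> nu \<and> nu \<le> la. tdet n F la nu * tdet n G nu mu)"
proof -
  define N where "N = la 0 + n"
  define I where "I = {..<n}"
  define l m where "l i = int (la i) + int (n - 1 - i)" and "m i = int (mu i) + int (n - 1 - i)" for i
  let ?P = "\<lambda>i c. icoef F (l i - int c)" and ?Q = "\<lambda>c j. icoef G (int c - m j)"
  let ?K = "{k. k \<in> I \<rightarrow>\<^sub>E {..<N} \<and> strict_mono_on I ((\<lambda>c. - int c) \<circ> k)}"
  let ?f = "\<lambda>nu. restrict (\<lambda>i. nu i + (n - 1 - i)) I"
  let ?g = "\<lambda>k i. if i < n then k i - (n - 1 - i) else (0::nat)"
  let ?Nu = "{nu. is_partition nu \<and> (\<forall>i\<ge>n. nu i = 0) \<and> (\<forall>i<n. nu i \<le> la 0)}"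
  let ?T = "\<lambda>nu. tdet n F la nu * tdet n G nu mu"
  have finN: "finite ?Nu"
  proof (rule finite_subset)
    show "?Nu \<subseteq> {f. \<forall>i. (i \<in> {..<n} \<longrightarrow> f i \<in> {..la 0}) \<and> (i \<notin> {..<n} \<longrightarrow> f i = 0)}" by auto
    show "finite \<dots>" by (intro finite_set_of_finite_funs) auto
  qed
  have shift: "int (n - 1 - i) - int (n - 1 - j) = int j - int i" if "i < n" "j < n" for i j
    using that by auto
  have "tdet n (F * G) la mu = DET I (\<lambda>i j. \<Sum>c<N. ?P i c * ?Q c j)"
    unfolding tdet_def I_def
  proof (intro DET_cong)
    fix i j assume ij: "i \<in> {..<n}" "j \<in> {..<n}"
    have li: "l i < int N" using ij antimonoD [OF la(1), of 0 i] by (auto simp: l_def N_def)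
    have "icoef (F * G) (l i - m j) = (\<Sum>c\<in>int ` {..<N}. icoef F (l i - c) * icoef G (c - m j))"
    proof (intro icoef_mult subsetI)
      fix c assume "c \<in> {m j..l i}"
      then have "0 \<le> c" "c < int N" using li by (auto simp: m_def)
      then show "c \<in> int ` {..<N}" by (intro image_eqI [where x = "nat c"]) auto
    qed auto
    moreover have "l i - m j = int (la i) - int i - (int (mu j) - int j)"
      using ij shift [of i j] by (simp add: l_def m_def)
    ultimately show "icoef (F * G) (int (la i) - int i - (int (mu j) - int j)) = (\<Sum>c<N. ?P i c * ?Q c j)"
      by (simp add: sum.reindex)
  qed
  also have "\<dots> = (\<Sum>k\<in>?K. DET I (\<lambda>i j. ?P i (k j)) * DET I (\<lambda>i j. ?Q (k i) j))"
    by (intro Cauchy_Binet) (auto simp: I_def inj_on_def)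
  also have "\<dots> = (\<Sum>nu\<in>?Nu. ?T nu)"
  proof (rule sum.reindex_bij_witness [where i = ?f and j = ?g])
    fix k assume k: "k \<in> ?K"
    have dec: "k j < k i" if "i < j" "j < n" for i j
      using k that by (auto simp: strict_mono_on_def I_def)
    have ge: "n - 1 - i \<le> k i" if "i < n" for i using strictly_decreasing_ge [of n k i] dec that by blast
    have gk: "?g k i + (n - 1 - i) = k i" if "i < n" for i using ge [OF that] that by simp
    show "?f (?g k) = k"
    proof
      fix i show "?f (?g k) i = k i"
        using gk [of i] k by (cases "i < n") (auto simp: I_def PiE_def extensional_def)
    qed
    have anti: "antimono (?g k)"
    proof (intro antimonoI)
      fix i j :: nat assume "i \<le> j"
      show "?g k j \<le> ?g k i"
      proof (cases "j < n")
        case True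
        have "k i - (n - 1 - i) \<ge> k j - (n - 1 - j)" using \<open>i \<le> j\<close> True
        proof (induction j rule: dec_induct)
          case (step j)
          have "k (Suc j) < k j" using dec step by simp
          moreover have "k j - (n - 1 - j) \<le> k i - (n - 1 - i)" using step by simp
          moreover have "n - 1 - j = Suc (n - 1 - Suc j)" using step.prems by simp
          moreover have "a - t \<le> c" if "a < b" "b - Suc t \<le> c" for a b c t :: nat
            using that by linarith
          ultimately show ?case by metis
        qed simp
        then show ?thesis using True \<open>i \<le> j\<close> by simp
      qed simp
    qed
    have "finite {i. ?g k i \<noteq> 0}" by (rule finite_subset [of _ "{..<n}"]) (auto split: if_splits)
    moreover have "?g k i \<le> la 0" if "i < n" for i
    proof -
      have "?g k i \<le> ?g k 0" by (rule antimonoD [OF anti]) simp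
      moreover have "k 0 < N" using k that by (auto simp: I_def PiE_def Pi_def)
      ultimately show ?thesis using that by (simp add: N_def)
    qed
    ultimately show "?g k \<in> ?Nu" using anti by (auto simp: is_partition_def)
    have "DET I (\<lambda>i j. ?P i (k j)) = tdet n F la (?g k)"
      unfolding tdet_def I_def
    proof (intro DET_cong)
      fix i j assume ij: "i \<in> {..<n}" "j \<in> {..<n}"
      have "l i - int (k j) = int (la i) - int i - (int (?g k j) - int j)"
        using ij shift [of i j] gk [of j] by (simp add: l_def)
      then show "?P i (k j) = icoef F (int (la i) - int i - (int (?g k j) - int j))" by simp
    qed
    moreover have "DET I (\<lambda>i j. ?Q (k i) j) = tdet n G (?g k) mu"
      unfolding tdet_def I_def
    proof (intro DET_cong)
      fix i j assume ij: "i \<in> {..<n}" "j \<in> {..<n}"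
      have "int (k i) - m j = int (?g k i) - int i - (int (mu j) - int j)"
        using ij shift [of i j] gk [of i] by (simp add: m_def)
      then show "?Q (k i) j = icoef G (int (?g k i) - int i - (int (mu j) - int j))" by simp
    qed
    ultimately show "?T (?g k) = DET I (\<lambda>i j. ?P i (k j)) * DET I (\<lambda>i j. ?Q (k i) j)" by simp
  next
    fix nu assume nu: "nu \<in> ?Nu"
    show "?g (?f nu) = nu"
      using nu by (auto simp: I_def fun_eq_iff)
    show "?f nu \<in> ?K"
    proof -
      have "nu i + (n - 1 - i) < N" if "i < n" for i
        using nu that by (auto simp: N_def intro!: add_le_less_mono)
      moreover have "nu j + (n - 1 - j) < nu i + (n - 1 - i)" if "i < j" "j < n" for i j
      proof (intro add_le_less_mono)
        have "antimono nu" using nu by (simp add: is_partition_def)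
        then show "nu j \<le> nu i" using that by (simp add: antimonoD)
      qed (use that in auto)
      ultimately show ?thesis by (auto simp: I_def strict_mono_on_def)
    qed
  qed
  also have "\<dots> = (\<Sum>nu | is_partition nu \<and> mu \<le> nu \<and> nu \<le> la. ?T nu)"
  proof (intro sum.mono_neutral_right finN ballI)
    show "{nu. is_partition nu \<and> mu \<le> nu \<and> nu \<le> la} \<subseteq> ?Nu"
    proof (clarsimp, intro conjI allI impI)
      fix nu i assume "nu \<le> la"
      then have "nu i \<le> la i" by (simp add: le_fun_def)
      moreover have "la i \<le> la 0" using la by (simp add: antimonoD)
      ultimately show "nu i \<le> la 0" "n \<le> i \<Longrightarrow> nu i = 0" using la by auto
    qed
    fix nu assume nu: "nu \<in> ?Nu - {nu. is_partition nu \<and> mu \<le> nu \<and> nu \<le> la}"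
    then have anu: "antimono nu" by (simp add: is_partition_def)
    from nu have "(\<exists>i. nu i < mu i) \<or> (\<exists>i. la i < nu i)" by (auto simp: le_fun_def not_le)
    then show "?T nu = 0"
    proof (elim disjE exE)
      fix i assume "nu i < mu i"
      then show ?thesis using mu(2) [of i] tdet_zero [OF anu mu(1), of i n G] by (cases "i < n") auto
    next
      fix i assume "la i < nu i"
      then show ?thesis using nu tdet_zero [OF la(1) anu, of i n F] by (cases "i < n") auto
    qed
  qed
  finally show ?thesis .
qed

lemma tdet_Suc_row:
  assumes "\<And>j. j < n \<Longrightarrow> icoef F (int (la n) - int n - (int (mu j) - int j)) = 0"
  shows "tdet (Suc n) F la mu = icoef F (int (la n) - int (mu n)) * tdet n F la mu"
proof -
  have "{..<Suc n} - {n} = {..<n}" by auto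
  then show ?thesis
    unfolding tdet_def by (subst DET_remove [where r = n]) (use assms in \<open>auto simp: less_Suc_eq\<close>)
qed

lemma tdet_Suc_column:
  assumes "\<And>i. i < n \<Longrightarrow> icoef F (int (la i) - int i - (int (mu n) - int n)) = 0"
  shows "tdet (Suc n) F la mu = icoef F (int (la n) - int (mu n)) * tdet n F la mu"
proof -
  have "{..<Suc n} - {n} = {..<n}" by auto
  then show ?thesis
    unfolding tdet_def by (subst DET_remove_column [where r = n]) (use assms in \<open>auto simp: less_Suc_eq\<close>)
qed

text \<open>
  For one even letter the determinant detects horizontal strips. The last row has a nonzero entry
  on the diagonal only, unless the last part of \<open>la\<close> exceeds the part of \<open>mu\<close> above it; then the last two
  columns are proportional.
\<close>

lemma tdet_geo:
  assumes la: "antimono la" and mu: "antimono mu"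
  shows "tdet n (geo x) la mu =
    (if \<forall>i<n. mu i \<le> la i \<and> (Suc i < n \<longrightarrow> la (Suc i) \<le> mu i)
     then x ^ (\<Sum>i<n. la i - mu i) else 0)"
proof (induction n)
  case 0
  show ?case by (simp add: tdet_def)
next
  case (Suc n)
  show ?case
  proof (cases "la n < mu n")
    case True
    then show ?thesis using tdet_zero [OF la mu, of n "Suc n"] by auto
  next
    case ge: False
    show ?thesis
    proof (cases "\<exists>j. n = Suc j \<and> mu j < la n")
      case True
      then obtain j where j: "n = Suc j" "mu j < la n" by blast
      let ?M = "\<lambda>i j. icoef (geo x) (int (la i) - int i - (int (mu j) - int j))"
      define a where "a i = (if i = n then x ^ (Suc (mu j - mu n)) else 1)" for i
      define B where "B r c = (if c = n then ?M r j else ?M r c)" for r c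
      have "tdet (Suc n) (geo x) la mu = DET {..<Suc n} (\<lambda>i j. a j * B i j)"
        unfolding tdet_def
      proof (rule DET_cong)
        fix r c assume rc: "r \<in> {..<Suc n}" "c \<in> {..<Suc n}"
        show "?M r c = a c * B r c"
        proof (cases "c = n")
          case True
          have "la n \<le> la r" using la rc by (simp add: antimonoD)
          moreover have "mu n \<le> mu j" using mu j by (simp add: antimonoD)
          ultimately have "int (la r) - int r - (int (mu n) - int n)
              = int (Suc (mu j - mu n) + (la r + j - r - mu j))"
            "int (la r) - int r - (int (mu j) - int j) = int (la r + j - r - mu j)"
            using j rc by auto
          then show ?thesis unfolding a_def B_def True by (simp only: icoef_nat geo_nth power_add if_True refl)
        qed (simp add: a_def B_def)
      qed
      also have "\<dots> = (\<Prod>i<Suc n. a i) * DET {..<Suc n} B" by (rule DET_scale_columns) simp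
      also have "DET {..<Suc n} B = 0"
        by (rule DET_equal_columns [of _ j n]) (use j in \<open>auto simp: B_def\<close>)
      finally have "tdet (Suc n) (geo x) la mu = 0" by simp
      moreover have "\<not> (\<forall>i<Suc n. mu i \<le> la i \<and> (Suc i < Suc n \<longrightarrow> la (Suc i) \<le> mu i))"
        using j by (auto simp: not_le intro!: exI [of _ j])
      ultimately show ?thesis by (simp only: if_False)
    next
      case nle: False
      have "tdet (Suc n) (geo x) la mu = icoef (geo x) (int (la n) - int (mu n)) * tdet n (geo x) la mu"
      proof (rule tdet_Suc_row)
        fix j assume "j < n"
        then obtain k where k: "n = Suc k" "j \<le> k" by (cases n) auto
        then have "la n \<le> mu k" "mu k \<le> mu j" using nle mu by (simp_all add: antimonoD not_less)
        then show "icoef (geo x) (int (la n) - int n - (int (mu j) - int j)) = 0"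
          using \<open>j < n\<close> by (intro icoef_neg) auto
      qed
      also have "int (la n) - int (mu n) = int (la n - mu n)" using ge by simp
      finally have *: "tdet (Suc n) (geo x) la mu = x ^ (la n - mu n) * tdet n (geo x) la mu"
        by (simp only: icoef_nat geo_nth)
      have "(\<forall>i<Suc n. mu i \<le> la i \<and> (Suc i < Suc n \<longrightarrow> la (Suc i) \<le> mu i))
          \<longleftrightarrow> (\<forall>i<n. mu i \<le> la i \<and> (Suc i < n \<longrightarrow> la (Suc i) \<le> mu i))"
        using ge nle by (auto simp: less_Suc_eq not_less)
      moreover have "x ^ (\<Sum>i<Suc n. la i - mu i) = x ^ (la n - mu n) * x ^ (\<Sum>i<n. la i - mu i)"
        by (simp add: power_add mult.commute)
      ultimately show ?thesis unfolding * Suc.IH by (auto simp del: sum.lessThan_Suc)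
    qed
  qed
qed

text \<open>
  For one odd letter the determinant detects vertical strips. According to \<open>la n \<le> mu n\<close> or not, the
  last row or the last column is zero off the diagonal.
\<close>

lemma tdet_lin:
  assumes la: "antimono la" and mu: "antimono mu"
  shows "tdet n (lin x) la mu =
    (if \<forall>i<n. mu i \<le> la i \<and> la i \<le> Suc (mu i) then x ^ (\<Sum>i<n. la i - mu i) else 0)"
proof (induction n)
  case 0
  show ?case by (simp add: tdet_def)
next
  case (Suc n)
  have eq: "tdet (Suc n) (lin x) la mu = icoef (lin x) (int (la n) - int (mu n)) * tdet n (lin x) la mu"
  proof (cases "la n \<le> mu n")
    case True
    show ?thesis
    proof (rule tdet_Suc_row)
      fix j assume "j < n"
      then have "mu n \<le> mu j" using mu by (simp add: antimonoD)
      then show "icoef (lin x) (int (la n) - int n - (int (mu j) - int j)) = 0"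
        using \<open>j < n\<close> True by (intro icoef_neg) auto
    qed
  next
    case False
    show ?thesis
    proof (rule tdet_Suc_column)
      fix i assume i: "i < n"
      then have "la n \<le> la i" using la by (simp add: antimonoD)
      then have "1 < nat (int (la i) - int i - (int (mu n) - int n))"
        using i False by auto
      then show "icoef (lin x) (int (la i) - int i - (int (mu n) - int n)) = 0"
        by (auto simp: icoef_def lin_nth)
    qed
  qed
  have "icoef (lin x) (int (la n) - int (mu n))
      = (if mu n \<le> la n \<and> la n \<le> Suc (mu n) then x ^ (la n - mu n) else 0)"
  proof (cases "mu n \<le> la n")
    case True
    then have "int (la n) - int (mu n) = int (la n - mu n)" by simp
    then show ?thesis using True by (simp only: icoef_nat lin_nth) (auto simp: le_Suc_eq)
  qed auto
  moreover have "(\<forall>i<Suc n. mu i \<le> la i \<and> la i \<le> Suc (mu i)) \<longleftrightarrow>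
      (mu n \<le> la n \<and> la n \<le> Suc (mu n)) \<and> (\<forall>i<n. mu i \<le> la i \<and> la i \<le> Suc (mu i))"
    by (auto simp: less_Suc_eq)
  moreover have "x ^ (\<Sum>i<Suc n. la i - mu i) = x ^ (la n - mu n) * x ^ (\<Sum>i<n. la i - mu i)"
    by (simp add: power_add mult.commute)
  ultimately show ?case unfolding eq Suc.IH by (auto simp del: sum.lessThan_Suc)
qed

section \<open>Tableaux and the Jacobi--Trudi identities\<close>

lemma initial_segment_card:
  fixes D :: "nat set"
  assumes sub: "D \<subseteq> {a..<b}" and down: "\<And>i j. j \<in> D \<Longrightarrow> a \<le> i \<Longrightarrow> i \<le> j \<Longrightarrow> i \<in> D"
  shows "D = {a..<a + card D}"
proof (cases "D = {}")
  case False
  have fin: "finite D" using sub finite_subset by blast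
  have "D = {a..Max D}"
  proof (intro equalityI subsetI)
    fix i assume "i \<in> D"
    then show "i \<in> {a..Max D}" using sub fin by (auto intro: Max_ge)
  next
    fix i assume "i \<in> {a..Max D}"
    then show "i \<in> D" using down [OF Max_in [OF fin False]] by auto
  qed
  moreover have "a \<le> Max D" using sub Max_in [OF fin False] by auto
  ultimately obtain m where "D = {a..m}" "a \<le> m" by blast
  then show ?thesis by auto
qed simp

lemma is_partition_antimono: "is_partition la \<Longrightarrow> i \<le> j \<Longrightarrow> la j \<le> la i"
  by (simp add: is_partition_def antimonoD)

lemma is_partition_below:
  assumes "antimono nu" "nu \<le> la" "is_partition la"
  shows "is_partition nu"
proof -
  have "{i. nu i \<noteq> 0} \<subseteq> {i. la i \<noteq> 0}"
    using assms(2) by (auto simp: le_fun_def intro: order.strict_trans2)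
  then show ?thesis
    using assms by (auto simp: is_partition_def intro: finite_subset)
qed

lemma is_partition_bounded: "is_partition la \<Longrightarrow> \<exists>n. \<forall>i\<ge>n. la i = 0"
proof -
  assume "is_partition la"
  then have "finite {i. la i \<noteq> 0}" by (simp add: is_partition_def)
  then obtain n where "{i. la i \<noteq> 0} \<subseteq> {..<n}" using finite_nat_bounded by blast
  then show ?thesis by (intro exI [of _ n]) (auto simp: subset_iff)
qed

text \<open>
  Conjugation transposes the diagram. All other facts about conjugates are derived from this one.
\<close>

lemma less_conj_partition_iff:
  assumes "is_partition la"
  shows "i < conj_partition la j \<longleftrightarrow> j < la i"
proof -
  obtain n where n: "\<And>i. i \<ge> n \<Longrightarrow> la i = 0" using is_partition_bounded [OF assms] by auto
  have "{i. j < la i} = {0..<0 + card {i. j < la i}}"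
  proof (rule initial_segment_card)
    show "{i. j < la i} \<subseteq> {0..<n}" using n by (auto simp: not_le [symmetric])
    fix i i' assume "i' \<in> {i. j < la i}" "i \<le> i'"
    then show "i \<in> {i. j < la i}" using is_partition_antimono [OF assms, of i i'] by auto
  qed
  then have "i \<in> {i. j < la i} \<longleftrightarrow> i \<in> {0..<0 + card {i. j < la i}}" by (rule arg_cong)
  then show ?thesis by (simp add: conj_partition_def)
qed

lemma is_partition_conj:
  assumes la: "is_partition la"
  shows "is_partition (conj_partition la)"
proof -
  have "antimono (conj_partition la)"
  proof (intro antimonoI)
    fix j j' :: nat assume "j \<le> j'"
    then have "i < conj_partition la j" if "i < conj_partition la j'" for i
      using that by (simp add: less_conj_partition_iff [OF la])
    then show "conj_partition la j' \<le> conj_partition la j" by (meson leI less_irrefl)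
  qed
  moreover have "{j. conj_partition la j \<noteq> 0} \<subseteq> {..<la 0}"
    using less_conj_partition_iff [OF la, of 0] by auto
  ultimately show ?thesis by (auto simp: is_partition_def intro: finite_subset)
qed

lemma conj_conj_partition:
  assumes la: "is_partition la"
  shows "conj_partition (conj_partition la) = la"
proof
  fix i
  have "j < conj_partition (conj_partition la) i \<longleftrightarrow> j < la i" for j
    by (simp add: less_conj_partition_iff is_partition_conj la)
  then show "conj_partition (conj_partition la) i = la i" by (metis linorder_neqE_nat less_irrefl)
qed

lemma conj_partition_mono:
  assumes "is_partition la" "is_partition mu" "mu \<le> la"
  shows "conj_partition mu \<le> conj_partition la"
proof (rule le_funI)
  fix j
  have "i < conj_partition la j" if "i < conj_partition mu j" for i
    using that assms(3) by (simp add: less_conj_partition_iff assms(1,2) le_fun_def order.strict_trans2)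
  then show "conj_partition mu j \<le> conj_partition la j" by (meson leI less_irrefl)
qed

lemma bij_betw_conj_partition:
  assumes mu: "is_partition mu" and la: "is_partition la"
  shows "bij_betw conj_partition {nu. is_partition nu \<and> mu \<le> nu \<and> nu \<le> la}
    {nu. is_partition nu \<and> conj_partition mu \<le> nu \<and> nu \<le> conj_partition la}"
proof (rule bij_betw_byWitness [where f' = conj_partition])
  show "conj_partition ` {nu. is_partition nu \<and> conj_partition mu \<le> nu \<and> nu \<le> conj_partition la}
      \<subseteq> {nu. is_partition nu \<and> mu \<le> nu \<and> nu \<le> la}"
    using conj_partition_mono [OF _ is_partition_conj [OF mu]] conj_partition_mono [OF is_partition_conj [OF la]]
    by (auto simp: is_partition_conj conj_conj_partition mu la)
qed (auto simp: conj_conj_partition is_partition_conj conj_partition_mono mu la)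

lemma is_partition_empty [simp]: "is_partition empty_partition"
  by (simp add: is_partition_def empty_partition_def antimono_def)

lemma conj_empty_partition: "conj_partition empty_partition = empty_partition"
  by (simp add: conj_partition_def empty_partition_def fun_eq_iff)

lemma empty_partition_le [simp]: "empty_partition \<le> la"
  by (simp add: empty_partition_def le_fun_def)

lemma skew_diagram_Sigma:
  assumes "\<And>i. i \<ge> n \<Longrightarrow> la i = 0"
  shows "skew_diagram la mu = (SIGMA i:{..<n}. {mu i..<la i})"
  using assms by (auto simp: skew_diagram_def not_le [symmetric])

lemma card_skew_diagram:
  assumes "\<And>i. i \<ge> n \<Longrightarrow> la i = 0"
  shows "card (skew_diagram la mu) = (\<Sum>i<n. la i - mu i)"
  by (simp add: skew_diagram_Sigma [OF assms])

lemma finite_skew_diagram: "is_partition la \<Longrightarrow> finite (skew_diagram la mu)"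
  using is_partition_bounded [of la] skew_diagram_Sigma [of _ la mu] by fastforce

lemma card_skew_diagram_conj:
  assumes "is_partition la" "is_partition mu"
  shows "card (skew_diagram (conj_partition la) (conj_partition mu)) = card (skew_diagram la mu)"
proof -
  have "skew_diagram (conj_partition la) (conj_partition mu) = prod.swap ` skew_diagram la mu"
    by (auto simp: skew_diagram_def less_conj_partition_iff assms not_less [symmetric] image_iff)
  then show ?thesis by (simp add: card_image)
qed

definition horizontal_strip :: "(nat \<Rightarrow> nat) \<Rightarrow> (nat \<Rightarrow> nat) \<Rightarrow> bool" where
  "horizontal_strip la nu \<longleftrightarrow> nu \<le> la \<and> (\<forall>i. la (Suc i) \<le> nu i)"

text \<open>
  Any ranking \<open>r\<close> takes the place of the enumeration of the alphabet. This allows removing letters one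
  by one, and restricting an alphabet to finitely many letters while keeping their order.
\<close>

definition tableaux :: "('i \<Rightarrow> nat) \<Rightarrow> 'i set \<Rightarrow> (nat \<Rightarrow> nat) \<Rightarrow> (nat \<Rightarrow> nat) \<Rightarrow> (nat \<times> nat \<Rightarrow> 'i) set" where
  "tableaux r I la mu = {T \<in> skew_diagram la mu \<rightarrow>\<^sub>E I.
     (\<forall>i j j'. (i, j) \<in> skew_diagram la mu \<and> (i, j') \<in> skew_diagram la mu \<and> j < j' \<longrightarrow>
        r (T (i, j)) \<le> r (T (i, j'))) \<and>
     (\<forall>i i' j. (i, j) \<in> skew_diagram la mu \<and> (i', j) \<in> skew_diagram la mu \<and> i < i' \<longrightarrow>
        r (T (i, j)) < r (T (i', j)))}"

lemma ssyt_eq_tableaux: "ssyt I la mu = tableaux (to_nat_on I) I la mu"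
  by (simp add: ssyt_def tableaux_def)

lemma finite_tableaux: "finite I \<Longrightarrow> is_partition la \<Longrightarrow> finite (tableaux r I la mu)"
  by (rule finite_subset [of _ "skew_diagram la mu \<rightarrow>\<^sub>E I"])
     (auto simp: tableaux_def intro!: finite_PiE finite_skew_diagram)

definition tableau_sum ::
    "('i \<Rightarrow> 'c::comm_ring_1) \<Rightarrow> ('i \<Rightarrow> nat) \<Rightarrow> 'i set \<Rightarrow> (nat \<Rightarrow> nat) \<Rightarrow> (nat \<Rightarrow> nat) \<Rightarrow> 'c" where
  "tableau_sum x r I la mu = (\<Sum>T\<in>tableaux r I la mu. \<Prod>c\<in>skew_diagram la mu. x (T c))"

text \<open>
  The outer shape of what remains of the tableau \<open>T\<close> when the cells with entry \<open>m\<close> are deleted.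
\<close>

definition inner_shape :: "'i \<Rightarrow> (nat \<Rightarrow> nat) \<Rightarrow> (nat \<Rightarrow> nat) \<Rightarrow> (nat \<times> nat \<Rightarrow> 'i) \<Rightarrow> nat \<Rightarrow> nat" where
  "inner_shape m la mu T i = mu i + card {j. (i, j) \<in> skew_diagram la mu \<and> T (i, j) \<noteq> m}"

text \<open>
  The branching rule. The cells of a tableau that contain its largest letter \<open>m\<close> are the ends of the
  rows and lie in different columns, so they form a horizontal strip; deleting them is a bijection,
  because the strip can be filled with \<open>m\<close> again.
\<close>

lemma tableau_sum_insert:
  assumes I: "finite I" "m \<notin> I" "\<And>i. i \<in> I \<Longrightarrow> r i < r m"
    and la: "is_partition la" and mu: "is_partition mu" and le: "mu \<le> la"
  shows "tableau_sum x r (insert m I) la mu =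
    (\<Sum>nu | is_partition nu \<and> mu \<le> nu \<and> nu \<le> la.
       (if horizontal_strip la nu then x m ^ card (skew_diagram la nu) else 0) * tableau_sum x r I nu mu)"
proof -
  let ?N = "{nu. is_partition nu \<and> mu \<le> nu \<and> nu \<le> la}"
  let ?H = "{nu. is_partition nu \<and> mu \<le> nu \<and> horizontal_strip la nu}"
  let ?D = "skew_diagram la mu"
  let ?sh = "inner_shape m la mu"
  let ?back = "\<lambda>(nu, S) c. if c \<in> skew_diagram nu mu then S c else if c \<in> ?D then m else undefined"
  let ?w = "\<lambda>nu S. x m ^ card (skew_diagram la nu) * (\<Prod>c\<in>skew_diagram nu mu. x (S c))"
  have finN: "finite ?N"
    using is_partition_bounded [OF la] finite_partitions_below by blast
  have HN: "?H \<subseteq> ?N" by (auto simp: horizontal_strip_def)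
  have finH: "finite ?H" using finite_subset [OF HN finN] .
  have sub: "skew_diagram nu mu \<subseteq> ?D" if "nu \<le> la" for nu
    using that by (auto simp: skew_diagram_def le_fun_def order.strict_trans2)
  have lt: "r y < r m" if "y \<in> insert m I" "y \<noteq> m" for y using that I(3) by auto
  have le_m: "r y \<le> r m" if "y \<in> insert m I" for y using that I(3) by (auto simp: less_imp_le)
  have shape: "T (i, j) \<noteq> m \<longleftrightarrow> j < ?sh T i" if T: "T \<in> tableaux r (insert m I) la mu" and ij: "(i, j) \<in> ?D"
    for T i j
  proof -
    let ?R = "{j. (i, j) \<in> ?D \<and> T (i, j) \<noteq> m}"
    have "?R = {mu i..<mu i + card ?R}"
    proof (rule initial_segment_card)
      show "?R \<subseteq> {mu i..<la i}" by (auto simp: skew_diagram_def)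
      fix a b assume b: "b \<in> ?R" and ab: "mu i \<le> a" "a \<le> b"
      then have a: "(i, a) \<in> ?D" by (auto simp: skew_diagram_def)
      show "a \<in> ?R"
      proof (cases "a = b")
        case False
        then have "r (T (i, a)) \<le> r (T (i, b))" using T a b ab by (auto simp: tableaux_def)
        moreover have "r (T (i, b)) < r m" using T b by (intro lt) (auto simp: tableaux_def)
        ultimately show ?thesis using a by auto
      qed (use b in simp)
    qed
    then have "j \<in> ?R \<longleftrightarrow> j \<in> {mu i..<mu i + card ?R}" by (rule arg_cong)
    then show ?thesis using ij by (simp add: inner_shape_def) (simp add: skew_diagram_def)
  qed
  have sh_le: "?sh T i \<le> la i" and sh_ge: "mu i \<le> ?sh T i" for T i
  proof -
    have "card {j. (i, j) \<in> ?D \<and> T (i, j) \<noteq> m} \<le> card {mu i..<la i}"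
      by (intro card_mono) (auto simp: skew_diagram_def)
    then show "?sh T i \<le> la i" using le by (auto simp: inner_shape_def le_fun_def dest: spec [of _ i])
    show "mu i \<le> ?sh T i" by (simp add: inner_shape_def)
  qed
  have strip: "la (Suc i) \<le> ?sh T i" if T: "T \<in> tableaux r (insert m I) la mu" for T i
  proof (rule ccontr)
    let ?j = "?sh T i"
    assume "\<not> la (Suc i) \<le> ?j"
    then have j: "?j < la (Suc i)" by simp
    have "la (Suc i) \<le> la i" "mu (Suc i) \<le> mu i" using la mu by (auto intro: is_partition_antimono)
    then have cells: "(i, ?j) \<in> ?D" "(Suc i, ?j) \<in> ?D"
      using j sh_ge [of i T] by (auto simp: skew_diagram_def)
    then have "T (i, ?j) = m" using shape [OF T, of i ?j] by auto
    moreover have "r (T (i, ?j)) < r (T (Suc i, ?j))" using T cells by (auto simp: tableaux_def)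
    moreover have "r (T (Suc i, ?j)) \<le> r m" using T cells by (intro le_m) (auto simp: tableaux_def)
    ultimately show False by simp
  qed
  have shH: "?sh T \<in> ?H" if T: "T \<in> tableaux r (insert m I) la mu" for T
  proof -
    have "?sh T \<le> la" using sh_le by (intro le_funI) auto
    have "antimono (?sh T)"
      unfolding antimono_iff_le_Suc using strip [OF T] sh_le by (meson order_trans)
    then have "is_partition (?sh T)" using \<open>?sh T \<le> la\<close> la by (rule is_partition_below)
    then show ?thesis
      using strip [OF T] sh_ge \<open>?sh T \<le> la\<close> by (auto simp: horizontal_strip_def le_fun_def)
  qed
  have inner: "(i, j) \<in> skew_diagram (?sh T) mu \<longleftrightarrow> (i, j) \<in> ?D \<and> T (i, j) \<noteq> m"
    if T: "T \<in> tableaux r (insert m I) la mu" for T i j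
    using shape [OF T, of i j] sh_le [of T i]
    by (auto simp: skew_diagram_def)
  have "tableau_sum x r (insert m I) la mu
      = (\<Sum>(nu, S)\<in>(SIGMA nu:?H. tableaux r I nu mu). ?w nu S)"
    unfolding tableau_sum_def
  proof (rule sum.reindex_bij_witness [where i = ?back
        and j = "\<lambda>T. (?sh T, restrict T (skew_diagram (?sh T) mu))"])
    fix T assume T: "T \<in> tableaux r (insert m I) la mu"
    let ?nu = "?sh T" and ?S = "restrict T (skew_diagram (?sh T) mu)"
    have ext: "T c = undefined" if "c \<notin> ?D" for c
      using T that PiE_arb [of T ?D "\<lambda>_. insert m I" c] by (simp add: tableaux_def)
    have nula: "?nu \<le> la" using shH [OF T] by (simp add: horizontal_strip_def)
    show "?back (?nu, ?S) = T"
    proof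
      fix c
      have "c \<in> skew_diagram ?nu mu \<longleftrightarrow> c \<in> ?D \<and> T c \<noteq> m"
        using inner [OF T, of "fst c" "snd c"] by simp
      then show "?back (?nu, ?S) c = T c" using ext [of c] by simp
    qed
    show "(?nu, ?S) \<in> (SIGMA nu:?H. tableaux r I nu mu)"
    proof (intro SigmaI shH T)
      show "?S \<in> tableaux r I ?nu mu"
        using T inner [OF T] unfolding tableaux_def
        by (auto simp: PiE_def Pi_def)
    qed
    show "(case (?nu, ?S) of (nu, S) \<Rightarrow> ?w nu S) = (\<Prod>c\<in>?D. x (T c))"
    proof -
      have D: "?D = skew_diagram ?nu mu \<union> skew_diagram la ?nu"
      proof (intro set_eqI)
        fix c show "c \<in> ?D \<longleftrightarrow> c \<in> skew_diagram ?nu mu \<union> skew_diagram la ?nu"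
          using sh_le [of T "fst c"] sh_ge [of "fst c" T] by (auto simp: skew_diagram_def)
      qed
      have disj: "skew_diagram ?nu mu \<inter> skew_diagram la ?nu = {}" by (auto simp: skew_diagram_def)
      have "(\<Prod>c\<in>skew_diagram la ?nu. x (T c)) = (\<Prod>c\<in>skew_diagram la ?nu. x m)"
      proof (intro prod.cong refl)
        fix c assume c: "c \<in> skew_diagram la ?nu"
        then have "c \<in> ?D" using D by auto
        then have "T c = m" using shape [OF T, of "fst c" "snd c"] c by (auto simp: skew_diagram_def)
        then show "x (T c) = x m" by simp
      qed
      then have "(\<Prod>c\<in>?D. x (T c))
          = (\<Prod>c\<in>skew_diagram ?nu mu. x (T c)) * x m ^ card (skew_diagram la ?nu)"
        using shH [OF T] by (subst D, subst prod.union_disjoint)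
          (auto simp: disj finite_skew_diagram la)
      then show ?thesis by (simp add: mult.commute)
    qed
  next
    fix y assume "y \<in> (SIGMA nu:?H. tableaux r I nu mu)"
    then obtain nu S where y: "y = (nu, S)" and nu: "nu \<in> ?H" and S: "S \<in> tableaux r I nu mu" by auto
    let ?E = "skew_diagram nu mu"
    have nula: "nu \<le> la" and strip': "\<And>i. la (Suc i) \<le> nu i" and munu: "mu \<le> nu"
      using nu by (auto simp: horizontal_strip_def)
    have E: "?E \<subseteq> ?D" by (rule sub [OF nula])
    have SI: "S c \<in> I" if "c \<in> ?E" for c using S that by (auto simp: tableaux_def)
    define T where "T = ?back y"
    have T1: "T c = S c" if "c \<in> ?E" for c using that by (simp add: T_def y)
    have T2: "T c = m" if "c \<in> ?D" "c \<notin> ?E" for c using that by (simp add: T_def y)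
    have T3: "T c = undefined" if "c \<notin> ?D" for c using that E by (auto simp: T_def y)
    have TI: "T c \<in> insert m I" if "c \<in> ?D" for c using T1 T2 SI that by (cases "c \<in> ?E") auto
    have T: "T \<in> tableaux r (insert m I) la mu"
      unfolding tableaux_def
    proof (intro CollectI conjI allI impI)
      show "T \<in> ?D \<rightarrow>\<^sub>E insert m I" using TI T3 by (auto simp: PiE_def extensional_def)
      fix i j j' assume *: "(i, j) \<in> ?D \<and> (i, j') \<in> ?D \<and> j < j'"
      show "r (T (i, j)) \<le> r (T (i, j'))"
      proof (cases "(i, j') \<in> ?E")
        case True
        then have "(i, j) \<in> ?E" using * by (auto simp: skew_diagram_def)
        then show ?thesis using T1 True S * by (auto simp: tableaux_def)
      next
        case False
        then show ?thesis using T2 [of "(i, j')"] TI [of "(i, j)"] le_m * by auto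
      qed
    next
      fix i i' j assume *: "(i, j) \<in> ?D \<and> (i', j) \<in> ?D \<and> i < i'"
      have "(i, j) \<in> ?E"
      proof -
        have "j < la i'" "la i' \<le> la (Suc i)" using * la
          by (auto simp: skew_diagram_def Suc_le_eq intro: is_partition_antimono)
        then show ?thesis using * strip' [of i] by (auto simp: skew_diagram_def)
      qed
      show "r (T (i, j)) < r (T (i', j))"
      proof (cases "(i', j) \<in> ?E")
        case True
        then show ?thesis using T1 S * \<open>(i, j) \<in> ?E\<close> by (auto simp: tableaux_def)
      next
        case False
        then show ?thesis using T2 [of "(i', j)"] T1 SI I(3) * \<open>(i, j) \<in> ?E\<close> by auto
      qed
    qed
    then show "?back y \<in> tableaux r (insert m I) la mu" by (simp add: T_def)
    have "?sh T i = nu i" for i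
    proof -
      have "{j. (i, j) \<in> ?D \<and> T (i, j) \<noteq> m} = {j. (i, j) \<in> ?E}"
      proof (intro Collect_cong)
        fix j show "(i, j) \<in> ?D \<and> T (i, j) \<noteq> m \<longleftrightarrow> (i, j) \<in> ?E"
          using T1 [of "(i, j)"] T2 [of "(i, j)"] SI [of "(i, j)"] E I(2) by auto
      qed
      also have "\<dots> = {mu i..<nu i}" by (auto simp: skew_diagram_def)
      finally show ?thesis using munu by (simp add: inner_shape_def le_fun_def)
    qed
    then have "?sh T = nu" by auto
    moreover have "restrict T ?E = S"
      using T1 S by (auto simp: fun_eq_iff tableaux_def PiE_def extensional_def restrict_def)
    ultimately show "(?sh (?back y), restrict (?back y) (skew_diagram (?sh (?back y)) mu)) = y"
      unfolding T_def [symmetric] by (simp add: y)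
  qed
  also have "\<dots> = (\<Sum>nu\<in>?H. x m ^ card (skew_diagram la nu) * tableau_sum x r I nu mu)"
    unfolding tableau_sum_def sum_distrib_left
    using finH by (subst sum.Sigma) (auto simp: finite_tableaux I)
  also have "\<dots> = (\<Sum>nu\<in>?H. (if horizontal_strip la nu then x m ^ card (skew_diagram la nu) else 0) * tableau_sum x r I nu mu)"
    by (intro sum.cong) auto
  also have "\<dots> = (\<Sum>nu\<in>?N. (if horizontal_strip la nu then x m ^ card (skew_diagram la nu) else 0) * tableau_sum x r I nu mu)"
    by (intro sum.mono_neutral_left finN HN) auto
  finally show ?thesis .
qed

lemma tableau_sum_empty:
  assumes "is_partition la" "is_partition mu" "mu \<le> la"
  shows "tableau_sum x r {} la mu = (if la = mu then 1 else 0)"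
proof (cases "la = mu")
  case True
  then have "skew_diagram la mu = {}" by (auto simp: skew_diagram_def)
  then show ?thesis using True by (simp add: tableau_sum_def tableaux_def)
next
  case False
  then obtain i where "mu i \<noteq> la i" by (metis ext)
  with assms(3) have "mu i < la i" by (auto simp: le_fun_def le_neq_implies_less)
  then have "(i, mu i) \<in> skew_diagram la mu" by (simp add: skew_diagram_def)
  then have "tableaux r {} la mu = {}" by (auto simp: tableaux_def PiE_def Pi_def)
  then show ?thesis using False by (simp add: tableau_sum_def)
qed

lemma tdet_one':
  assumes "is_partition la" "\<And>i. i \<ge> n \<Longrightarrow> la i = 0" "is_partition mu" "\<And>i. i \<ge> n \<Longrightarrow> mu i = 0"
  shows "tdet n 1 la mu = (if la = mu then 1 else 0 :: 'c::comm_ring_1)"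
proof -
  have "(\<forall>i<n. la i = mu i) \<longleftrightarrow> la = mu"
    using assms(2,4) by (auto simp: fun_eq_iff) (metis not_le)
  then show ?thesis using assms by (simp add: tdet_one is_partition_def)
qed

lemma zero_below: "mu \<le> la \<Longrightarrow> la i = 0 \<Longrightarrow> mu i = 0" for la mu :: "nat \<Rightarrow> nat"
  by (metis le_fun_def le_zero_eq)

text \<open>
  If removing the largest letter amounts to a factor \<open>tdet n (F m)\<close>, then by \<open>tdet_mult\<close> the letters
  together amount to \<open>tdet\<close> of the product of their series.
\<close>

lemma transfer_det:
  fixes F :: "'i \<Rightarrow> 'c::comm_ring_1 fps" and mu :: "nat \<Rightarrow> nat" and n :: nat and r :: "'i \<Rightarrow> nat"
  defines "shape \<equiv> \<lambda>la. is_partition la \<and> (\<forall>i\<ge>n. la i = 0) \<and> mu \<le> la"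
  assumes I: "finite I" "inj_on r I" and mu: "is_partition mu" and la: "shape la"
    and base: "\<And>la. shape la \<Longrightarrow> Z {} la = (if la = mu then 1 else 0)"
    and step: "\<And>I m la. finite I \<Longrightarrow> m \<notin> I \<Longrightarrow> (\<And>i. i \<in> I \<Longrightarrow> r i < r m) \<Longrightarrow> shape la \<Longrightarrow>
      Z (insert m I) la = (\<Sum>nu | is_partition nu \<and> mu \<le> nu \<and> nu \<le> la. tdet n (F m) la nu * Z I nu)"
  shows "Z I la = tdet n (\<Prod>i\<in>I. F i) la mu"
  using I la
proof (induction I arbitrary: la rule: finite_ranking_induct [where f = r])
  case empty
  then show ?case using mu base by (auto simp: shape_def tdet_one' zero_below)
next
  case (insert m I)
  show ?case
  proof (cases "m \<in> I")
    case True
    then show ?thesis using insert by (simp add: insert_absorb)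
  next
    case False
    have lt: "r i < r m" if "i \<in> I" for i
    proof -
      have "r i \<noteq> r m" using insert.prems(1) that False by (metis inj_onD insertI1 insertI2)
      then show ?thesis using insert.hyps(2) [OF that] by simp
    qed
    have "Z (insert m I) la = (\<Sum>nu | is_partition nu \<and> mu \<le> nu \<and> nu \<le> la. tdet n (F m) la nu * Z I nu)"
      using insert.hyps(1) False lt insert.prems(2) by (rule step)
    also have "\<dots> = (\<Sum>nu | is_partition nu \<and> mu \<le> nu \<and> nu \<le> la.
        tdet n (F m) la nu * tdet n (\<Prod>i\<in>I. F i) nu mu)"
    proof (intro sum.cong refl arg_cong2 [where f = "(*)"] insert.IH)
      show "inj_on r I" using insert.prems(1) by (auto simp: inj_on_def)
      fix nu assume "nu \<in> {nu. is_partition nu \<and> mu \<le> nu \<and> nu \<le> la}"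
      then show "shape nu" using insert.prems(2) by (auto simp: shape_def zero_below)
    qed
    also have "\<dots> = tdet n (F m * (\<Prod>i\<in>I. F i)) la mu"
      using insert.prems(2) mu
      by (intro tdet_mult [symmetric]) (auto simp: shape_def is_partition_def zero_below)
    finally show ?thesis using insert.hyps(1) False by simp
  qed
qed

theorem Jacobi_Trudi:
  fixes x :: "'i \<Rightarrow> 'c::comm_ring_1"
  assumes I: "finite I" "inj_on r I"
    and la: "is_partition la" "\<And>i. i \<ge> n \<Longrightarrow> la i = 0" and mu: "is_partition mu" and le: "mu \<le> la"
  shows "tableau_sum x r I la mu = tdet n (\<Prod>i\<in>I. geo (x i)) la mu"
proof (rule transfer_det [OF I mu, where Z = "\<lambda>I la. tableau_sum x r I la mu"])
  fix I m la
  assume I: "finite I" "m \<notin> I" "\<And>i. i \<in> I \<Longrightarrow> r i < r m"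
    and "is_partition la \<and> (\<forall>i\<ge>n. la i = 0) \<and> mu \<le> la"
  then have la: "is_partition la" "\<And>i. i \<ge> n \<Longrightarrow> la i = 0" "mu \<le> la" by auto
  have "tableau_sum x r (insert m I) la mu =
      (\<Sum>nu | is_partition nu \<and> mu \<le> nu \<and> nu \<le> la.
       (if horizontal_strip la nu then x m ^ card (skew_diagram la nu) else 0) * tableau_sum x r I nu mu)"
    using I la mu by (intro tableau_sum_insert) auto
  also have "\<dots> = (\<Sum>nu | is_partition nu \<and> mu \<le> nu \<and> nu \<le> la. tdet n (geo (x m)) la nu * tableau_sum x r I nu mu)"
  proof (intro sum.cong refl arg_cong2 [where f = "(*)"])
    fix nu assume "nu \<in> {nu. is_partition nu \<and> mu \<le> nu \<and> nu \<le> la}"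
    then have nu: "is_partition nu" "nu \<le> la" by auto
    have "(\<forall>i<n. nu i \<le> la i \<and> (Suc i < n \<longrightarrow> la (Suc i) \<le> nu i)) \<longleftrightarrow> horizontal_strip la nu"
      using nu(2) la(2) unfolding horizontal_strip_def le_fun_def by (metis Suc_lessD le0 not_le)
    then show "(if horizontal_strip la nu then x m ^ card (skew_diagram la nu) else 0) = tdet n (geo (x m)) la nu"
      using la(1,2) nu(1) by (simp add: tdet_geo is_partition_def card_skew_diagram [of n la nu])
  qed
  finally show "tableau_sum x r (insert m I) la mu
      = (\<Sum>nu | is_partition nu \<and> mu \<le> nu \<and> nu \<le> la. tdet n (geo (x m)) la nu * tableau_sum x r I nu mu)" .
qed (use la mu le in \<open>auto simp: tableau_sum_empty\<close>)

text \<open>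
  On the conjugate shape, removing a letter takes away a horizontal strip, that is, a vertical
  strip of \<open>la\<close>. So the one-letter series is \<open>lin\<close> instead of \<open>geo\<close>.
\<close>

theorem dual_Jacobi_Trudi:
  fixes x :: "'i \<Rightarrow> 'c::comm_ring_1"
  assumes I: "finite I" "inj_on r I"
    and la: "is_partition la" "\<And>i. i \<ge> n \<Longrightarrow> la i = 0" and mu: "is_partition mu" and le: "mu \<le> la"
  shows "tableau_sum x r I (conj_partition la) (conj_partition mu) = tdet n (\<Prod>i\<in>I. lin (x i)) la mu"
proof (rule transfer_det [OF I mu, where Z = "\<lambda>I la. tableau_sum x r I (conj_partition la) (conj_partition mu)"])
  let ?c = conj_partition
  fix la assume la: "is_partition la \<and> (\<forall>i\<ge>n. la i = 0) \<and> mu \<le> la"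
  have "?c la = ?c mu \<longleftrightarrow> la = mu"
    using conj_conj_partition la mu by metis
  then show "tableau_sum x r {} (?c la) (?c mu) = (if la = mu then 1 else 0)"
    using la mu by (simp add: tableau_sum_empty is_partition_conj conj_partition_mono)
next
  let ?c = conj_partition
  fix I m la
  assume I: "finite I" "m \<notin> I" "\<And>i. i \<in> I \<Longrightarrow> r i < r m"
    and "is_partition la \<and> (\<forall>i\<ge>n. la i = 0) \<and> mu \<le> la"
  then have la: "is_partition la" "\<And>i. i \<ge> n \<Longrightarrow> la i = 0" "mu \<le> la" by auto
  have "tableau_sum x r (insert m I) (?c la) (?c mu) =
      (\<Sum>nu | is_partition nu \<and> ?c mu \<le> nu \<and> nu \<le> ?c la.
       (if horizontal_strip (?c la) nu then x m ^ card (skew_diagram (?c la) nu) else 0) * tableau_sum x r I nu (?c mu))"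
    using I la mu by (intro tableau_sum_insert) (auto simp: is_partition_conj conj_partition_mono)
  also have "\<dots> = (\<Sum>nu | is_partition nu \<and> mu \<le> nu \<and> nu \<le> la.
       (if horizontal_strip (?c la) (?c nu) then x m ^ card (skew_diagram (?c la) (?c nu)) else 0)
         * tableau_sum x r I (?c nu) (?c mu))"
    by (rule sum.reindex_bij_betw [symmetric, OF bij_betw_conj_partition [OF mu la(1)]])
  also have "\<dots> = (\<Sum>nu | is_partition nu \<and> mu \<le> nu \<and> nu \<le> la.
       tdet n (lin (x m)) la nu * tableau_sum x r I (?c nu) (?c mu))"
  proof (intro sum.cong refl arg_cong2 [where f = "(*)"])
    fix nu assume "nu \<in> {nu. is_partition nu \<and> mu \<le> nu \<and> nu \<le> la}"
    then have nu: "is_partition nu" "nu \<le> la" by auto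
    have "horizontal_strip (?c la) (?c nu) \<longleftrightarrow> (\<forall>j i. i < ?c la (Suc j) \<longrightarrow> i < ?c nu j)"
      using conj_partition_mono [OF la(1) nu]
      unfolding horizontal_strip_def by (metis leI less_irrefl order.strict_trans2)
    also have "\<dots> \<longleftrightarrow> (\<forall>i. la i \<le> Suc (nu i))"
      unfolding less_conj_partition_iff [OF la(1)] less_conj_partition_iff [OF nu(1)]
    proof (intro iffI allI impI)
      fix i assume *: "\<forall>j i. Suc j < la i \<longrightarrow> j < nu i"
      show "la i \<le> Suc (nu i)" using *[rule_format, of "nu i" i] by (meson less_irrefl not_le)
    next
      fix i j assume *: "\<forall>i. la i \<le> Suc (nu i)" "Suc j < la i"
      show "j < nu i" using *(1)[rule_format, of i] *(2) by simp
    qed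
    also have "\<dots> \<longleftrightarrow> (\<forall>i<n. nu i \<le> la i \<and> la i \<le> Suc (nu i))"
    proof (intro iffI allI)
      fix i assume *: "\<forall>i<n. nu i \<le> la i \<and> la i \<le> Suc (nu i)"
      show "la i \<le> Suc (nu i)" using * la(2) [of i] by (cases "i < n") auto
    qed (use nu(2) in \<open>auto simp: le_fun_def\<close>)
    finally have "(\<forall>i<n. nu i \<le> la i \<and> la i \<le> Suc (nu i)) \<longleftrightarrow> horizontal_strip (?c la) (?c nu)" by simp
    then show "(if horizontal_strip (?c la) (?c nu) then x m ^ card (skew_diagram (?c la) (?c nu)) else 0)
        = tdet n (lin (x m)) la nu"
      using la(1,2) nu(1)
      by (simp add: card_skew_diagram_conj card_skew_diagram [of n la nu])
         (simp add: tdet_lin is_partition_def)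
  qed
  finally show "tableau_sum x r (insert m I) (?c la) (?c mu)
      = (\<Sum>nu | is_partition nu \<and> mu \<le> nu \<and> nu \<le> la. tdet n (lin (x m)) la nu * tableau_sum x r I (?c nu) (?c mu))" .
qed (use la le in auto)

section \<open>Super Schur functions modulo a monomial\<close>

text \<open>
  The letters that do not vanish modulo \<open>M\<close>.
\<close>

definition visible :: "'v multiset \<Rightarrow> ('i \<Rightarrow> ('v, 'r::comm_ring_1) mfps) \<Rightarrow> 'i set \<Rightarrow> 'i set" where
  "visible M x I = {i \<in> I. \<not> mcong M (x i) 0}"

lemma visible_subset: "visible M x I \<subseteq> I"
  by (auto simp: visible_def)

text \<open>
  All that the proof uses about a family of variables. Families of products, such as \<open>x\<^sub>a z\<close> with a
  fixed series \<open>z\<close> or \<open>x\<^sub>a x\<^sub>b\<^sup>-\<^sup>1\<close>, have these properties as well.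
\<close>

definition alphabet :: "('i \<Rightarrow> ('v, 'r::comm_ring_1) mfps) \<Rightarrow> bool" where
  "alphabet x \<longleftrightarrow> (\<forall>M I. finite (visible M x I)) \<and> (\<forall>i. order_ge 1 (x i))"

lemma alphabet_finite [simp]: "alphabet x \<Longrightarrow> finite (visible M x I)"
  and alphabet_ord: "alphabet x \<Longrightarrow> order_ge 1 (x i)"
  by (auto simp: alphabet_def)

lemma alphabet_mvar:
  assumes "inj g"
  shows "alphabet (\<lambda>i. mvar (g i) :: ('v, 'r::comm_ring_1) mfps)"
  unfolding alphabet_def
proof (intro conjI allI)
  fix M I
  have "visible M (\<lambda>i. mvar (g i) :: ('v, 'r) mfps) I \<subseteq> g -` set_mset M"
    using mcong_mvar_zero by (fastforce simp: visible_def)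
  moreover have "finite (g -` set_mset M)" using assms by (intro finite_vimageI) auto
  ultimately show "finite (visible M (\<lambda>i. mvar (g i) :: ('v, 'r) mfps) I)" by (rule finite_subset)
qed (rule order_ge_mvar)

lemma alphabet_xA: "alphabet (xA :: 'a \<Rightarrow> ('a + 'b, 'r::comm_ring_1) mfps)"
  using alphabet_mvar [of Inl] by (simp add: xA_def [abs_def])

lemma alphabet_xB_inv: "alphabet (xB_inv :: 'b \<Rightarrow> ('a + 'b, 'r::comm_ring_1) mfps)"
  using alphabet_mvar [of Inr] by (simp add: xB_inv_def [abs_def])

lemma visible_uminus:
  fixes x :: "'i \<Rightarrow> ('v, 'r::comm_ring_1) mfps"
  shows "visible M (\<lambda>i. - x i) I = visible M x I"
proof -
  have "mcong M (- f) 0 \<longleftrightarrow> mcong M f 0" for f :: "('v, 'r) mfps"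
    by (simp add: mcong_def)
  then show ?thesis by (simp add: visible_def)
qed


text \<open>
  Modulo \<open>M\<close> such a series is a polynomial of degree at most \<open>size M\<close>.
\<close>

definition graded :: "('v, 'r::comm_ring_1) mfps fps \<Rightarrow> bool" where
  "graded F \<longleftrightarrow> (\<forall>n. order_ge n (F $ n))"

lemma graded_mult: "graded F \<Longrightarrow> graded G \<Longrightarrow> graded (F * G)"
  unfolding graded_def fps_mult_nth
proof (intro allI order_ge_sum)
  fix n i :: nat assume *: "\<forall>n. order_ge n (F $ n)" "\<forall>n. order_ge n (G $ n)" and "i \<in> {0..n}"
  then have "order_ge (i + (n - i)) (F $ i * G $ (n - i))" by (intro order_ge_mult) auto
  then show "order_ge n (F $ i * G $ (n - i))" using \<open>i \<in> {0..n}\<close> by simp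
qed

lemma graded_one: "graded 1"
  by (auto simp: graded_def)

lemma graded_prod: "(\<And>i. i \<in> I \<Longrightarrow> graded (F i)) \<Longrightarrow> graded (prod F I)"
  by (induction I rule: infinite_finite_induct) (auto intro: graded_mult graded_one)

lemma graded_geo: "order_ge 1 x \<Longrightarrow> graded (geo x)"
  by (simp add: graded_def order_ge_power)

lemma graded_lin: "order_ge 1 x \<Longrightarrow> graded (lin x)"
  by (simp add: graded_def lin_nth)

lemma graded_mcong_zero: "graded F \<Longrightarrow> size M < n \<Longrightarrow> mcong M (F $ n) 0"
  by (auto simp: graded_def intro: order_ge_mcong_zero)

lemma graded_icoef_mcong_zero: "graded F \<Longrightarrow> int (size M) < k \<Longrightarrow> mcong M (icoef F k) 0"
  by (auto simp: icoef_def intro: graded_mcong_zero)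

text \<open>
  In each product of the Leibniz formula the indices of the coefficients add up to the size of
  \<open>la / mu\<close>.
\<close>

lemma order_ge_tdet:
  assumes F: "graded F" and k: "k + (\<Sum>i<n. mu i) \<le> (\<Sum>i<n. la i)"
  shows "order_ge k (tdet n F la mu)"
  unfolding tdet_def DET_def
proof (intro order_ge_sum)
  fix p assume "p \<in> {p. p permutes {..<n}}"
  then have p: "p permutes {..<n}" by simp
  define e where "e i = int (la i) - int i - (int (mu (p i)) - int (p i))" for i
  have "order_ge k (\<Prod>i<n. icoef F (e i))"
  proof (cases "\<forall>i<n. 0 \<le> e i")
    case True
    have "order_ge (\<Sum>i<n. nat (e i)) (\<Prod>i<n. icoef F (e i))"
      using True F by (intro order_ge_prod) (auto simp: icoef_def graded_def)
    moreover have "k \<le> (\<Sum>i<n. nat (e i))"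
    proof -
      have "int (\<Sum>i<n. nat (e i)) = (\<Sum>i<n. e i)" using True by simp
      also have "\<dots> = (\<Sum>i<n. int (la i) - int i) - (\<Sum>i<n. int (mu (p i)) - int (p i))"
        by (simp add: e_def sum_subtractf)
      also have "(\<Sum>i<n. int (mu (p i)) - int (p i)) = (\<Sum>i<n. int (mu i) - int i)"
        using sum.permute [OF p, of "\<lambda>i. int (mu i) - int i"] by (simp add: o_def)
      also have "(\<Sum>i<n. int (la i) - int i) - (\<Sum>i<n. int (mu i) - int i) = int (\<Sum>i<n. la i) - int (\<Sum>i<n. mu i)"
        by (simp add: sum_subtractf)
      finally show ?thesis using k by linarith
    qed
    ultimately show ?thesis by (rule order_ge_mono)
  next
    case False
    then obtain i where "i < n" "e i < 0" by auto
    then have "(\<Prod>i<n. icoef F (e i)) = 0" by (intro prod_zero bexI [of _ i]) auto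
    then show ?thesis by simp
  qed
  from order_ge_mult [OF order_ge_0 this, of "of_int (sign p)"]
  show "order_ge k (of_int (sign p) * (\<Prod>i<n. icoef F (int (la i) - int i - (int (mu (p i)) - int (p i)))))"
    by (simp add: e_def)
qed


lemma skew_schur_mcong:
  fixes x :: "'i \<Rightarrow> ('v, 'r::comm_ring_1) mfps"
  assumes x: "alphabet x" and la: "is_partition la"
  shows "mcong M (skew_schur x I la mu)
    (if mu \<le> la then tableau_sum x (to_nat_on I) (visible M x I) la mu else 0)"
proof (cases "mu \<le> la")
  case True
  let ?D = "skew_diagram la mu"
  let ?t = "\<lambda>T. \<Prod>c\<in>?D. x (T c)"
  let ?J = "\<lambda>M. tableaux (to_nat_on I) (visible M x I) la mu"
  have finD: "finite ?D" using la by (rule finite_skew_diagram)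
  have finJ: "finite (?J M)" for M using x la by (intro finite_tableaux) auto
  have zero: "mcong M (?t T) 0" if "T \<in> ssyt I la mu - ?J M" for T M
  proof -
    have "\<exists>c\<in>?D. T c \<notin> visible M x I"
      using that by (auto simp: ssyt_eq_tableaux tableaux_def PiE_def Pi_def)
    then obtain c where c: "c \<in> ?D" "T c \<notin> visible M x I" by blast
    moreover have "T c \<in> I" using that c by (auto simp: ssyt_eq_tableaux tableaux_def)
    ultimately show ?thesis using finD by (intro mcong_prod_zero [of _ c]) (auto simp: visible_def)
  qed
  have "mcong M (infsum ?t (ssyt I la mu)) (sum ?t (?J M))"
  proof (rule mcong_infsum)
    fix M
    have "{T \<in> ssyt I la mu. \<not> mcong M (?t T) 0} \<subseteq> ?J M" using zero by blast
    then show "finite {T \<in> ssyt I la mu. \<not> mcong M (?t T) 0}" using finJ finite_subset by blast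
  next
    show "?J M \<subseteq> ssyt I la mu"
      using visible_subset by (fastforce simp: ssyt_eq_tableaux tableaux_def PiE_def Pi_def)
  qed (use finJ zero in auto)
  then show ?thesis using True by (simp add: skew_schur_def tableau_sum_def)
qed (simp add: skew_schur_def)

lemma
  fixes x :: "'i \<Rightarrow> ('v, 'r::comm_ring_1) mfps"
  assumes x: "alphabet x" and I: "countable I" and la: "is_partition la" "\<And>i. i \<ge> n \<Longrightarrow> la i = 0"
    and mu: "is_partition mu" "\<And>i. i \<ge> n \<Longrightarrow> mu i = 0"
  shows skew_schur_row: "mcong M (skew_schur x I la mu) (tdet n (\<Prod>i\<in>visible M x I. geo (x i)) la mu)"
    and skew_schur_column: "mcong M (skew_schur x I (conj_partition la) (conj_partition mu))
      (tdet n (\<Prod>i\<in>visible M x I. lin (x i)) la mu)"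
proof -
  have inj: "inj_on (to_nat_on I) (visible M x I)"
    using inj_on_to_nat_on [OF I] visible_subset by (rule inj_on_subset)
  have zero: "tdet n F la mu = 0" if "\<not> mu \<le> la" for F :: "('v, 'r) mfps fps"
  proof -
    obtain i where i: "la i < mu i" using \<open>\<not> mu \<le> la\<close> by (auto simp: le_fun_def not_le)
    then have "i < n" using mu(2) [of i] by (cases "i < n") auto
    with i la mu show ?thesis by (intro tdet_zero) (auto simp: is_partition_def)
  qed
  show "mcong M (skew_schur x I la mu) (tdet n (\<Prod>i\<in>visible M x I. geo (x i)) la mu)"
  proof (cases "mu \<le> la")
    case True
    have "tableau_sum x (to_nat_on I) (visible M x I) la mu = tdet n (\<Prod>i\<in>visible M x I. geo (x i)) la mu"
      using x inj la mu True by (intro Jacobi_Trudi) auto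
    then show ?thesis using skew_schur_mcong [OF x la(1), of M I mu] True by simp
  next
    case False
    then show ?thesis using skew_schur_mcong [OF x la(1), of M I mu] zero by simp
  qed
  have iff: "conj_partition mu \<le> conj_partition la \<longleftrightarrow> mu \<le> la"
    using conj_partition_mono [OF la(1) mu(1)] la mu
      conj_partition_mono [OF is_partition_conj [OF la(1)] is_partition_conj [OF mu(1)]]
    by (auto simp: conj_conj_partition)
  show "mcong M (skew_schur x I (conj_partition la) (conj_partition mu))
      (tdet n (\<Prod>i\<in>visible M x I. lin (x i)) la mu)"
  proof (cases "mu \<le> la")
    case True
    have "tableau_sum x (to_nat_on I) (visible M x I) (conj_partition la) (conj_partition mu)
        = tdet n (\<Prod>i\<in>visible M x I. lin (x i)) la mu"
      using x inj la mu True by (intro dual_Jacobi_Trudi) auto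
    then show ?thesis
      using skew_schur_mcong [OF x is_partition_conj [OF la(1)], of M I "conj_partition mu"] True iff by simp
  next
    case False
    then show ?thesis
      using skew_schur_mcong [OF x is_partition_conj [OF la(1)], of M I "conj_partition mu"] iff zero by simp
  qed
qed

text \<open>
  The series \<open>H(t)\<close> of the visible letters. Exchanging even and odd letters gives the elementary series
  \<open>1 / H(- t)\<close>, so exchanging them and changing their signs gives the inverse.
\<close>

definition h_series :: "'v multiset \<Rightarrow> ('i \<Rightarrow> ('v, 'r::comm_ring_1) mfps) \<Rightarrow> 'i set \<Rightarrow> 'i set \<Rightarrow> ('v, 'r) mfps fps" where
  "h_series M x I0 I1 = (\<Prod>i\<in>visible M x I1. lin (x i)) * (\<Prod>i\<in>visible M x I0. geo (x i))"

lemma graded_h_series: "alphabet x \<Longrightarrow> graded (h_series M x I0 I1)"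
  unfolding h_series_def by (intro graded_mult graded_prod graded_lin graded_geo alphabet_ord)

lemma h_series_inverse:
  fixes x :: "'i \<Rightarrow> ('v, 'r::comm_ring_1) mfps"
  assumes "alphabet x"
  shows "h_series M x I0 I1 * h_series M (\<lambda>i. - x i) I1 I0 = 1"
proof -
  have *: "lin y * geo (- y) = 1" "geo y * lin (- y) = 1" for y :: "('v, 'r) mfps"
    using geo_lin [of "- y"] geo_lin [of y] by (simp_all add: mult.commute)
  have "h_series M x I0 I1 * h_series M (\<lambda>i. - x i) I1 I0
      = (\<Prod>i\<in>visible M x I1. lin (x i) * geo (- x i)) * (\<Prod>i\<in>visible M x I0. geo (x i) * lin (- x i))"
    by (simp add: h_series_def visible_uminus prod.distrib mult_ac)
  also have "\<dots> = 1" by (simp add: *)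
  finally show ?thesis .
qed

lemma h_series_uminus_nth:
  fixes x :: "'i \<Rightarrow> ('v, 'r::comm_ring_1) mfps"
  shows "h_series M (\<lambda>i. - x i) I0 I1 $ n = (- 1) ^ n * h_series M x I0 I1 $ n"
proof -
  define s :: "('v, 'r) mfps fps \<Rightarrow> ('v, 'r) mfps fps"
    where "s F = Abs_fps (\<lambda>n. (- 1) ^ n * F $ n)" for F
  have smult: "s (F * G) = s F * s G" for F G
  proof (rule fps_ext)
    fix n
    have "s (F * G) $ n = (\<Sum>i = 0..n. (- 1) ^ n * (F $ i * G $ (n - i)))"
      by (simp add: s_def fps_mult_nth sum_distrib_left)
    also have "\<dots> = (\<Sum>i = 0..n. ((- 1) ^ i * F $ i) * ((- 1) ^ (n - i) * G $ (n - i)))"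
    proof (intro sum.cong refl)
      fix i assume "i \<in> {0..n}"
      then have "(- 1) ^ n = (- 1) ^ i * (- 1 :: ('v, 'r) mfps) ^ (n - i)"
        by (simp flip: power_add)
      then show "(- 1) ^ n * (F $ i * G $ (n - i)) = ((- 1) ^ i * F $ i) * ((- 1) ^ (n - i) * G $ (n - i))"
        by (simp add: mult_ac)
    qed
    finally show "s (F * G) $ n = (s F * s G) $ n" by (simp add: s_def fps_mult_nth)
  qed
  have sone: "s 1 = 1" by (rule fps_ext) (simp add: s_def)
  have sprod: "s (prod F J) = (\<Prod>i\<in>J. s (F i))" for F and J :: "'i set"
    by (induction J rule: infinite_finite_induct) (auto simp: smult sone)
  have sgeo: "s (geo y) = geo (- y)" and slin: "s (lin y) = lin (- y)" for y
    by (rule fps_ext, simp add: s_def lin_nth power_minus')+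
  have "h_series M (\<lambda>i. - x i) I0 I1 = s (h_series M x I0 I1)"
    by (simp add: h_series_def visible_uminus smult sprod sgeo slin)
  then show ?thesis by (simp add: s_def)
qed

text \<open>
  Each summand of the definition is a product of two Jacobi-Trudi determinants, and \<open>tdet_mult\<close> sums
  these products.
\<close>

lemma skew_super_schur_row:
  fixes x :: "'i \<Rightarrow> ('v, 'r::comm_ring_1) mfps"
  assumes x: "alphabet x" and I: "countable I0" "countable I1"
    and la: "is_partition la" "\<And>i. i \<ge> n \<Longrightarrow> la i = 0"
    and mu: "is_partition mu" "\<And>i. i \<ge> n \<Longrightarrow> mu i = 0"
  shows "mcong M (skew_super_schur x I0 I1 la mu) (tdet n (h_series M x I0 I1) la mu)"
proof -
  let ?N = "{nu. is_partition nu \<and> mu \<le> nu \<and> nu \<le> la}"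
  have "mcong M (skew_super_schur x I0 I1 la mu)
    (\<Sum>nu\<in>?N. tdet n (\<Prod>i\<in>visible M x I0. geo (x i)) nu mu * tdet n (\<Prod>i\<in>visible M x I1. lin (x i)) la nu)"
    unfolding skew_super_schur_def
  proof (intro mcong_sum mcong_mult)
    fix nu assume "nu \<in> ?N"
    then have nu: "is_partition nu" "nu \<le> la" by auto
    have nu0: "nu i = 0" if "i \<ge> n" for i using zero_below [OF nu(2) la(2) [OF that]] .
    show "mcong M (skew_schur x I0 nu mu) (tdet n (\<Prod>i\<in>visible M x I0. geo (x i)) nu mu)"
      using x I nu nu0 mu by (intro skew_schur_row) auto
    show "mcong M (skew_schur x I1 (conj_partition la) (conj_partition nu))
        (tdet n (\<Prod>i\<in>visible M x I1. lin (x i)) la nu)"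
      using x I nu nu0 la by (intro skew_schur_column) auto
  qed
  also have "(\<Sum>nu\<in>?N. tdet n (\<Prod>i\<in>visible M x I0. geo (x i)) nu mu * tdet n (\<Prod>i\<in>visible M x I1. lin (x i)) la nu)
      = tdet n (h_series M x I0 I1) la mu"
    unfolding h_series_def using la mu
    by (subst tdet_mult) (auto simp: is_partition_def mult.commute)
  finally show ?thesis .
qed

lemma super_schur_column:
  fixes x :: "'i \<Rightarrow> ('v, 'r::comm_ring_1) mfps"
  assumes x: "alphabet x" and I: "countable I0" "countable I1"
    and la: "is_partition la" "\<And>i. i \<ge> n \<Longrightarrow> la i = 0"
  shows "mcong M (super_schur x I0 I1 (conj_partition la)) (tdet n (h_series M x I1 I0) la empty_partition)"
proof -
  let ?c = conj_partition
  let ?N = "{nu. is_partition nu \<and> empty_partition \<le> nu \<and> nu \<le> ?c la}"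
  let ?N' = "{nu. is_partition nu \<and> empty_partition \<le> nu \<and> nu \<le> la}"
  have "super_schur x I0 I1 (?c la)
    = (\<Sum>nu\<in>?N. skew_schur x I0 nu empty_partition * skew_schur x I1 (?c (?c la)) (?c nu))"
    by (simp add: super_schur_def skew_super_schur_def)
  also have "\<dots> = (\<Sum>nu\<in>?N'. skew_schur x I0 (?c nu) (?c empty_partition) * skew_schur x I1 la nu)"
    using bij_betw_conj_partition [OF is_partition_empty la(1)]
    by (subst sum.reindex_bij_betw [symmetric])
       (auto simp: conj_empty_partition conj_conj_partition la(1) intro!: sum.cong)
  finally have *: "super_schur x I0 I1 (?c la) = \<dots>" .
  have "mcong M (super_schur x I0 I1 (?c la))
    (\<Sum>nu\<in>?N'. tdet n (\<Prod>i\<in>visible M x I0. lin (x i)) nu empty_partition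
        * tdet n (\<Prod>i\<in>visible M x I1. geo (x i)) la nu)"
    unfolding *
  proof (intro mcong_sum mcong_mult)
    fix nu assume "nu \<in> ?N'"
    then have nu: "is_partition nu" "nu \<le> la" by auto
    have nu0: "nu i = 0" if "i \<ge> n" for i using zero_below [OF nu(2) la(2) [OF that]] .
    show "mcong M (skew_schur x I0 (?c nu) (?c empty_partition))
        (tdet n (\<Prod>i\<in>visible M x I0. lin (x i)) nu empty_partition)"
      using x I nu nu0 by (intro skew_schur_column is_partition_empty) (auto simp: empty_partition_def)
    show "mcong M (skew_schur x I1 la nu) (tdet n (\<Prod>i\<in>visible M x I1. geo (x i)) la nu)"
      using x I nu nu0 la by (intro skew_schur_row) auto
  qed
  also have "(\<Sum>nu\<in>?N'. tdet n (\<Prod>i\<in>visible M x I0. lin (x i)) nu empty_partition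
        * tdet n (\<Prod>i\<in>visible M x I1. geo (x i)) la nu) = tdet n (h_series M x I1 I0) la empty_partition"
    unfolding h_series_def mult.commute [of "\<Prod>i\<in>visible M x I0. lin (x i)"] using la
    by (subst tdet_mult) (auto simp: is_partition_def mult.commute empty_partition_def antimono_def)
  finally show ?thesis .
qed

section \<open>Two-sided Toeplitz determinants\<close>

text \<open>
  The coefficient of \<open>t\<^sup>k\<close> in \<open>F(t) G(1/t)\<close>, cut off after the terms with \<open>G $ K\<close>. For \<open>K = size M\<close> and graded
  series the rest vanishes modulo \<open>M\<close>.
\<close>

definition toeplitz_coef :: "nat \<Rightarrow> 'c::comm_ring_1 fps \<Rightarrow> 'c fps \<Rightarrow> int \<Rightarrow> 'c" where
  "toeplitz_coef K F G k = (\<Sum>j\<le>K. icoef F (k + int j) * G $ j)"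

lemma toeplitz_coef_convolution:
  fixes F G :: "('v, 'r::comm_ring_1) mfps fps"
  assumes G: "graded G" and C: "finite C" "{b - int (size M)..b} \<subseteq> C"
  shows "mcong M (\<Sum>c\<in>C. icoef F (a - c) * icoef G (b - c)) (toeplitz_coef (size M) F G (a - b))"
proof -
  have "mcong M (\<Sum>c\<in>C. icoef F (a - c) * icoef G (b - c))
      (\<Sum>c\<in>{b - int (size M)..b}. icoef F (a - c) * icoef G (b - c))"
  proof (rule mcong_sum_neutral [OF C])
    fix c assume c: "c \<in> C - {b - int (size M)..b}"
    have "mcong M (icoef G (b - c)) 0"
    proof (cases "b < c")
      case False
      then show ?thesis using c by (intro graded_icoef_mcong_zero G) auto
    qed simp
    then have "mcong M (icoef F (a - c) * icoef G (b - c)) (icoef F (a - c) * 0)"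
      by (intro mcong_mult) auto
    then show "mcong M (icoef F (a - c) * icoef G (b - c)) 0" by simp
  qed
  also have "(\<Sum>c\<in>{b - int (size M)..b}. icoef F (a - c) * icoef G (b - c)) = toeplitz_coef (size M) F G (a - b)"
    unfolding toeplitz_coef_def
    by (rule sum.reindex_bij_witness [where i = "\<lambda>j. b - int j" and j = "\<lambda>c. nat (b - c)"])
       (auto simp: icoef_def algebra_simps)
  finally show ?thesis .
qed

lemma sum_pairs_truncate:
  fixes h :: "nat \<Rightarrow> nat \<Rightarrow> ('v, 'r::comm_ring_1) mfps"
  assumes R: "size M \<le> R" "size M \<le> R'" and h: "\<And>k j. size M < k + j \<Longrightarrow> mcong M (h k j) 0"
  shows "mcong M (\<Sum>k\<le>R. \<Sum>j\<le>R'. h k j) (\<Sum>s\<le>size M. \<Sum>k\<le>s. h k (s - k))"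
proof -
  let ?T = "{(k, j). k + j \<le> size M}"
  have T: "?T \<subseteq> {..R} \<times> {..R'}" using R by auto
  have "(\<Sum>k\<le>R. \<Sum>j\<le>R'. h k j) = (\<Sum>(k, j)\<in>{..R} \<times> {..R'}. h k j)"
    by (simp add: sum.cartesian_product)
  also have "mcong M \<dots> (\<Sum>(k, j)\<in>?T. h k j)"
    using h T by (intro mcong_sum_neutral) auto
  also have "(\<Sum>(k, j)\<in>?T. h k j) = (\<Sum>(s, k)\<in>(SIGMA s:{..size M}. {..s}). h k (s - k))"
    by (rule sum.reindex_bij_witness [where i = "\<lambda>(s, k). (k, s - k)" and j = "\<lambda>(k, j). (k + j, k)"]) auto
  also have "\<dots> = (\<Sum>s\<le>size M. \<Sum>k\<le>s. h k (s - k))"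
    by (subst sum.Sigma) auto
  finally show ?thesis .
qed

text \<open>
  Multiplication by \<open>1 / G(1/t)\<close> takes \<open>F(t) G(1/t)\<close> to \<open>F(t)\<close>.
\<close>

lemma toeplitz_coef_inverse_right:
  fixes F G W :: "('v, 'r::comm_ring_1) mfps fps"
  assumes W: "graded W" "graded G" "W * G = 1" and R: "size M \<le> R"
  shows "mcong M (\<Sum>k\<le>R. W $ k * toeplitz_coef (size M) F G (n + int k)) (icoef F n)"
proof -
  let ?h = "\<lambda>k j. W $ k * G $ j * icoef F (n + int (k + j))"
  have "(\<Sum>k\<le>R. W $ k * toeplitz_coef (size M) F G (n + int k)) = (\<Sum>k\<le>R. \<Sum>j\<le>size M. ?h k j)"
    by (simp add: toeplitz_coef_def sum_distrib_left mult_ac add_ac)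
  also have "mcong M \<dots> (\<Sum>s\<le>size M. \<Sum>k\<le>s. ?h k (s - k))"
  proof (rule sum_pairs_truncate [OF R order_refl])
    fix k j assume "size M < k + j"
    then have "mcong M (W $ k * G $ j) 0"
      using W by (intro order_ge_mcong_zero [of "k + j"] order_ge_mult) (auto simp: graded_def)
    then have "mcong M (?h k j) (0 * icoef F (n + int (k + j)))" by (intro mcong_mult) auto
    then show "mcong M (?h k j) 0" by simp
  qed
  also have "(\<Sum>s\<le>size M. \<Sum>k\<le>s. ?h k (s - k)) = (\<Sum>s\<le>size M. (W * G) $ s * icoef F (n + int s))"
    by (intro sum.cong refl) (simp add: fps_mult_nth sum_distrib_right atLeast0AtMost)
  also have "\<dots> = (\<Sum>s\<le>size M. if s = 0 then icoef F n else 0)"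
    unfolding W(3) by (intro sum.cong) auto
  also have "\<dots> = icoef F n" by simp
  finally show ?thesis .
qed

text \<open>
  Multiplication by \<open>1 / F(t)\<close> takes \<open>F(t) G(1/t)\<close> to \<open>G(1/t)\<close>.
\<close>

lemma toeplitz_coef_inverse_left:
  fixes F G U :: "('v, 'r::comm_ring_1) mfps fps"
  assumes U: "graded U" "graded G" "U * F = 1" and R: "size M \<le> R"
  shows "mcong M (\<Sum>k\<le>R. U $ k * toeplitz_coef (size M) F G (n - int k)) (icoef G (- n))"
proof -
  have "(\<Sum>k\<le>R. U $ k * toeplitz_coef (size M) F G (n - int k))
      = (\<Sum>j\<le>size M. G $ j * (\<Sum>k\<le>R. U $ k * icoef F (n + int j - int k)))"
    by (simp add: toeplitz_coef_def sum_distrib_left mult_ac algebra_simps sum.swap [of _ "{..R}"])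
  also have "mcong M \<dots> (\<Sum>j\<le>size M. G $ j * (if n + int j = 0 then 1 else 0))"
  proof (intro mcong_sum mcong_mult mcong_refl)
    fix j
    define R' where "R' = max R (nat (n + int j))"
    have "mcong M (\<Sum>k\<le>R'. U $ k * icoef F (n + int j - int k)) (\<Sum>k\<le>R. U $ k * icoef F (n + int j - int k))"
    proof (rule mcong_sum_neutral)
      fix k assume "k \<in> {..R'} - {..R}"
      then have "mcong M (U $ k * icoef F (n + int j - int k)) (0 * icoef F (n + int j - int k))"
        using R U by (intro mcong_mult graded_mcong_zero) auto
      then show "mcong M (U $ k * icoef F (n + int j - int k)) 0" by simp
    qed (auto simp: R'_def)
    then have "mcong M (\<Sum>k\<le>R. U $ k * icoef F (n + int j - int k)) (\<Sum>k\<le>R'. U $ k * icoef F (n + int j - int k))"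
      by (rule mcong_sym)
    also have "(\<Sum>k\<le>R'. U $ k * icoef F (n + int j - int k))
        = (\<Sum>c\<in>{n + int j - int R'..n + int j}. icoef U (n + int j - c) * icoef F (c - 0))"
      by (rule sum.reindex_bij_witness [where i = "\<lambda>c. nat (n + int j - c)" and j = "\<lambda>k. n + int j - int k"])
         (auto simp: icoef_def)
    also have "\<dots> = icoef (U * F) (n + int j - 0)"
      by (rule icoef_mult [symmetric]) (auto simp: R'_def)
    also have "\<dots> = (if n + int j = 0 then 1 else 0)"
      unfolding U(3) by (simp add: icoef_one)
    finally show "mcong M (\<Sum>k\<le>R. U $ k * icoef F (n + int j - int k)) (if n + int j = 0 then 1 else 0)" .
  qed
  also have "(\<Sum>j\<le>size M. G $ j * (if n + int j = 0 then 1 else 0))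
      = (\<Sum>j\<le>size M. if j = nat (- n) then (if n \<le> 0 then G $ j else 0) else 0)"
    by (intro sum.cong) auto
  also have "\<dots> = (if nat (- n) \<le> size M \<and> n \<le> 0 then G $ nat (- n) else 0)"
    by simp
  also have "mcong M \<dots> (icoef G (- n))"
  proof (cases "n \<le> 0 \<and> size M < nat (- n)")
    case True
    then have "mcong M (icoef G (- n)) 0" by (intro graded_icoef_mcong_zero U) auto
    then show ?thesis using True by (auto intro: mcong_sym)
  next
    case False
    then show ?thesis by (auto simp: icoef_def)
  qed
  finally show ?thesis .
qed


text \<open>
  What multiplying the symbol by \<open>1 - y t\<close> does to a finite Toeplitz determinant. Row \<open>r\<close> of the new matrix
  is the old row \<open>r\<close> minus \<open>y\<close> times the old row \<open>r + 1\<close>. The row \<open>hi + 1\<close> outside the matrix is by \<open>rel\<close> a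
  combination of the rows inside, so the new matrix is the old one multiplied by a matrix \<open>C\<close> that is
  bidiagonal up to its last row, and \<open>det C\<close> is the sum in front.
\<close>

lemma Toeplitz_step:
  fixes g :: "int \<Rightarrow> ('v, 'r::comm_ring_1) mfps"
  assumes lohi: "lo \<le> hi" and R: "lo + int R \<le> hi + 1" and w: "w 0 = 1"
    and rel: "\<And>c. c \<in> {lo..hi} \<Longrightarrow> mcong M (\<Sum>k\<le>R. w k * g (c - hi - 1 + int k)) 0"
  shows "mcong M (DET {lo..hi} (\<lambda>r c. g (c - r) - y * g (c - r - 1)))
    ((\<Sum>k\<le>R. w k * y ^ k) * DET {lo..hi} (\<lambda>r c. g (c - r)))"
proof -
  let ?I = "{lo..hi}"
  \<comment> \<open>\<open>Z\<close> inverts the bidiagonal part of \<open>C\<close>, so that \<open>C Z\<close> is the identity up to its last row.\<close>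
  define C where "C r s = (if r < hi then (if s = r then 1 else if s = r + 1 then - y else 0)
      else (if s = hi then 1 else 0) + (if hi + 1 - int R \<le> s then y * w (nat (hi + 1 - s)) else 0))" for r s
  define Z where "Z r s = (if r \<le> s then y ^ nat (s - r) else 0)" for r s
  have row: "(\<Sum>s\<in>?I. C r s * h s) = h r - y * h (r + 1)" if "r \<in> ?I" "r < hi" for r h
  proof -
    have "(\<Sum>s\<in>?I. C r s * h s) = (\<Sum>s\<in>?I. (if s = r then h s else 0) + (if s = r + 1 then - y * h s else 0))"
      using that by (intro sum.cong) (auto simp: C_def)
    also have "\<dots> = h r - y * h (r + 1)" using that by (simp add: sum.distrib)
    finally show ?thesis .
  qed
  have last: "(\<Sum>s\<in>?I. C hi s * h s) = h hi + y * (\<Sum>k\<in>{1..R}. w k * h (hi + 1 - int k))" for h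
  proof -
    have "(\<Sum>s\<in>?I. C hi s * h s)
        = (\<Sum>s\<in>?I. if s = hi then h s else 0) + (\<Sum>s\<in>?I. if hi + 1 - int R \<le> s then y * w (nat (hi + 1 - s)) * h s else 0)"
      unfolding sum.distrib [symmetric] by (intro sum.cong) (auto simp: C_def algebra_simps)
    also have "(\<Sum>s\<in>?I. if s = hi then h s else 0) = h hi" using lohi by simp
    also have "(\<Sum>s\<in>?I. if hi + 1 - int R \<le> s then y * w (nat (hi + 1 - s)) * h s else 0)
        = (\<Sum>s\<in>{hi + 1 - int R..hi}. y * w (nat (hi + 1 - s)) * h s)"
      using R by (intro sum.mono_neutral_cong_right) auto
    also have "\<dots> = (\<Sum>k\<in>{1..R}. y * w k * h (hi + 1 - int k))"
      by (rule sum.reindex_bij_witness [where i = "\<lambda>k. hi + 1 - int k" and j = "\<lambda>s. nat (hi + 1 - s)"]) auto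
    finally show ?thesis by (simp add: sum_distrib_left mult.assoc)
  qed
  have split0: "(\<Sum>k\<le>R. h k) = h 0 + (\<Sum>k\<in>{1..R}. h k)" for h :: "nat \<Rightarrow> ('v, 'r) mfps"
  proof -
    have "{..R} = insert 0 {1..R}" by auto
    then show ?thesis by simp
  qed
  have "mcong M (DET ?I (\<lambda>r c. g (c - r) - y * g (c - r - 1)))
      (DET ?I (\<lambda>r c. \<Sum>s\<in>?I. C r s * g (c - s)))"
  proof (intro mcong_DET)
    fix r c assume r: "r \<in> ?I" and c: "c \<in> ?I"
    show "mcong M (g (c - r) - y * g (c - r - 1)) (\<Sum>s\<in>?I. C r s * g (c - s))"
    proof (cases "r < hi")
      case True
      have "c - (r + 1) = c - r - 1" by simp
      then show ?thesis using row [OF r True, of "\<lambda>s. g (c - s)"] by (metis mcong_refl)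
    next
      case False
      then have rhi: "r = hi" using r by simp
      have "mcong M (g (c - hi - 1) + (\<Sum>k\<in>{1..R}. w k * g (c - hi - 1 + int k))) 0"
        using rel [OF c] by (simp add: split0 w)
      then have "mcong M (g (c - hi) + y * (\<Sum>k\<in>{1..R}. w k * g (c - hi - 1 + int k))
            - y * (g (c - hi - 1) + (\<Sum>k\<in>{1..R}. w k * g (c - hi - 1 + int k))))
          (g (c - hi) + y * (\<Sum>k\<in>{1..R}. w k * g (c - hi - 1 + int k)) - y * 0)"
        by (intro mcong_diff mcong_mult mcong_refl)
      then show ?thesis
        unfolding rhi last by (simp add: algebra_simps)
    qed
  qed
  also have "DET ?I (\<lambda>r c. \<Sum>s\<in>?I. C r s * g (c - s)) = DET ?I C * DET ?I (\<lambda>r c. g (c - r))"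
    by (rule DET_mult) simp
  also have "DET ?I C = (\<Sum>k\<le>R. w k * y ^ k)"
  proof -
    have "DET ?I Z = (\<Prod>r\<in>?I. Z r r)"
      by (rule DET_upper_triangular) (auto simp: Z_def)
    then have "DET ?I Z = 1" by (simp add: Z_def)
    then have "DET ?I C = DET ?I (\<lambda>r c. \<Sum>s\<in>?I. C r s * Z s c)"
      by (subst DET_mult) auto
    also have "\<dots> = (\<Prod>r\<in>?I. \<Sum>s\<in>?I. C r s * Z s r)"
    proof (rule DET_lower_triangular)
      fix r c assume r: "r \<in> ?I" "c \<in> ?I" "r < c"
      then have "r < hi" by simp
      moreover have "nat (c - r) = Suc (nat (c - (r + 1)))" using r by simp
      ultimately show "(\<Sum>s\<in>?I. C r s * Z s c) = 0"
        using r by (simp add: row Z_def)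
    qed simp
    also have "\<dots> = (\<Prod>r\<in>?I. if r = hi then \<Sum>k\<le>R. w k * y ^ k else 1)"
    proof (intro prod.cong refl)
      fix r assume r: "r \<in> ?I"
      show "(\<Sum>s\<in>?I. C r s * Z s r) = (if r = hi then \<Sum>k\<le>R. w k * y ^ k else 1)"
      proof (cases "r < hi")
        case True
        then show ?thesis using r by (simp add: row Z_def)
      next
        case False
        then have rhi: "r = hi" using r by simp
        have "(\<Sum>s\<in>?I. C hi s * Z s hi) = 1 + y * (\<Sum>k\<in>{1..R}. w k * y ^ (k - 1))"
          unfolding last by (simp add: Z_def nat_diff_distrib')
        also have "\<dots> = 1 + (\<Sum>k\<in>{1..R}. w k * y ^ k)"
          unfolding sum_distrib_left
          by (intro arg_cong2 [where f = "(+)"] sum.cong refl) (auto simp: power_eq_if mult_ac)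
        finally show ?thesis using rhi by (simp add: split0 w)
      qed
    qed
    also have "\<dots> = (\<Sum>k\<le>R. w k * y ^ k)" using lohi by simp
    finally show ?thesis .
  qed
  finally show ?thesis .
qed

text \<open>
  The value of the series \<open>F\<close> at \<open>t = y\<close>, up to terms of degree above \<open>R\<close> in \<open>t\<close>. If \<open>F\<close> is graded and \<open>R\<close> is
  at least \<open>size M\<close>, the terms left out vanish modulo \<open>M\<close>, whatever \<open>y\<close> is. So \<open>y\<close> may be a Laurent
  monomial, of degree 0 in the power series ring.
\<close>

definition trunc_eval :: "nat \<Rightarrow> 'c::comm_ring_1 fps \<Rightarrow> 'c \<Rightarrow> 'c" where
  "trunc_eval R F y = (\<Sum>k\<le>R. F $ k * y ^ k)"

lemma trunc_eval_mult:
  fixes F G :: "('v, 'r::comm_ring_1) mfps fps"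
  assumes "graded F" "graded G" "size M \<le> R"
  shows "mcong M (trunc_eval R (F * G) y) (trunc_eval R F y * trunc_eval R G y)"
proof -
  let ?h = "\<lambda>k j. (F $ k * G $ j) * y ^ (k + j)"
  have "trunc_eval R F y * trunc_eval R G y = (\<Sum>k\<le>R. \<Sum>j\<le>R. ?h k j)"
    by (simp add: trunc_eval_def sum_product power_add mult_ac)
  also have "mcong M \<dots> (\<Sum>s\<le>size M. \<Sum>k\<le>s. ?h k (s - k))"
  proof (rule sum_pairs_truncate [OF assms(3,3)])
    fix k j assume "size M < k + j"
    then have "mcong M (F $ k * G $ j) 0"
      using assms by (intro order_ge_mcong_zero [of "k + j"] order_ge_mult) (auto simp: graded_def)
    then have "mcong M (?h k j) (0 * y ^ (k + j))" by (intro mcong_mult) auto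
    then show "mcong M (?h k j) 0" by simp
  qed
  also have "(\<Sum>s\<le>size M. \<Sum>k\<le>s. ?h k (s - k)) = (\<Sum>s\<le>size M. (F * G) $ s * y ^ s)"
    by (intro sum.cong refl) (simp add: fps_mult_nth sum_distrib_right atLeast0AtMost)
  finally have *: "mcong M (trunc_eval R F y * trunc_eval R G y) (\<Sum>s\<le>size M. (F * G) $ s * y ^ s)" .
  have "mcong M (trunc_eval R (F * G) y) (\<Sum>s\<le>size M. (F * G) $ s * y ^ s)"
    unfolding trunc_eval_def
  proof (rule mcong_sum_neutral)
    fix k assume "k \<in> {..R} - {..size M}"
    then have "mcong M ((F * G) $ k * y ^ k) (0 * y ^ k)"
      using graded_mult [OF assms(1,2)] by (intro mcong_mult graded_mcong_zero) auto
    then show "mcong M ((F * G) $ k * y ^ k) 0" by simp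
  qed (use assms in auto)
  also note mcong_sym [OF *]
  finally show ?thesis .
qed

lemma trunc_eval_one [simp]: "trunc_eval R 1 y = 1"
  by (simp add: trunc_eval_def sum.delta' if_distrib [where f = "\<lambda>u. u * _"] cong: if_cong)

lemma trunc_eval_lin: "1 \<le> R \<Longrightarrow> trunc_eval R (lin x) y = 1 + x * y"
proof -
  assume "1 \<le> R"
  then have "trunc_eval R (lin x) y = (\<Sum>k\<in>{0, 1}. lin x $ k * y ^ k)"
    unfolding trunc_eval_def by (intro sum.mono_neutral_right) (auto simp: lin_nth)
  then show ?thesis by (simp add: lin_nth)
qed

lemma trunc_eval_prod:
  fixes F :: "'i \<Rightarrow> ('v, 'r::comm_ring_1) mfps fps"
  assumes "\<And>i. i \<in> I \<Longrightarrow> graded (F i)" "size M \<le> R"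
  shows "mcong M (trunc_eval R (prod F I) y) (\<Prod>i\<in>I. trunc_eval R (F i) y)"
  using assms
proof (induction I rule: infinite_finite_induct)
  case (insert i I)
  have "mcong M (trunc_eval R (F i * prod F I) y) (trunc_eval R (F i) y * trunc_eval R (prod F I) y)"
    using insert.prems by (intro trunc_eval_mult graded_prod) auto
  also have "mcong M \<dots> (trunc_eval R (F i) y * (\<Prod>i\<in>I. trunc_eval R (F i) y))"
    using insert by (intro mcong_mult) auto
  finally show ?case using insert.hyps by simp
qed auto

lemma trunc_eval_h_series:
  fixes x :: "'i \<Rightarrow> ('v, 'r::comm_ring_1) mfps"
  assumes x: "alphabet x" and R: "size M \<le> R" "1 \<le> R"
  shows "mcong M (trunc_eval R (h_series M x I0 I1) y * (\<Prod>i\<in>visible M x I0. 1 - x i * y))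
    (\<Prod>i\<in>visible M x I1. 1 + x i * y)"
proof -
  let ?P = "\<Prod>i\<in>visible M x I0. lin (- x i)"
  have lin: "graded (lin (x i))" "graded (lin (- x i))" for i
    by (rule graded_lin alphabet_ord [OF x] order_ge_uminus [OF alphabet_ord [OF x]])+
  have "mcong M (trunc_eval R (h_series M x I0 I1) y * (\<Prod>i\<in>visible M x I0. 1 - x i * y))
      (trunc_eval R (h_series M x I0 I1) y * trunc_eval R ?P y)"
    using trunc_eval_prod [of "visible M x I0" "\<lambda>i. lin (- x i)" M R y] R lin
    by (intro mcong_mult) (auto simp: trunc_eval_lin intro: mcong_sym)
  also have "mcong M \<dots> (trunc_eval R (h_series M x I0 I1 * ?P) y)"
    using R x lin by (intro mcong_sym [OF trunc_eval_mult] graded_h_series graded_prod) auto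
  also have "h_series M x I0 I1 * ?P = (\<Prod>i\<in>visible M x I1. lin (x i))"
  proof -
    have "h_series M x I0 I1 * ?P = (\<Prod>i\<in>visible M x I1. lin (x i)) * (\<Prod>i\<in>visible M x I0. geo (x i) * lin (- x i))"
      by (simp add: h_series_def prod.distrib mult_ac)
    then show ?thesis by (simp add: geo_lin)
  qed
  also have "mcong M (trunc_eval R \<dots> y) (\<Prod>i\<in>visible M x I1. 1 + x i * y)"
    using trunc_eval_prod [of "visible M x I1" "\<lambda>i. lin (x i)" M R y] R lin by (simp add: trunc_eval_lin)
  finally show ?thesis .
qed

lemma toeplitz_coef_lin:
  assumes "F' = lin x * F"
  shows "toeplitz_coef K F' G k = toeplitz_coef K F G k + x * toeplitz_coef K F G (k - 1)"
proof -
  have "icoef (lin x * F) k = icoef F k + x * icoef F (k - 1)" for k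
  proof (cases "k \<le> 0")
    case True
    then show ?thesis by (auto simp: icoef_def lin_def algebra_simps)
  next
    case False
    then obtain n where "k = int (Suc n)" by (metis gr0_implies_Suc not_le zero_less_imp_eq_int)
    then have "nat k = Suc n" "nat (k - 1) = n" by auto
    then show ?thesis using False by (auto simp: icoef_def lin_def distrib_right mult.assoc)
  qed
  then show ?thesis
    unfolding toeplitz_coef_def assms by (simp add: algebra_simps sum.distrib sum_distrib_left)
qed

lemma toeplitz_coef_one_Toeplitz:
  assumes "G $ 0 = 1"
  shows "DET {lo..hi::int} (\<lambda>r c. toeplitz_coef K 1 G (c - r)) = 1"
proof -
  have "DET {lo..hi} (\<lambda>r c. toeplitz_coef K 1 G (c - r)) = (\<Prod>r\<in>{lo..hi}. toeplitz_coef K 1 G (r - r))"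
    by (rule DET_lower_triangular) (auto simp: toeplitz_coef_def icoef_one)
  also have "\<dots> = 1"
  proof (intro prod.neutral ballI)
    fix r
    have "toeplitz_coef K 1 G (r - r) = (\<Sum>j\<le>K. if j = 0 then G $ j else 0)"
      unfolding toeplitz_coef_def by (intro sum.cong) (auto simp: icoef_one)
    then show "toeplitz_coef K 1 G (r - r) = 1" using assms by simp
  qed
  finally show ?thesis .
qed

text \<open>
  Without letters the matrix is unitriangular. Dividing the symbol by \<open>1 - x\<^sub>i t\<close> for an even letter
  or multiplying it by \<open>1 + x\<^sub>i t\<close> for an odd one is controlled by \<open>Toeplitz_step\<close>.
\<close>

lemma Toeplitz_alphabet:
  fixes x :: "'i \<Rightarrow> ('v, 'r::comm_ring_1) mfps"
  assumes x: "alphabet x" and G: "graded G" "graded W" "W * G = 1" "G $ 0 = 1" "W $ 0 = 1"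
    and R: "size M \<le> R" "lo + int R \<le> hi + 1" "lo \<le> hi" and fin: "finite P0" "finite P1"
  shows "mcong M (DET {lo..hi} (\<lambda>r c. toeplitz_coef (size M) ((\<Prod>i\<in>P1. lin (x i)) * (\<Prod>i\<in>P0. geo (x i))) G (c - r))
      * (\<Prod>i\<in>P0. trunc_eval R W (x i))) (\<Prod>i\<in>P1. trunc_eval R W (- x i))"
proof -
  have step: "mcong M (DET {lo..hi} (\<lambda>r c. toeplitz_coef (size M) (lin y * F) G (c - r)))
      (trunc_eval R W (- y) * DET {lo..hi} (\<lambda>r c. toeplitz_coef (size M) F G (c - r)))" for F y
  proof -
    have "mcong M (DET {lo..hi} (\<lambda>r c. toeplitz_coef (size M) F G (c - r) - (- y) * toeplitz_coef (size M) F G (c - r - 1)))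
      ((\<Sum>k\<le>R. W $ k * (- y) ^ k) * DET {lo..hi} (\<lambda>r c. toeplitz_coef (size M) F G (c - r)))"
    proof (rule Toeplitz_step [OF R(3,2)])
      show "W $ 0 = 1" by (rule G)
      fix c assume "c \<in> {lo..hi}"
      then show "mcong M (\<Sum>k\<le>R. W $ k * toeplitz_coef (size M) F G (c - hi - 1 + int k)) 0"
        using toeplitz_coef_inverse_right [OF G(2,1,3) R(1), of F "c - hi - 1"] by simp
    qed
    then show ?thesis by (simp add: trunc_eval_def toeplitz_coef_lin [OF refl])
  qed
  have even: "mcong M (DET {lo..hi} (\<lambda>r c. toeplitz_coef (size M) (\<Prod>i\<in>P0. geo (x i)) G (c - r))
      * (\<Prod>i\<in>P0. trunc_eval R W (x i))) 1"
    using fin(1)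
  proof (induction P0 rule: finite_induct)
    case empty
    then show ?case using toeplitz_coef_one_Toeplitz [OF G(4)] by simp
  next
    case (insert a P)
    let ?T = "\<lambda>F. DET {lo..hi} (\<lambda>r c. toeplitz_coef (size M) F G (c - r))"
    let ?F = "\<Prod>i\<in>P. geo (x i)"
    let ?e = "\<Prod>i\<in>P. trunc_eval R W (x i)"
    have "?T (geo (x a) * ?F) * (trunc_eval R W (x a) * ?e)
        = (trunc_eval R W (- (- x a)) * ?T (geo (x a) * ?F)) * ?e"
      by (simp add: mult_ac)
    also have "mcong M \<dots> (?T (lin (- x a) * (geo (x a) * ?F)) * ?e)"
      by (intro mcong_mult mcong_sym [OF step]) auto
    also have "lin (- x a) * (geo (x a) * ?F) = ?F"
      using geo_lin [of "x a"] by (simp add: mult.assoc [symmetric] mult.commute)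
    also note insert.IH
    finally show ?case using insert.hyps by simp
  qed
  show ?thesis
    using fin(2)
  proof (induction P1 rule: finite_induct)
    case empty
    then show ?case using even by simp
  next
    case (insert a P)
    let ?T = "\<lambda>F. DET {lo..hi} (\<lambda>r c. toeplitz_coef (size M) F G (c - r))"
    let ?F = "(\<Prod>i\<in>P. lin (x i)) * (\<Prod>i\<in>P0. geo (x i))"
    let ?e = "\<Prod>i\<in>P0. trunc_eval R W (x i)"
    have "mcong M (?T (lin (x a) * ?F) * ?e) (trunc_eval R W (- x a) * ?T ?F * ?e)"
      by (intro mcong_mult step) auto
    also have "\<dots> = trunc_eval R W (- x a) * (?T ?F * ?e)" by (simp add: mult_ac)
    also have "mcong M \<dots> (trunc_eval R W (- x a) * (\<Prod>i\<in>P. trunc_eval R W (- x i)))"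
      by (intro mcong_mult insert.IH) auto
    finally show ?case using insert.hyps by (simp add: mult.assoc)
  qed
qed

lemma h_series_nth_0:
  fixes x :: "'i \<Rightarrow> ('v, 'r::comm_ring_1) mfps"
  shows "h_series M x I0 I1 $ 0 = 1"
proof -
  have "(\<Prod>i\<in>J. F i) $ 0 = 1" if "\<And>i. F i $ 0 = 1" for F :: "'i \<Rightarrow> ('v, 'r) mfps fps" and J
    using that by (induction J rule: infinite_finite_induct) auto
  then show ?thesis by (simp add: h_series_def lin_nth)
qed

text \<open>
  The factors of \<open>\<Delta>\<close> are the values of \<open>1 / H\<^sub>B(t)\<close> at \<open>t = x\<^sub>a\<close> for even \<open>a\<close>, and the inverses of its values
  at \<open>t = - x\<^sub>a\<close> for odd \<open>a\<close>. Modulo \<open>M\<close> the determinant is the same for all intervals longer than the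
  degree of \<open>M\<close>.
\<close>

theorem Toeplitz_Delta:
  fixes x :: "'i \<Rightarrow> ('v, 'r::comm_ring_1) mfps" and y :: "'j \<Rightarrow> ('v, 'r) mfps"
  assumes x: "alphabet x" and y: "alphabet y" and R: "size M < R" "lo + int R \<le> hi + 1"
  defines "P \<equiv> \<lambda>I J s. \<Prod>a\<in>visible M x I. \<Prod>b\<in>visible M y J. 1 + s * (x a * y b)"
  shows "mcong M (DET {lo..hi} (\<lambda>r c. toeplitz_coef (size M) (h_series M x A0 A1) (h_series M y B0 B1) (c - r))
      * (P A0 B0 (- 1) * P A1 B1 (- 1))) (P A0 B1 1 * P A1 B0 1)"
proof -
  let ?G = "h_series M y B0 B1" and ?W = "h_series M (\<lambda>b. - y b) B1 B0"
  let ?T = "DET {lo..hi} (\<lambda>r c. toeplitz_coef (size M) (h_series M x A0 A1) ?G (c - r))"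
  let ?e0 = "\<Prod>a\<in>visible M x A0. trunc_eval R ?W (x a)" and ?e1 = "\<Prod>a\<in>visible M x A1. trunc_eval R ?W (- x a)"
  have my: "alphabet (\<lambda>b. - y b)"
    using y by (auto simp: alphabet_def visible_uminus intro: order_ge_uminus)
  have GW: "?W * ?G = 1" using h_series_inverse [OF y] by (simp add: mult.commute)
  have T: "mcong M (?T * ?e0) ?e1"
    unfolding h_series_def [of M x]
    using x y my R GW
    by (intro Toeplitz_alphabet) (auto simp: h_series_nth_0 intro: graded_h_series)
  have ev: "mcong M (trunc_eval R ?W t * (\<Prod>b\<in>visible M y B1. 1 + t * y b)) (\<Prod>b\<in>visible M y B0. 1 - t * y b)" for t
    using trunc_eval_h_series [OF my, of M R B1 B0 t] R by (simp add: visible_uminus mult.commute)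
  have e0: "mcong M (?e0 * P A0 B1 1) (P A0 B0 (- 1))"
    unfolding P_def prod.distrib [symmetric] using ev by (intro mcong_prod) simp
  have e1: "mcong M (?e1 * P A1 B1 (- 1)) (P A1 B0 1)"
    unfolding P_def prod.distrib [symmetric]
  proof (intro mcong_prod)
    fix a show "mcong M (trunc_eval R ?W (- x a) * (\<Prod>b\<in>visible M y B1. 1 + (- 1) * (x a * y b)))
        (\<Prod>b\<in>visible M y B0. 1 + 1 * (x a * y b))"
      using ev [of "- x a"] by simp
  qed
  have "mcong M (?T * (P A0 B0 (- 1) * P A1 B1 (- 1))) (?T * ((?e0 * P A0 B1 1) * P A1 B1 (- 1)))"
    by (intro mcong_mult mcong_sym [OF e0]) auto
  also have "\<dots> = (?T * ?e0) * (P A0 B1 1 * P A1 B1 (- 1))" by (simp add: mult_ac)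
  also have "mcong M \<dots> (?e1 * (P A0 B1 1 * P A1 B1 (- 1)))"
    by (intro mcong_mult T) auto
  also have "\<dots> = P A0 B1 1 * (?e1 * P A1 B1 (- 1))" by (simp add: mult_ac)
  also have "mcong M \<dots> (P A0 B1 1 * P A1 B0 1)"
    by (intro mcong_mult e1) auto
  finally show ?thesis .
qed

section \<open>The rational super Schur function as a determinant\<close>

lemma gen_partitions_length: "l \<in> gen_partitions d \<Longrightarrow> length l = d"
  by (simp add: gen_partitions_def)

lemma gen_partitions_antimono: "l \<in> gen_partitions d \<Longrightarrow> i \<le> j \<Longrightarrow> j < d \<Longrightarrow> l ! j \<le> l ! i"
  by (cases "i = j") (auto simp: gen_partitions_def sorted_wrt_iff_nth_less)

lemma gen_partitionsI:
  "length l = d \<Longrightarrow> (\<And>i j. i < j \<Longrightarrow> j < d \<Longrightarrow> l ! j \<le> l ! i) \<Longrightarrow> l \<in> gen_partitions d"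
  by (auto simp: gen_partitions_def sorted_wrt_iff_nth_less)

lemma ex_shift_nonneg: "\<exists>p::nat. \<forall>x\<in>set xs. 0 \<le> x + int p"
proof (induction xs)
  case (Cons a xs)
  then obtain p where p: "\<forall>x\<in>set xs. 0 \<le> x + int p" by blast
  show ?case
  proof (intro exI ballI)
    fix x assume x: "x \<in> set (a # xs)"
    show "0 \<le> x + int (p + nat (- a))"
    proof (cases "x = a")
      case False
      then have "0 \<le> x + int p" using x p by auto
      then show ?thesis by simp
    qed simp
  qed
qed simp

lemma min_shift_nonneg:
  assumes "i < length l"
  shows "0 \<le> l ! i + int (min_shift l)"
proof -
  obtain p where "\<forall>x\<in>set l. 0 \<le> x + int p" using ex_shift_nonneg by blast
  then have "\<forall>i<length l. 0 \<le> l ! i + int p" by simp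
  then have "\<forall>i<length l. 0 \<le> l ! i + int (min_shift l)" unfolding min_shift_def by (rule LeastI)
  then show ?thesis using assms by blast
qed

lemma shift_partition:
  assumes l: "l \<in> gen_partitions d" and p: "\<And>i. i < d \<Longrightarrow> 0 \<le> l ! i + int p"
  shows "is_partition (shift l p)"
proof -
  have "antimono (shift l p)"
  proof (intro antimonoI)
    fix i j :: nat assume "i \<le> j"
    then show "shift l p j \<le> shift l p i"
      using gen_partitions_antimono [OF l, of i j] gen_partitions_length [OF l]
      by (auto simp: shift_def nat_mono)
  qed
  moreover have "{i. shift l p i \<noteq> 0} \<subseteq> {..<d}"
    using gen_partitions_length [OF l] by (auto simp: shift_def split: if_splits)
  ultimately show ?thesis by (auto simp: is_partition_def intro: finite_subset)
qed

lemma shift_zero: "l \<in> gen_partitions d \<Longrightarrow> i \<ge> d \<Longrightarrow> shift l p i = 0"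
  by (simp add: shift_def gen_partitions_length)

lemma shift_nth: "l \<in> gen_partitions d \<Longrightarrow> i < d \<Longrightarrow> 0 \<le> l ! i + int p \<Longrightarrow> int (shift l p i) = l ! i + int p"
  by (simp add: shift_def gen_partitions_length)

text \<open>
  \<open>tdet\<close> for generalized partitions, given as lists; it is invariant under a common shift of both.
\<close>

definition int_tdet :: "nat \<Rightarrow> 'c::comm_ring_1 fps \<Rightarrow> int list \<Rightarrow> int list \<Rightarrow> 'c" where
  "int_tdet d F l k = DET {..<d} (\<lambda>i j. icoef F (l ! i - int i - (k ! j - int j)))"

lemma tdet_shift:
  assumes l: "l \<in> gen_partitions d" "\<And>i. i < d \<Longrightarrow> 0 \<le> l ! i + int p"
    and k: "k \<in> gen_partitions d" "\<And>i. i < d \<Longrightarrow> 0 \<le> k ! i + int p"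
  shows "tdet d F (shift l p) (shift k p) = int_tdet d F l k"
  unfolding tdet_def int_tdet_def
  by (intro DET_cong arg_cong [where f = "icoef F"]) (simp add: shift_nth [OF l(1)] shift_nth [OF k(1)] l k)

lemma int_tdet_zero:
  assumes l: "l \<in> gen_partitions d" and k: "k \<in> gen_partitions d" and i: "i < d" "l ! i < k ! i"
  shows "int_tdet d F l k = 0"
proof -
  obtain p where p: "\<forall>x\<in>set (l @ k). 0 \<le> x + int p" using ex_shift_nonneg by blast
  then have l': "0 \<le> l ! i + int p" and k': "0 \<le> k ! i + int p" if "i < d" for i
    using that gen_partitions_length [OF l] gen_partitions_length [OF k] by auto
  have "int_tdet d F l k = tdet d F (shift l p) (shift k p)" using l k l' k' by (simp add: tdet_shift)
  also have "\<dots> = 0"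
  proof (rule tdet_zero)
    show "antimono (shift l p)" "antimono (shift k p)"
      using shift_partition [OF l l'] shift_partition [OF k k'] by (auto simp: is_partition_def)
    show "shift l p i < shift k p i"
      using i shift_nth [OF l i(1) l'] shift_nth [OF k i(1) k'] by linarith
  qed (rule i)
  finally show ?thesis .
qed

text \<open>
  Subtracting the index turns weakly into strictly decreasing sequences, as Cauchy-Binet wants them.
\<close>

lemma bij_betw_gen_partitions:
  "bij_betw (\<lambda>k. map (\<lambda>i. k i + int i) [0..<d])
     {k. k \<in> {..<d} \<rightarrow>\<^sub>E C \<and> strict_mono_on {..<d} (uminus \<circ> k)}
     {l \<in> gen_partitions d. \<forall>i<d. l ! i - int i \<in> C}"
proof (rule bij_betwI [where g = "\<lambda>l. restrict (\<lambda>i. l ! i - int i) {..<d}"])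
  show "(\<lambda>k. map (\<lambda>i. k i + int i) [0..<d]) \<in> {k. k \<in> {..<d} \<rightarrow>\<^sub>E C \<and> strict_mono_on {..<d} (uminus \<circ> k)}
      \<rightarrow> {l \<in> gen_partitions d. \<forall>i<d. l ! i - int i \<in> C}"
  proof (intro funcsetI CollectI conjI gen_partitionsI)
    fix k :: "nat \<Rightarrow> int" and i j
    assume k: "k \<in> {k. k \<in> {..<d} \<rightarrow>\<^sub>E C \<and> strict_mono_on {..<d} (uminus \<circ> k)}" and ij: "i < j" "j < d"
    have "k (i + n) + int (i + n) \<le> k i + int i" if "i + n < d" for n using that
    proof (induction n)
      case (Suc n)
      then have "k (i + Suc n) < k (i + n)" using k by (auto simp: strict_mono_on_def)
      with Suc show ?case by simp
    qed simp
    from this [of "j - i"] ij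
    show "map (\<lambda>i. k i + int i) [0..<d] ! j \<le> map (\<lambda>i. k i + int i) [0..<d] ! i" by simp
  qed auto
  show "(\<lambda>l. restrict (\<lambda>i. l ! i - int i) {..<d}) \<in> {l \<in> gen_partitions d. \<forall>i<d. l ! i - int i \<in> C}
      \<rightarrow> {k. k \<in> {..<d} \<rightarrow>\<^sub>E C \<and> strict_mono_on {..<d} (uminus \<circ> k)}"
  proof (intro funcsetI CollectI conjI strict_mono_onI)
    fix l r s assume l: "l \<in> {l \<in> gen_partitions d. \<forall>i<d. l ! i - int i \<in> C}" and rs: "r \<in> {..<d}" "s \<in> {..<d}" "r < s"
    then have "l ! s \<le> l ! r" by (intro gen_partitions_antimono) auto
    then show "(uminus \<circ> restrict (\<lambda>i. l ! i - int i) {..<d}) r < (uminus \<circ> restrict (\<lambda>i. l ! i - int i) {..<d}) s"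
      using rs by simp
  qed auto
  fix k assume "k \<in> {k. k \<in> {..<d} \<rightarrow>\<^sub>E C \<and> strict_mono_on {..<d} (uminus \<circ> k)}"
  then show "restrict (\<lambda>i. map (\<lambda>i. k i + int i) [0..<d] ! i - int i) {..<d} = k"
    by (auto simp: fun_eq_iff PiE_def extensional_def)
next
  fix l assume "l \<in> {l \<in> gen_partitions d. \<forall>i<d. l ! i - int i \<in> C}"
  then show "map (\<lambda>i. restrict (\<lambda>i. l ! i - int i) {..<d} i + int i) [0..<d] = l"
    by (auto intro!: nth_equalityI simp: gen_partitions_length)
qed

lemma Cauchy_Binet_gen_partitions:
  fixes C :: "int set"
  assumes "finite C"
  shows "DET {..<d} (\<lambda>i j. \<Sum>c\<in>C. P i c * Q c j)
    = (\<Sum>l | l \<in> gen_partitions d \<and> (\<forall>i<d. l ! i - int i \<in> C).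
        DET {..<d} (\<lambda>i j. P i (l ! j - int j)) * DET {..<d} (\<lambda>i j. Q (l ! i - int i) j))"
proof -
  let ?f = "\<lambda>k. map (\<lambda>i. k i + int i) [0..<d]"
  let ?T = "\<lambda>l. DET {..<d} (\<lambda>i j. P i (l ! j - int j)) * DET {..<d} (\<lambda>i j. Q (l ! i - int i) j)"
  have "DET {..<d} (\<lambda>i j. \<Sum>c\<in>C. P i c * Q c j)
    = (\<Sum>k | k \<in> {..<d} \<rightarrow>\<^sub>E C \<and> strict_mono_on {..<d} (uminus \<circ> k).
        DET {..<d} (\<lambda>i j. P i (k j)) * DET {..<d} (\<lambda>i j. Q (k i) j))"
    using assms by (intro Cauchy_Binet) auto
  also have "\<dots> = (\<Sum>k | k \<in> {..<d} \<rightarrow>\<^sub>E C \<and> strict_mono_on {..<d} (uminus \<circ> k). ?T (?f k))"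
    by (intro sum.cong refl arg_cong2 [where f = "(*)"] DET_cong) simp_all
  also have "\<dots> = (\<Sum>l | l \<in> gen_partitions d \<and> (\<forall>i<d. l ! i - int i \<in> C). ?T l)"
    by (rule sum.reindex_bij_betw [OF bij_betw_gen_partitions])
  finally show ?thesis .
qed

lemma finite_gen_partitions:
  assumes "finite C"
  shows "finite {l \<in> gen_partitions d. \<forall>i<d. l ! i - int i \<in> C}"
proof -
  have "finite ({..<d} \<rightarrow>\<^sub>E C)" using assms by (intro finite_PiE) auto
  then have "finite {k. k \<in> {..<d} \<rightarrow>\<^sub>E C \<and> strict_mono_on {..<d} (uminus \<circ> k)}" by (rule rev_finite_subset) auto
  then show ?thesis using bij_betw_finite [OF bij_betw_gen_partitions] by blast
qed

lemma order_ge_tdet_mcong_zero: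
  assumes "graded F" "size M + (\<Sum>i<n. mu i) < (\<Sum>i<n. la i)"
  shows "mcong M (tdet n F la mu) 0"
  using assms by (intro order_ge_mcong_zero [of "Suc (size M)"] order_ge_tdet) auto

text \<open>
  The summand of \<open>\<kappa>\<close> is a product of two determinants, one for \<open>\<lambda> / \<kappa>\<close> and one for the complement of \<open>\<kappa>\<close> in
  the rectangle, neither of which depends on the shift \<open>p\<close>. Hence the sum is a Cauchy-Binet sum. Its
  index set may be changed freely: if \<open>\<kappa>\<close> is not contained in \<open>\<lambda>\<close> then the first determinant is zero, and if
  \<open>\<kappa>\<close> is very negative then the second one vanishes modulo \<open>M\<close>.
\<close>

theorem rational_super_schur_det:
  fixes M :: "('a + 'b) multiset" and A0 A1 :: "'a set" and B0 B1 :: "'b set"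
  defines "hA \<equiv> h_series M (xA :: 'a \<Rightarrow> ('a + 'b, 'r::comm_ring_1) mfps) A0 A1"
    and "hB \<equiv> h_series M (xB_inv :: 'b \<Rightarrow> ('a + 'b, 'r) mfps) B0 B1"
  assumes ctb: "countable A0" "countable A1" "countable B0" "countable B1" and l: "l \<in> gen_partitions d"
  shows "mcong M (rational_super_schur A0 A1 B0 B1 d l :: ('a + 'b, 'r) mfps)
    (DET {..<d} (\<lambda>i j. toeplitz_coef (size M) hA hB (l ! i - int i + int j)))"
proof -
  let ?Ks = "{k \<in> gen_partitions d. \<forall>i<d. k ! i \<le> min (l ! i) 0}"
  let ?S = "\<lambda>p eta. skew_super_schur (xA :: 'a \<Rightarrow> ('a + 'b, 'r) mfps) A0 A1 (shift l p) eta *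
          skew_super_schur xB_inv B0 B1 (rect d p) eta"
  let ?t = "\<lambda>k. let p = min_shift k; eta = shift k p in ?S p eta"
  define C where "C M = {- (int d + int (size (M :: ('a + 'b) multiset)))..0}" for M
  let ?J = "\<lambda>M. {k \<in> gen_partitions d. \<forall>i<d. k ! i - int i \<in> C M}"
  let ?hA = "\<lambda>M. h_series M (xA :: 'a \<Rightarrow> ('a + 'b, 'r) mfps) A0 A1"
  let ?hB = "\<lambda>M. h_series M (xB_inv :: 'b \<Rightarrow> ('a + 'b, 'r) mfps) B0 B1"
  have finJ: "finite (?J M)" for M by (rule finite_gen_partitions) (simp add: C_def)
  have factors: "mcong M (?t k) (int_tdet d (?hA M) l k * tdet d (?hB M) (rect d (min_shift k)) (shift k (min_shift k)))"
    if k: "k \<in> ?Ks" for k M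
  proof -
    let ?p = "min_shift k"
    have kg: "k \<in> gen_partitions d" using k by simp
    have k0: "0 \<le> k ! i + int ?p" if "i < d" for i
      using min_shift_nonneg [of i k] that gen_partitions_length [OF kg] by simp
    have l0: "0 \<le> l ! i + int ?p" if "i < d" for i
    proof -
      have "k ! i \<le> l ! i" using k that by simp
      then show ?thesis using k0 [OF that] by linarith
    qed
    have "is_partition (rect d ?p)"
      by (auto simp: is_partition_def rect_def antimono_def intro: finite_subset [of _ "{..<d}"])
    then have "mcong M (?S ?p (shift k ?p))
        (tdet d (?hA M) (shift l ?p) (shift k ?p) * tdet d (?hB M) (rect d ?p) (shift k ?p))"
      using ctb shift_partition [OF l l0] shift_partition [OF kg k0] shift_zero [OF l] shift_zero [OF kg]
      by (intro mcong_mult skew_super_schur_row alphabet_xA alphabet_xB_inv) (auto simp: rect_def)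
    then show ?thesis by (simp add: Let_def tdet_shift l l0 kg k0)
  qed
  have outside: "mcong M (?t k) 0" if k: "k \<in> ?Ks - ?J M" for k M
  proof -
    let ?p = "min_shift k"
    have kg: "k \<in> gen_partitions d" and kK: "k \<in> ?Ks" using k by auto
    have k0: "0 \<le> k ! i + int ?p" if "i < d" for i
      using min_shift_nonneg [of i k] that gen_partitions_length [OF kg] by simp
    have kneg: "k ! i \<le> 0" if "i < d" for i using kK that by simp
    obtain i where i: "i < d" "k ! i - int i \<notin> C M" using k by auto
    then have ki: "k ! i < - int (size M)" using kneg [of i] by (auto simp: C_def)
    have "(\<Sum>i<d. int (shift k ?p i)) = (\<Sum>i<d. k ! i + int ?p)"
      by (intro sum.cong) (auto simp: shift_nth [OF kg] k0)
    also have "\<dots> = (\<Sum>i<d. k ! i) + int d * int ?p" by (simp add: sum.distrib)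
    also have "(\<Sum>i<d. k ! i) \<le> k ! i"
    proof -
      have "(\<Sum>i<d. k ! i) = k ! i + (\<Sum>j\<in>{..<d} - {i}. k ! j)" using i by (simp add: sum.remove)
      also have "(\<Sum>j\<in>{..<d} - {i}. k ! j) \<le> 0" using kneg by (intro sum_nonpos) auto
      finally show ?thesis by simp
    qed
    finally have "int (size M + (\<Sum>i<d. shift k ?p i)) < int (d * ?p)" using ki by simp
    then have "size M + (\<Sum>i<d. shift k ?p i) < d * ?p" by (simp only: of_nat_less_iff)
    moreover have "(\<Sum>i<d. rect d ?p i) = d * ?p" by (simp add: rect_def)
    ultimately have "mcong M (tdet d (?hB M) (rect d ?p) (shift k ?p)) 0"
      by (intro order_ge_tdet_mcong_zero graded_h_series alphabet_xB_inv) simp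
    then have "mcong M (int_tdet d (?hA M) l k * tdet d (?hB M) (rect d ?p) (shift k ?p)) (int_tdet d (?hA M) l k * 0)"
      by (intro mcong_mult) auto
    with factors [OF kK] show ?thesis by (auto intro: mcong_trans)
  qed
  have "mcong M (rational_super_schur A0 A1 B0 B1 d l) (\<Sum>k\<in>?Ks \<inter> ?J M. ?t k)"
    unfolding rational_super_schur_def
  proof (rule mcong_infsum)
    fix M :: "('a + 'b) multiset"
    have "{k \<in> ?Ks. \<not> mcong M (?t k) 0} \<subseteq> ?J M" using outside by blast
    then show "finite {k \<in> ?Ks. \<not> mcong M (?t k) 0}" using finJ finite_subset by blast
  next
    show "finite (?Ks \<inter> ?J M)" using finJ by blast
  qed (use outside in auto)
  also have "mcong M \<dots> (\<Sum>k\<in>?Ks \<inter> ?J M. int_tdet d hA l k * DET {..<d} (\<lambda>i j. icoef hB (- int j - (k ! i - int i))))"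
  proof (intro mcong_sum)
    fix k assume k: "k \<in> ?Ks \<inter> ?J M"
    let ?p = "min_shift k"
    have kg: "k \<in> gen_partitions d" using k by simp
    have k0: "0 \<le> k ! i + int ?p" if "i < d" for i
      using min_shift_nonneg [of i k] that gen_partitions_length [OF kg] by simp
    have "tdet d hB (rect d ?p) (shift k ?p)
        = DET {..<d} (\<lambda>j i. icoef hB (- int j - (k ! i - int i)))"
      unfolding tdet_def
      by (intro DET_cong arg_cong [where f = "icoef hB"]) (simp add: rect_def shift_nth [OF kg] k0)
    also have "\<dots> = DET {..<d} (\<lambda>i j. icoef hB (- int j - (k ! i - int i)))"
      by (rule DET_transpose [symmetric, of "{..<d}" "\<lambda>j i. icoef hB (- int j - (k ! i - int i))"]) simp
    finally show "mcong M (?t k) (int_tdet d hA l k * DET {..<d} (\<lambda>i j. icoef hB (- int j - (k ! i - int i))))"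
      using factors [of k M] k by (simp add: hA_def hB_def)
  qed
  also have "(\<Sum>k\<in>?Ks \<inter> ?J M. int_tdet d hA l k * DET {..<d} (\<lambda>i j. icoef hB (- int j - (k ! i - int i))))
      = (\<Sum>k\<in>?J M. int_tdet d hA l k * DET {..<d} (\<lambda>i j. icoef hB (- int j - (k ! i - int i))))"
  proof (intro sum.mono_neutral_left finJ ballI)
    fix k assume k: "k \<in> ?J M - ?Ks \<inter> ?J M"
    then have kg: "k \<in> gen_partitions d" by simp
    have neg: "k ! i \<le> 0" if "i < d" for i
    proof -
      have "k ! i \<le> k ! 0" using gen_partitions_antimono [OF kg, of 0 i] that by simp
      moreover have "k ! 0 - int 0 \<in> C M" using k that by (metis (mono_tags, lifting) Diff_iff le_less_trans mem_Collect_eq zero_le)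
      ultimately show ?thesis by (simp add: C_def)
    qed
    then obtain i where "i < d" "l ! i < k ! i" using k by (auto simp: not_le)
    then have "int_tdet d hA l k = 0" by (intro int_tdet_zero [OF l kg])
    then show "int_tdet d hA l k * DET {..<d} (\<lambda>i j. icoef hB (- int j - (k ! i - int i))) = 0" by simp
  qed auto
  also have "\<dots> = DET {..<d} (\<lambda>i j. \<Sum>c\<in>C M. icoef hA (l ! i - int i - c) * icoef hB (- int j - c))"
    by (subst Cauchy_Binet_gen_partitions) (simp_all add: int_tdet_def C_def)
  also have "mcong M \<dots> (DET {..<d} (\<lambda>i j. toeplitz_coef (size M) hA hB (l ! i - int i - (- int j))))"
    unfolding hA_def hB_def
    by (intro mcong_DET toeplitz_coef_convolution graded_h_series alphabet_xB_inv) (auto simp: C_def)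
  finally show ?thesis by simp
qed

section \<open>The Coxeter group and its coset representatives\<close>

text \<open>
  The increasing enumeration of the nonzero integers. It turns all generators, including the one
  that exchanges \<open>-1\<close> and \<open>1\<close>, into transpositions of neighbours.
\<close>

definition enum_nz :: "int \<Rightarrow> int" where
  "enum_nz n = (if n < 0 then n else n + 1)"

lemma enum_nz_less [simp]: "enum_nz a < enum_nz b \<longleftrightarrow> a < b"
  by (auto simp: enum_nz_def)

lemma enum_nz_eq [simp]: "enum_nz a = enum_nz b \<longleftrightarrow> a = b"
  by (auto simp: enum_nz_def)

lemma enum_nz_nonzero [simp]: "enum_nz a \<noteq> 0"
  by (auto simp: enum_nz_def)

lemma ex_enum_nz: "s \<noteq> 0 \<Longrightarrow> \<exists>a. s = enum_nz a"
  by (rule exI [of _ "if s < 0 then s else s - 1"]) (auto simp: enum_nz_def)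

lemma reflect_eq: "reflect i = transpose (enum_nz (i - 1)) (enum_nz i)"
  by (auto simp: reflect_def enum_nz_def)

lemma reflect_enum_nz: "reflect i (enum_nz a) = enum_nz (transpose (i - 1) i a)"
  by (auto simp: reflect_eq transpose_def)

lemma permutation_reflect: "permutation (reflect i)"
  by (simp add: reflect_eq permutation_swap_id)

lemma reflect_0 [simp]: "reflect i 0 = 0"
  using enum_nz_nonzero by (metis reflect_eq transpose_apply_other)

lemma reflect_reflect: "reflect i \<circ> (reflect i \<circ> w) = w"
  by (simp add: reflect_eq o_assoc)

lemma inv_reflect: "inv (reflect i) = reflect i"
  by (rule inv_unique_comp) (use reflect_reflect [of i id] in auto)

lemma word_perm_Nil [simp]: "word_perm [] = id"
  and word_perm_Cons [simp]: "word_perm (i # ws) = reflect i \<circ> word_perm ws"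
  by (simp_all add: word_perm_def)

lemma permutation_word_perm: "permutation (word_perm ws)"
proof (induction ws)
  case (Cons i ws)
  show ?case unfolding word_perm_Cons by (rule permutation_compose [OF permutation_reflect Cons])
qed simp

lemma word_perm_0: "word_perm ws 0 = 0"
  by (induction ws) auto

lemma sign_word_perm: "sign (word_perm ws) = (- 1) ^ length ws"
proof (induction ws)
  case (Cons i ws)
  have "sign (reflect i) = - 1" by (simp add: reflect_eq sign_swap_id)
  then show ?case
    unfolding word_perm_Cons sign_compose [OF permutation_reflect permutation_word_perm] Cons by simp
qed simp

text \<open>
  Inversions are recorded by values, not by positions, since the generators multiply from the left.
\<close>

definition inversions :: "(int \<Rightarrow> int) \<Rightarrow> (int \<times> int) set" where
  "inversions w = {(a, b). a < b \<and> inv w (enum_nz b) < inv w (enum_nz a)}"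

lemma finite_inversions:
  assumes "permutation w"
  shows "finite (inversions w)"
proof -
  obtain S where S: "finite S" "w permutes S" using assms by (auto simp: permutation_permutes)
  define N where "N = Max (abs ` insert 0 S)"
  have N: "\<bar>s\<bar> \<le> N" if "s \<in> S" for s unfolding N_def using S that by (intro Max_ge) auto
  have N0: "0 \<le> N" unfolding N_def using S by (intro Max_ge) auto
  have fixed: "inv w s = s" if "\<bar>s\<bar> > N" for s
    using permutes_not_in [OF permutes_inv [OF S(2)], of s] N [of s] that by fastforce
  have bounded: "\<bar>inv w s\<bar> \<le> N" if "\<bar>s\<bar> \<le> N" for s
    using permutes_in_image [OF permutes_inv [OF S(2)], of s] permutes_not_in [OF permutes_inv [OF S(2)], of s] N that
    by metis
  have "inversions w \<subseteq> {- N - 1..N + 1} \<times> {- N - 1..N + 1}"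
  proof (clarsimp simp: inversions_def)
    fix a b :: int assume ab: "a < b" "inv w (enum_nz b) < inv w (enum_nz a)"
    have "enum_nz a < enum_nz b" using ab by simp
    with ab have "\<bar>enum_nz a\<bar> \<le> N" "\<bar>enum_nz b\<bar> \<le> N"
      using fixed [of "enum_nz a"] fixed [of "enum_nz b"] bounded [of "enum_nz a"] bounded [of "enum_nz b"]
      by linarith+
    then show "- N - 1 \<le> a \<and> a \<le> N + 1 \<and> - N - 1 \<le> b \<and> b \<le> N + 1"
      by (auto simp: enum_nz_def split: if_splits)
  qed
  then show ?thesis by (rule finite_subset) auto
qed

text \<open>
  A transposition of neighbours preserves the order of all other pairs, so it only adds the
  inversion between the two neighbours.
\<close>

lemma card_inversions_reflect:
  assumes w: "permutation w" and asc: "inv w (enum_nz (i - 1)) < inv w (enum_nz i)"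
  shows "card (inversions (reflect i \<circ> w)) = Suc (card (inversions w))"
proof -
  let ?t = "transpose (i - 1) i" and ?r = "reflect i \<circ> w"
  have inv: "inv ?r = inv w \<circ> reflect i"
    using o_inv_distrib [of "reflect i" w] w permutation_reflect [of i]
    by (simp add: permutation_bijective inv_reflect)
  have r: "permutation ?r" using w permutation_reflect by (rule permutation_compose [rotated])
  have order: "?t a < ?t b \<and> (?t a, ?t b) \<noteq> (i - 1, i)" if "a < b" "(a, b) \<noteq> (i - 1, i)" for a b
    using that by (auto simp: transpose_def split: if_splits)
  have "inversions ?r - {(i - 1, i)} = (\<lambda>(a, b). (?t a, ?t b)) ` (inversions w - {(i - 1, i)})"
  proof (intro equalityI subsetI)
    fix z assume z: "z \<in> inversions ?r - {(i - 1, i)}"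
    obtain a b where ab: "z = (a, b)" by (cases z)
    have "(?t a, ?t b) \<in> inversions w - {(i - 1, i)}"
      using z order [of a b] by (auto simp: ab inversions_def inv reflect_enum_nz)
    then show "z \<in> (\<lambda>(a, b). (?t a, ?t b)) ` (inversions w - {(i - 1, i)})"
      by (rule rev_image_eqI) (simp add: ab)
  next
    fix z assume "z \<in> (\<lambda>(a, b). (?t a, ?t b)) ` (inversions w - {(i - 1, i)})"
    then obtain a b where "z = (?t a, ?t b)" "(a, b) \<in> inversions w - {(i - 1, i)}" by auto
    then show "z \<in> inversions ?r - {(i - 1, i)}"
      using order [of a b] by (auto simp: inversions_def inv reflect_enum_nz)
  qed
  moreover have "inj_on (\<lambda>(a, b). (?t a, ?t b)) (inversions w - {(i - 1, i)})"
    by (auto simp: inj_on_def dest: transpose_eq_imp_eq)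
  ultimately have "card (inversions ?r - {(i - 1, i)}) = card (inversions w - {(i - 1, i)})"
    by (simp add: card_image)
  moreover have "(i - 1, i) \<notin> inversions w" using asc by (simp add: inversions_def)
  moreover have "(i - 1, i) \<in> inversions ?r"
    using asc by (simp add: inversions_def inv reflect_enum_nz)
  ultimately show ?thesis
    using finite_inversions [OF r] by (metis Diff_empty Diff_insert0 card.remove)
qed

lemma card_inversions_reflect':
  assumes w: "permutation w" and desc: "\<not> inv w (enum_nz (i - 1)) < inv w (enum_nz i)"
  shows "card (inversions w) = Suc (card (inversions (reflect i \<circ> w)))"
proof -
  let ?r = "reflect i \<circ> w"
  have inv: "inv ?r = inv w \<circ> reflect i"
    using o_inv_distrib [of "reflect i" w] w permutation_reflect [of i]
    by (simp add: permutation_bijective inv_reflect)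
  have r: "permutation ?r" using w permutation_reflect by (rule permutation_compose [rotated])
  have "inj (inv w)"
    using w by (simp add: bij_imp_bij_inv bij_is_inj permutation_bijective)
  then have "inv w (enum_nz (i - 1)) \<noteq> inv w (enum_nz i)" by (simp add: inj_eq)
  then have "inv w (enum_nz i) < inv w (enum_nz (i - 1))" using desc by simp
  then have "inv ?r (enum_nz (i - 1)) < inv ?r (enum_nz i)"
    by (simp add: inv reflect_enum_nz)
  from card_inversions_reflect [OF r this] show ?thesis by (simp add: reflect_reflect)
qed

lemma card_inversions_word: "card (inversions (word_perm ws)) \<le> length ws"
proof (induction ws)
  case Nil
  have "inversions id = {}" by (auto simp: inversions_def)
  then show ?case unfolding word_perm_Nil by (simp only: card.empty le0)
next
  case (Cons i ws)
  have "card (inversions (reflect i \<circ> word_perm ws)) \<le> Suc (card (inversions (word_perm ws)))"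
    using card_inversions_reflect [OF permutation_word_perm, of ws i]
      card_inversions_reflect' [OF permutation_word_perm, of ws i] by linarith
  with Cons show ?case unfolding word_perm_Cons list.size by linarith
qed

lemma strict_mono_int:
  fixes g :: "int \<Rightarrow> int"
  assumes "\<And>i. P (i - 1) \<Longrightarrow> P i \<Longrightarrow> g (i - 1) < g i" "a < b" "\<And>i. a \<le> i \<Longrightarrow> i \<le> b \<Longrightarrow> P i"
  shows "g a < g b"
proof -
  have "g a < g (a + 1 + int n)" if "a + 1 + int n \<le> b" for n using that
  proof (induction n)
    case 0
    then show ?case using assms(1) [of "a + 1"] assms(3) by simp
  next
    case (Suc n)
    have "g (a + 1 + int (Suc n) - 1) < g (a + 1 + int (Suc n))"
      using Suc.prems assms(2) by (intro assms(1) assms(3)) auto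
    moreover have "a + 1 + int (Suc n) - 1 = a + 1 + int n" by simp
    moreover have "g a < g (a + 1 + int n)" using Suc by simp
    ultimately show ?case by (metis less_trans)
  qed
  from this [of "nat (b - a - 1)"] assms(2) show ?thesis by simp
qed

text \<open>
  As long as there are inversions, some generator removes one. A permutation of finite support
  without inversions is increasing and therefore the identity.
\<close>

lemma ex_reduced_word:
  assumes "permutation w" "w 0 = 0"
  shows "\<exists>ws. length ws = card (inversions w) \<and> word_perm ws = w"
  using assms
proof (induction "card (inversions w)" arbitrary: w)
  case (Suc n)
  have "\<exists>i. \<not> inv w (enum_nz (i - 1)) < inv w (enum_nz i)"
  proof (rule ccontr)
    assume *: "\<nexists>i. \<not> inv w (enum_nz (i - 1)) < inv w (enum_nz i)"
    have "inversions w = {}"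
    proof (clarsimp simp: inversions_def)
      fix a b :: int assume "a < b" "inv w (enum_nz b) < inv w (enum_nz a)"
      then show False
        using strict_mono_int [of "\<lambda>_. True" "\<lambda>i. inv w (enum_nz i)" a b] * by auto
    qed
    with Suc.hyps show False by simp
  qed
  then obtain i where i: "\<not> inv w (enum_nz (i - 1)) < inv w (enum_nz i)" by blast
  let ?r = "reflect i \<circ> w"
  have "n = card (inversions ?r)" using card_inversions_reflect' [OF Suc.prems(1) i] Suc.hyps(2) by simp
  moreover have "permutation ?r" using Suc.prems(1) permutation_reflect by (rule permutation_compose [rotated])
  ultimately obtain ws where "length ws = n" "word_perm ws = ?r"
    using Suc.hyps(1) [of ?r] Suc.prems(2) by auto
  then have "length (i # ws) = card (inversions w)" "word_perm (i # ws) = w"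
    using Suc.hyps(2) by (simp_all add: reflect_reflect)
  then show ?case by blast
next
  case 0
  then have "inversions w = {}" using finite_inversions by simp
  then have inc: "inv w (enum_nz a) < inv w (enum_nz b)" if "a < b" for a b
  proof -
    have "\<not> inv w (enum_nz b) < inv w (enum_nz a)" using \<open>inversions w = {}\<close> that by (auto simp: inversions_def)
    moreover have "inj (inv w)"
      using 0(2) by (simp add: bij_imp_bij_inv bij_is_inj permutation_bijective)
    then have "inv w (enum_nz a) \<noteq> inv w (enum_nz b)" using that by (simp add: inj_eq)
    ultimately show ?thesis by simp
  qed
  obtain S where S: "finite S" "w permutes S" using 0(2) by (auto simp: permutation_permutes)
  have w: "w permutes S - {0}" using S(2) 0(3) by (intro permutes_superset [OF S(2)]) auto
  have "strict_mono_on (S - {0}) (inv w)"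
  proof (intro strict_mono_onI)
    fix r s assume "r \<in> S - {0}" "s \<in> S - {0}" "r < s"
    moreover from this obtain a b where "r = enum_nz a" "s = enum_nz b"
      using ex_enum_nz [of r] ex_enum_nz [of s] by auto
    ultimately show "inv w r < inv w s" using inc [of a b] by simp
  qed
  then have "inv w = id" using S(1) permutes_inv [OF w] by (intro strict_mono_on_permutes_id) auto
  then have "w = id" using permutes_inv_inv [OF w] by (metis inv_id)
  then show ?case using 0 by (intro exI [of _ "[]"]) simp
qed

lemma cox_length_eq:
  assumes "permutation w" "w 0 = 0"
  shows "cox_length w = card (inversions w)"
  unfolding cox_length_def
proof (rule Least_equality)
  show "\<exists>ws. length ws = card (inversions w) \<and> word_perm ws = w" using assms by (rule ex_reduced_word)
next
  fix n assume "\<exists>ws. length ws = n \<and> word_perm ws = w"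
  then show "card (inversions w) \<le> n" using card_inversions_word by auto
qed

lemma W_on_UNIV: "W_on UNIV = {w. permutation w \<and> w 0 = 0}"
proof (intro equalityI subsetI)
  fix w :: "int \<Rightarrow> int" assume "w \<in> {w. permutation w \<and> w 0 = 0}"
  then obtain ws where "word_perm ws = w" using ex_reduced_word by blast
  then show "w \<in> W_on UNIV" by (auto simp: W_on_def)
qed (auto simp: W_on_def permutation_word_perm word_perm_0)

lemma sign_cox_length:
  fixes w :: "int \<Rightarrow> int"
  assumes "permutation w" "w 0 = 0"
  shows "(- 1) ^ cox_length w = (of_int (sign w) :: 'c::comm_ring_1)"
proof -
  obtain ws where ws: "length ws = card (inversions w)" "word_perm ws = w"
    using ex_reduced_word [OF assms] by blast
  have "sign w = (- 1) ^ cox_length w"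
    using sign_word_perm [of ws] ws cox_length_eq [OF assms] by simp
  then show ?thesis by simp
qed

text \<open>
  By the change of the number of inversions, the length condition for \<open>i \<noteq> 0\<close> says that \<open>inv w\<close> increases
  from one neighbour to the other; the omitted \<open>i = 0\<close> separates negative and positive numbers.
\<close>

lemma coset_reps_eq:
  "coset_reps = {w. permutation w \<and> w 0 = 0 \<and> strict_mono_on {1..} (inv w) \<and> strict_mono_on {..- 1} (inv w)}"
proof (intro equalityI subsetI)
  fix w assume "w \<in> coset_reps"
  then have w: "permutation w" "w 0 = 0"
    and len: "\<And>i. i \<noteq> 0 \<Longrightarrow> cox_length (reflect i \<circ> w) > cox_length w"
    by (auto simp: coset_reps_def W_on_UNIV)
  have inc: "inv w (enum_nz (i - 1)) < inv w (enum_nz i)" if "i \<noteq> 0" for i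
  proof (rule ccontr)
    assume "\<not> ?thesis"
    then have "card (inversions w) = Suc (card (inversions (reflect i \<circ> w)))"
      by (rule card_inversions_reflect' [OF w(1)])
    moreover have "permutation (reflect i \<circ> w)" using w(1) permutation_reflect by (rule permutation_compose [rotated])
    ultimately show False using len [OF that] w by (simp add: cox_length_eq)
  qed
  have "strict_mono_on {1..} (inv w)"
  proof (intro strict_mono_onI)
    fix r s :: int assume rs: "r \<in> {1..}" "s \<in> {1..}" "r < s"
    show "inv w r < inv w s"
    proof (rule strict_mono_int [where g = "inv w" and P = "\<lambda>i. 1 \<le> i"])
      fix i :: int assume "1 \<le> i - 1"
      then show "inv w (i - 1) < inv w i" using inc [of "i - 1"] by (simp add: enum_nz_def)
    qed (use rs in auto)
  qed
  moreover have "strict_mono_on {..- 1} (inv w)"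
  proof (intro strict_mono_onI)
    fix r s :: int assume rs: "r \<in> {..- 1}" "s \<in> {..- 1}" "r < s"
    show "inv w r < inv w s"
    proof (rule strict_mono_int [where g = "inv w" and P = "\<lambda>i. i \<le> - 1"])
      fix i :: int assume "i \<le> - 1"
      then show "inv w (i - 1) < inv w i" using inc [of i] by (simp add: enum_nz_def)
    qed (use rs in auto)
  qed
  ultimately show "w \<in> {w. permutation w \<and> w 0 = 0 \<and> strict_mono_on {1..} (inv w) \<and> strict_mono_on {..- 1} (inv w)}"
    using w by simp
next
  fix w :: "int \<Rightarrow> int" assume "w \<in> {w. permutation w \<and> w 0 = 0 \<and> strict_mono_on {1..} (inv w) \<and> strict_mono_on {..- 1} (inv w)}"
  then have w: "permutation w" "w 0 = 0" "strict_mono_on {1..} (inv w)" "strict_mono_on {..- 1} (inv w)"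
    by auto
  have "cox_length (reflect i \<circ> w) > cox_length w" if "i \<noteq> 0" for i
  proof -
    have "inv w (enum_nz (i - 1)) < inv w (enum_nz i)"
      using that w(3,4) by (cases "i < 0") (auto simp: enum_nz_def strict_mono_on_def)
    then have "card (inversions (reflect i \<circ> w)) = Suc (card (inversions w))"
      by (rule card_inversions_reflect [OF w(1)])
    moreover have "permutation (reflect i \<circ> w)" using w(1) permutation_reflect by (rule permutation_compose [rotated])
    ultimately show ?thesis using w by (simp add: cox_length_eq)
  qed
  then show "w \<in> coset_reps" using w by (simp add: coset_reps_def W_on_UNIV)
qed

lemma W_on_permutes:
  assumes "w \<in> W_on {- int p + 1..int q - 1}" "p > 0" "q > 0"
  shows "w permutes ({- int p..int q} - {0})"
proof -
  obtain ws where ws: "set ws \<subseteq> {- int p + 1..int q - 1}" "w = word_perm ws"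
    using assms by (auto simp: W_on_def lists_eq_set)
  have "word_perm ws permutes ({- int p..int q} - {0})" using ws(1)
  proof (induction ws)
    case (Cons i ws)
    have "reflect i permutes ({- int p..int q} - {0})"
      unfolding reflect_eq
    proof (rule permutes_swap_id)
      show "enum_nz (i - 1) \<in> {- int p..int q} - {0}" "enum_nz i \<in> {- int p..int q} - {0}"
        using Cons.prems by (auto simp: enum_nz_def)
    qed
    moreover have "word_perm ws permutes ({- int p..int q} - {0})" using Cons by simp
    ultimately show ?case unfolding word_perm_Cons by (rule permutes_compose [rotated])
  qed (simp only: word_perm_Nil permutes_id)
  then show ?thesis using ws by simp
qed

text \<open>
  The component of \<open>\<mu> + \<delta>\<^bsub>p,q\<^esub>\<close> at \<open>s\<close> minus \<open>q\<close>. This does not depend on \<open>p\<close> and \<open>q\<close>, and it is defined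
  for all nonzero \<open>s\<close>; the parts of the conjugate partition \<open>\<mu>\<close> are written as cardinalities.
\<close>

definition col_pos :: "int list \<Rightarrow> int \<Rightarrow> int" where
  "col_pos l s = (if s > 0 then int (card {k. k < length l \<and> s \<le> l ! k}) - s
     else int (card {k. k < length l \<and> s < l ! k}) - s - 1)"

text \<open>
  The component of \<open>\<delta>\<^bsub>p,q\<^esub> + d 1\<^sup>-\<^sub>p\<close> at \<open>s\<close> minus \<open>q\<close>, which is \<open>col_pos\<close> for the zero partition. It enumerates
  the integers outside \<open>{0..<d}\<close> in decreasing order.
\<close>

definition base_pos :: "nat \<Rightarrow> int \<Rightarrow> int" where
  "base_pos d s = (if s > 0 then - s else int d - s - 1)"

lemma ex_large_enough:
  assumes "permutation w" "w 0 = 0"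
  shows "\<exists>pq. large_enough w l pq"
proof -
  obtain ws where ws: "word_perm ws = w" using ex_reduced_word [OF assms] by blast
  define N where "N = Max (abs ` insert 0 (set ws \<union> set l))"
  have N: "\<bar>x\<bar> \<le> N" if "x \<in> insert 0 (set ws \<union> set l)" for x
    unfolding N_def using that by (intro Max_ge) auto
  define p where "p = nat N + 2"
  have N0: "0 \<le> N" using N [of 0] by simp
  have "set ws \<subseteq> {- int p + 1..int p - 1}"
  proof
    fix x assume "x \<in> set ws"
    then have "\<bar>x\<bar> \<le> N" by (intro N) auto
    then show "x \<in> {- int p + 1..int p - 1}" using N0 by (simp add: p_def abs_le_iff)
  qed
  then have "w \<in> W_on {- int p + 1..int p - 1}"
    using ws by (auto simp: W_on_def lists_eq_set)
  moreover have "\<forall>x\<in>set l. - int p \<le> x \<and> x \<le> int p"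
  proof
    fix x assume "x \<in> set l"
    then have "\<bar>x\<bar> \<le> N" by (intro N) auto
    then show "- int p \<le> x \<and> x \<le> int p" using N0 by (simp add: p_def abs_le_iff)
  qed
  ultimately have "large_enough w l (p, p)" by (simp add: large_enough_def p_def)
  then show ?thesis by blast
qed

lemma col_pos_outside:
  assumes "\<forall>x\<in>set l. - int p \<le> x \<and> x \<le> int q" "s < - int p \<or> int q < s"
  shows "col_pos l s = base_pos (length l) s"
proof (cases "s < - int p")
  case True
  have "{k. k < length l \<and> s < l ! k} = {..<length l}"
  proof (intro equalityI subsetI)
    fix k assume "k \<in> {..<length l}"
    then have "- int p \<le> l ! k" using assms(1) by auto
    then show "k \<in> {k. k < length l \<and> s < l ! k}" using True \<open>k \<in> {..<length l}\<close> by auto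
  qed auto
  then show ?thesis using True by (simp add: col_pos_def base_pos_def)
next
  case False
  have "{k. k < length l \<and> s \<le> l ! k} = {}"
  proof -
    have "l ! k \<le> int q" if "k < length l" for k using assms(1) that by auto
    then show ?thesis using False assms(2) by fastforce
  qed
  then have "card {k. k < length l \<and> s \<le> l ! k} = 0" by (simp only: card.empty)
  then show ?thesis using False assms(2) by (simp add: col_pos_def base_pos_def)
qed

text \<open>
  The choice of \<open>p\<close> and \<open>q\<close> in the definition of \<open>circ_act\<close> is arbitrary; outside the window \<open>w\<close> is trivial
  and both positions agree.
\<close>

lemma circ_act_eq:
  assumes w: "permutation w" "w 0 = 0" and s: "s \<noteq> 0"
  shows "circ_act w l s = col_pos l (inv w s) - base_pos (length l) s"
proof -
  define pq where "pq = (SOME pq. large_enough w l pq)"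
  obtain p q where pq: "pq = (p, q)" by (cases pq)
  have "large_enough w l pq"
    unfolding pq_def using ex_large_enough [OF w] by (rule someI_ex)
  then have le: "p > 0" "q > 0" "\<forall>x\<in>set l. - int p \<le> x \<and> x \<le> int q" "w \<in> W_on {- int p + 1..int q - 1}"
    by (auto simp: large_enough_def pq)
  let ?win = "{- int p..int q} - {0}"
  let ?mu = "conj_partition (shift l p)"
  have perm: "inv w permutes ?win" using W_on_permutes [OF le(4,1,2)] by (rule permutes_inv)
  have circ: "circ_act w l s = (partition_weight p q ?mu (inv w s) + delta_weight p q (inv w s))
      - delta_weight p q s - int (length l) * ones_neg p s"
    by (simp add: circ_act_def pq_def [symmetric] pq Let_def weight_act_def)
  have mu: "?mu (nat n) = card {k. k < length l \<and> n < l ! k + int p}" if "0 \<le> n" for n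
    unfolding conj_partition_def shift_def
    using that by (intro arg_cong [where f = card] Collect_cong) (auto split: if_splits)
  have win: "partition_weight p q ?mu j + delta_weight p q j = col_pos l j + int q" if "j \<in> ?win" for j
  proof (cases "j < 0")
    case True
    then have "?mu (nat (j + int p)) = card {k. k < length l \<and> j < l ! k}"
      using that by (subst mu) auto
    then show ?thesis using that True by (simp add: partition_weight_def delta_weight_def col_pos_def)
  next
    case False
    then have "?mu (nat (j + int p - 1)) = card {k. k < length l \<and> j + int p - 1 < l ! k + int p}"
      using that le by (subst mu) auto
    also have "{k. k < length l \<and> j + int p - 1 < l ! k + int p} = {k. k < length l \<and> j \<le> l ! k}" by auto
    finally show ?thesis using that False by (simp add: partition_weight_def delta_weight_def col_pos_def)
  qed
  show ?thesis
  proof (cases "s \<in> ?win")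
    case True
    then have "inv w s \<in> ?win" using permutes_in_image [OF perm] by blast
    then show ?thesis
      using True unfolding circ by (subst win) (auto simp: delta_weight_def ones_neg_def base_pos_def)
  next
    case False
    then have "inv w s = s" using permutes_not_in [OF perm] by blast
    moreover have "s < - int p \<or> int q < s" using False s by auto
    ultimately show ?thesis
      unfolding circ using col_pos_outside [OF le(3), of s]
      by (auto simp: partition_weight_def delta_weight_def ones_neg_def)
  qed
qed

lemma col_pos_strict_antimono:
  assumes "s < t" "s \<noteq> 0" "t \<noteq> 0"
  shows "col_pos l t < col_pos l s"
proof -
  consider "0 < s" | "t < 0" | "s < 0" "0 < t" using assms by linarith
  then show ?thesis
  proof cases
    case 1
    have "card {k. k < length l \<and> t \<le> l ! k} \<le> card {k. k < length l \<and> s \<le> l ! k}"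
      using assms by (intro card_mono) auto
    then show ?thesis using 1 assms by (simp add: col_pos_def)
  next
    case 2
    have "card {k. k < length l \<and> t < l ! k} \<le> card {k. k < length l \<and> s < l ! k}"
      using assms by (intro card_mono) auto
    then show ?thesis using 2 assms by (simp add: col_pos_def)
  next
    case 3
    have "card {k. k < length l \<and> t \<le> l ! k} \<le> card {k. k < length l \<and> s < l ! k}"
      using assms by (intro card_mono) auto
    then show ?thesis using 3 by (simp add: col_pos_def)
  qed
qed

lemma col_pos_inj: "s \<noteq> 0 \<Longrightarrow> t \<noteq> 0 \<Longrightarrow> col_pos l s = col_pos l t \<Longrightarrow> s = t"
  using col_pos_strict_antimono [of s t l] col_pos_strict_antimono [of t s l] by (cases s t rule: linorder_cases) auto

section \<open>The alternating sum as a determinant\<close>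

definition window :: "nat \<Rightarrow> nat \<Rightarrow> int set" where
  "window p q = {1..int q} \<union> {- int p..- 1}"

definition fits :: "nat \<Rightarrow> nat \<Rightarrow> int list \<Rightarrow> bool" where
  "fits p q l \<longleftrightarrow> (\<forall>x\<in>set l. - int p \<le> x \<and> x \<le> int q)"

definition tau :: "(int \<Rightarrow> int) \<Rightarrow> int list \<Rightarrow> nat \<Rightarrow> nat" where
  "tau w l j = nat (circ_act w l (int j + 1))"

definition sigma :: "(int \<Rightarrow> int) \<Rightarrow> int list \<Rightarrow> nat \<Rightarrow> nat" where
  "sigma w l i = nat (- circ_act w l (- int i - 1))"

lemma lam_plus_eq: "lam_plus w l = conj_partition (tau w l)"
  and lam_minus_eq: "lam_minus w l = conj_partition (sigma w l)"
  by (simp_all add: lam_plus_def lam_minus_def tau_def [abs_def] sigma_def [abs_def])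

lemma finite_window [simp]: "finite (window p q)"
  by (simp add: window_def)

lemma window_eq: "window p q = {- int p..int q} - {0}"
  by (auto simp: window_def)

lemma coset_reps_large_enough:
  assumes "w \<in> coset_reps"
  shows "\<exists>p q. w permutes window p q \<and> fits p q l"
proof -
  have w: "permutation w" "w 0 = 0" using assms by (auto simp: coset_reps_eq)
  obtain p q where "large_enough w l (p, q)" using ex_large_enough [OF w, of l] by auto
  then have "p > 0" "q > 0" "fits p q l" "w \<in> W_on {- int p + 1..int q - 1}"
    by (auto simp: large_enough_def fits_def)
  then show ?thesis using W_on_permutes [of w p q] by (auto simp: window_eq)
qed

lemma inv_nonzero:
  assumes "permutation w" "w 0 = 0" "s \<noteq> 0"
  shows "inv w s \<noteq> 0"
  using assms by (metis bij_inv_eq_iff permutation_bijective)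

lemma circ_act_outside:
  assumes w: "w permutes window p q" and l: "fits p q l" and s: "s \<noteq> 0" "s \<notin> window p q"
  shows "circ_act w l s = 0"
proof -
  have "permutation w" "w 0 = 0"
    using w permutes_imp_permutation [OF finite_window w] permutes_not_in [OF w, of 0] by (auto simp: window_def)
  then have "circ_act w l s = col_pos l (inv w s) - base_pos (length l) s" using s by (intro circ_act_eq)
  also have "inv w s = s" using permutes_not_in [OF permutes_inv [OF w] s(2)] .
  also have "col_pos l s = base_pos (length l) s"
    using l s by (intro col_pos_outside [of l p q]) (auto simp: fits_def window_def)
  finally show ?thesis by simp
qed

lemma decreasing_to_zero:
  fixes c :: "nat \<Rightarrow> int"
  assumes dec: "\<And>i. c (Suc i) \<le> c i" and zero: "\<And>i. i \<ge> n \<Longrightarrow> c i = 0"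
  shows "is_partition (\<lambda>i. nat (c i))" "0 \<le> c i"
proof -
  have anti: "c j \<le> c i" if "i \<le> j" for i j
    using lift_Suc_antimono_le [of c, OF dec that] .
  show "0 \<le> c i" using anti [of i "i + n"] zero [of "i + n"] by simp
  have "{i. nat (c i) \<noteq> 0} \<subseteq> {..<n}" using zero by (auto simp: not_le [symmetric])
  then show "is_partition (\<lambda>i. nat (c i))"
    using anti by (auto simp: is_partition_def intro!: antimonoI nat_mono intro: finite_subset)
qed

lemma
  assumes w: "w \<in> coset_reps"
  shows tau_partition: "is_partition (tau w l)"
    and tau_eq: "int (tau w l j) = col_pos l (inv w (int j + 1)) + int j + 1"
    and sigma_partition: "is_partition (sigma w l)"
    and sigma_eq: "int (sigma w l i) = int (length l) + int i - col_pos l (inv w (- int i - 1))"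
proof -
  have perm: "permutation w" "w 0 = 0" and mono: "strict_mono_on {1..} (inv w)" "strict_mono_on {..- 1} (inv w)"
    using w by (auto simp: coset_reps_eq)
  obtain p q where pq: "w permutes window p q" "fits p q l" using coset_reps_large_enough [OF w] by blast
  have c: "circ_act w l (int j + 1) = col_pos l (inv w (int j + 1)) + int j + 1" for j
    by (subst circ_act_eq [OF perm]) (auto simp: base_pos_def)
  have e: "- circ_act w l (- int i - 1) = int (length l) + int i - col_pos l (inv w (- int i - 1))" for i
    by (subst circ_act_eq [OF perm]) (auto simp: base_pos_def)
  have c_dec: "circ_act w l (int (Suc j) + 1) \<le> circ_act w l (int j + 1)" for j
  proof -
    have "inv w (int j + 1) < inv w (int (Suc j) + 1)" using mono(1) by (auto simp: strict_mono_on_def)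
    then have "col_pos l (inv w (int (Suc j) + 1)) < col_pos l (inv w (int j + 1))"
      by (intro col_pos_strict_antimono inv_nonzero [OF perm]) auto
    then show ?thesis unfolding c by simp
  qed
  have e_dec: "- circ_act w l (- int (Suc i) - 1) \<le> - circ_act w l (- int i - 1)" for i
  proof -
    have "inv w (- int (Suc i) - 1) < inv w (- int i - 1)" using mono(2) by (auto simp: strict_mono_on_def)
    then have "col_pos l (inv w (- int i - 1)) < col_pos l (inv w (- int (Suc i) - 1))"
      by (intro col_pos_strict_antimono inv_nonzero [OF perm]) auto
    then show ?thesis unfolding e by simp
  qed
  have c0: "circ_act w l (int j + 1) = 0" if "j \<ge> q" for j
    using that by (intro circ_act_outside [OF pq]) (auto simp: window_def)
  have e0: "- circ_act w l (- int i - 1) = 0" if "i \<ge> p" for i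
    using that circ_act_outside [OF pq, of "- int i - 1"] by (auto simp: window_def)
  note c' = decreasing_to_zero [of "\<lambda>j. circ_act w l (int j + 1)" q, OF c_dec c0]
  note e' = decreasing_to_zero [of "\<lambda>i. - circ_act w l (- int i - 1)" p, OF e_dec e0]
  show "is_partition (tau w l)" "is_partition (sigma w l)"
    using c'(1) e'(1) by (simp_all add: tau_def [abs_def] sigma_def [abs_def])
  show "int (tau w l j) = col_pos l (inv w (int j + 1)) + int j + 1"
    using c'(2) [of j] by (simp add: tau_def c [symmetric])
  show "int (sigma w l i) = int (length l) + int i - col_pos l (inv w (- int i - 1))"
    using e'(2) [of i] by (simp add: sigma_def e [symmetric])
qed

lemma
  assumes w: "w permutes window p q" and l: "fits p q l"
  shows tau_zero: "j \<ge> q \<Longrightarrow> tau w l j = 0" and sigma_zero: "i \<ge> p \<Longrightarrow> sigma w l i = 0"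
  using circ_act_outside [OF w l, of "int j + 1"] circ_act_outside [OF w l, of "- int i - 1"]
  by (auto simp: tau_def sigma_def window_def)

text \<open>
  Row \<open>s\<close> contains coefficients of the elementary series of \<open>A\<close> for positive and of \<open>B\<close> for negative \<open>s\<close>.
  Permuting the columns by \<open>inv w\<close> and taking the two diagonal blocks yields the conjugate Jacobi-Trudi
  determinants of the partitions attached to \<open>w\<close> (\<open>tdet_tau\<close>, \<open>tdet_sigma\<close>).
\<close>

definition col_matrix :: "'c::comm_ring_1 fps \<Rightarrow> 'c fps \<Rightarrow> int list \<Rightarrow> int \<Rightarrow> int \<Rightarrow> 'c" where
  "col_matrix EA EB l s t =
     (if s > 0 then icoef EA (col_pos l t - base_pos (length l) s)
      else icoef EB (base_pos (length l) s - col_pos l t))"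

lemma tdet_tau:
  assumes w: "w \<in> coset_reps"
  shows "tdet q EA (tau w l) empty_partition = DET {1..int q} (\<lambda>s t. col_matrix EA EB l s (inv w t))"
proof -
  have bij: "bij_betw (\<lambda>i. int i + 1) {..<q} {1..int q}"
    by (rule bij_betw_byWitness [where f' = "\<lambda>s. nat (s - 1)"]) auto
  have "tdet q EA (tau w l) empty_partition
      = DET {..<q} (\<lambda>i j. col_matrix EA EB l (int j + 1) (inv w (int i + 1)))"
    unfolding tdet_def
    by (intro DET_cong) (simp add: col_matrix_def base_pos_def tau_eq [OF w] empty_partition_def algebra_simps)
  also have "\<dots> = DET {..<q} (\<lambda>j i. col_matrix EA EB l (int j + 1) (inv w (int i + 1)))"
    by (rule DET_transpose [of "{..<q}" "\<lambda>j i. col_matrix EA EB l (int j + 1) (inv w (int i + 1))"]) simp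
  also have "\<dots> = DET {1..int q} (\<lambda>s t. col_matrix EA EB l s (inv w t))"
    by (rule DET_reindex [OF bij, symmetric]) simp
  finally show ?thesis .
qed

lemma tdet_sigma:
  assumes w: "w \<in> coset_reps"
  shows "tdet p EB (sigma w l) empty_partition = DET {- int p..- 1} (\<lambda>s t. col_matrix EA EB l s (inv w t))"
proof -
  have bij: "bij_betw (\<lambda>i. - int i - 1) {..<p} {- int p..- 1}"
    by (rule bij_betw_byWitness [where f' = "\<lambda>s. nat (- s - 1)"]) auto
  have "tdet p EB (sigma w l) empty_partition
      = DET {..<p} (\<lambda>i j. col_matrix EA EB l (- int j - 1) (inv w (- int i - 1)))"
    unfolding tdet_def
    by (intro DET_cong) (simp add: col_matrix_def base_pos_def sigma_eq [OF w] empty_partition_def algebra_simps)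
  also have "\<dots> = DET {..<p} (\<lambda>j i. col_matrix EA EB l (- int j - 1) (inv w (- int i - 1)))"
    by (rule DET_transpose [of "{..<p}" "\<lambda>j i. col_matrix EA EB l (- int j - 1) (inv w (- int i - 1))"]) simp
  also have "\<dots> = DET {- int p..- 1} (\<lambda>s t. col_matrix EA EB l s (inv w t))"
    by (rule DET_reindex [OF bij, symmetric]) simp
  finally show ?thesis .
qed

lemma partition_sum_ge:
  assumes la: "is_partition la" "\<And>i. i \<ge> n \<Longrightarrow> la i = 0" and i: "la i \<noteq> 0"
  shows "i < (\<Sum>j<n. la j)"
proof -
  have "i < n" using la(2) [of i] i by (cases "i < n") auto
  have "Suc i = (\<Sum>j<Suc i. 1)" by simp
  also have "\<dots> \<le> (\<Sum>j<Suc i. la j)"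
  proof (intro sum_mono)
    fix j assume "j \<in> {..<Suc i}"
    then have "la i \<le> la j" using la(1) by (auto intro: is_partition_antimono)
    then show "1 \<le> la j" using i by simp
  qed
  also have "\<dots> \<le> (\<Sum>j<n. la j)" using \<open>i < n\<close> by (intro sum_mono2) auto
  finally show ?thesis by simp
qed

lemma super_schur_conj_zero:
  fixes x :: "'i \<Rightarrow> ('v, 'r::comm_ring_1) mfps"
  assumes x: "alphabet x" and I: "countable I0" "countable I1" and la: "is_partition la"
    and i: "size M \<le> i" "la i \<noteq> 0"
  shows "mcong M (super_schur x I0 I1 (conj_partition la)) 0"
proof -
  obtain n where n: "\<And>i. i \<ge> n \<Longrightarrow> la i = 0" using is_partition_bounded [OF la] by auto
  have "mcong M (super_schur x I0 I1 (conj_partition la)) (tdet n (h_series M x I1 I0) la empty_partition)"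
    using x I la n by (rule super_schur_column)
  also have "mcong M \<dots> 0"
    using partition_sum_ge [of la n i, OF la n i(2)] i(1)
    by (intro order_ge_tdet_mcong_zero graded_h_series x) (auto simp: empty_partition_def)
  finally show ?thesis .
qed

lemma coset_reps_window:
  "coset_reps \<inter> {w. w permutes window p q}
    = {w. w permutes ({1..int q} \<union> {- int p..- 1}) \<and> strict_mono_on {1..int q} (inv w)
        \<and> strict_mono_on {- int p..- 1} (inv w)}"
proof (intro equalityI subsetI)
  fix w assume "w \<in> coset_reps \<inter> {w. w permutes window p q}"
  then show "w \<in> {w. w permutes ({1..int q} \<union> {- int p..- 1}) \<and> strict_mono_on {1..int q} (inv w)
        \<and> strict_mono_on {- int p..- 1} (inv w)}"
    by (auto simp: coset_reps_eq window_def strict_mono_on_def)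
next
  fix w assume "w \<in> {w. w permutes ({1..int q} \<union> {- int p..- 1}) \<and> strict_mono_on {1..int q} (inv w)
        \<and> strict_mono_on {- int p..- 1} (inv w)}"
  then have w: "w permutes window p q" "strict_mono_on {1..int q} (inv w)" "strict_mono_on {- int p..- 1} (inv w)"
    by (auto simp: window_def)
  have inv: "inv w permutes window p q" using w(1) by (rule permutes_inv)
  have inside: "inv w s \<in> window p q" if "s \<in> window p q" for s using permutes_in_image [OF inv] that by simp
  have outside: "inv w s = s" if "s \<notin> window p q" for s using permutes_not_in [OF inv] that by simp
  have "strict_mono_on {1..} (inv w)"
  proof (intro strict_mono_onI)
    fix r s :: int assume rs: "r \<in> {1..}" "s \<in> {1..}" "r < s"
    show "inv w r < inv w s"
    proof (cases "s \<in> window p q")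
      case True
      then show ?thesis using w(2) rs by (auto simp: strict_mono_on_def window_def)
    next
      case False
      then show ?thesis
        using rs outside [of s] outside [of r] inside [of r] by (cases "r \<in> window p q") (auto simp: window_def)
    qed
  qed
  moreover have "strict_mono_on {..- 1} (inv w)"
  proof (intro strict_mono_onI)
    fix r s :: int assume rs: "r \<in> {..- 1}" "s \<in> {..- 1}" "r < s"
    show "inv w r < inv w s"
    proof (cases "r \<in> window p q")
      case True
      then show ?thesis using w(3) rs by (auto simp: strict_mono_on_def window_def)
    next
      case False
      then show ?thesis
        using rs outside [of s] outside [of r] inside [of s] by (cases "s \<in> window p q") (auto simp: window_def)
    qed
  qed
  moreover have "permutation w" "w 0 = 0"
    using permutes_imp_permutation [OF finite_window w(1)] permutes_not_in [OF w(1), of 0] by (auto simp: window_def)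
  ultimately show "w \<in> coset_reps \<inter> {w. w permutes window p q}"
    using w(1) by (simp add: coset_reps_eq)
qed

definition numerator_term ::
    "'a set \<Rightarrow> 'a set \<Rightarrow> 'b set \<Rightarrow> 'b set \<Rightarrow> int list \<Rightarrow> (int \<Rightarrow> int) \<Rightarrow> ('a + 'b, 'r::comm_ring_1) mfps" where
  "numerator_term A0 A1 B0 B1 l w = (- 1) ^ cox_length w * super_schur xA A0 A1 (lam_plus w l)
     * super_schur xB_inv B0 B1 (lam_minus w l)"

text \<open>
  If \<open>w\<close> moves a number \<open>s\<close> outside the window, then \<open>tau\<close> or \<open>sigma\<close> has a part with an index of at least
  \<open>size M\<close>, hence more than \<open>size M\<close> cells.
\<close>

lemma numerator_term_zero:
  assumes ctb: "countable A0" "countable A1" "countable B0" "countable B1"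
    and pq: "size M \<le> p" "size M \<le> q" "fits p q l"
    and w: "w \<in> coset_reps" "\<not> w permutes window p q"
  shows "mcong M (numerator_term A0 A1 B0 B1 l w :: ('a + 'b, 'r::comm_ring_1) mfps) 0"
proof -
  have perm: "permutation w" "w 0 = 0" using w by (auto simp: coset_reps_eq)
  have "\<exists>s. s \<notin> window p q \<and> inv w s \<noteq> s"
  proof (rule ccontr)
    assume *: "\<not> ?thesis"
    have bij: "bij w" using perm(1) by (simp add: permutation_bijective)
    then have "w permutes UNIV" by (intro bij_imp_permutes) auto
    moreover have "w s = s" if "s \<in> UNIV - window p q" for s
      using * that bij by (metis DiffD2 bij_inv_eq_iff)
    ultimately have "w permutes window p q" by (rule permutes_superset)
    with w(2) show False by simp
  qed
  then obtain s where s: "s \<notin> window p q" "inv w s \<noteq> s" by blast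
  have s0: "s \<noteq> 0" using s(2) perm by (metis bij_inv_eq_iff permutation_bijective)
  have "col_pos l (inv w s) \<noteq> col_pos l s"
    using col_pos_inj [OF inv_nonzero [OF perm s0] s0] s(2) by blast
  moreover have "col_pos l s = base_pos (length l) s"
    using pq(3) s s0 by (intro col_pos_outside [of l p q]) (auto simp: fits_def window_def)
  ultimately have ne: "col_pos l (inv w s) \<noteq> base_pos (length l) s" by simp
  have "mcong M (super_schur xA A0 A1 (lam_plus w l) :: ('a + 'b, 'r) mfps) 0
      \<or> mcong M (super_schur xB_inv B0 B1 (lam_minus w l) :: ('a + 'b, 'r) mfps) 0"
  proof (cases "s > 0")
    case True
    define j where "j = nat (s - 1)"
    have j: "int j + 1 = s" using True by (simp add: j_def)
    have "int (tau w l j) = col_pos l (inv w s) + s" using tau_eq [OF w(1), of l j] j by simp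
    then have "tau w l j \<noteq> 0" using ne True by (auto simp: base_pos_def)
    moreover have "size M \<le> j" using s True pq(2) by (simp add: j_def window_def)
    ultimately show ?thesis
      unfolding lam_plus_eq using ctb tau_partition [OF w(1)]
      by (intro disjI1 super_schur_conj_zero alphabet_xA) auto
  next
    case False
    define i where "i = nat (- s - 1)"
    have i: "- int i - 1 = s" using False s0 by (simp add: i_def)
    have "sigma w l i \<noteq> 0"
      using sigma_eq [OF w(1), of l i] ne False i by (auto simp: base_pos_def)
    moreover have "size M \<le> i" using s False s0 pq(1) by (auto simp: i_def window_def)
    ultimately show ?thesis
      unfolding lam_minus_eq using ctb sigma_partition [OF w(1)]
      by (intro disjI2 super_schur_conj_zero alphabet_xB_inv) auto
  qed
  then show ?thesis
  proof
    assume "mcong M (super_schur xA A0 A1 (lam_plus w l) :: ('a + 'b, 'r) mfps) 0"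
    then have "mcong M (numerator_term A0 A1 B0 B1 l w :: ('a + 'b, 'r) mfps)
        ((- 1) ^ cox_length w * 0 * super_schur xB_inv B0 B1 (lam_minus w l))"
      unfolding numerator_term_def by (intro mcong_mult) auto
    then show ?thesis by simp
  next
    assume "mcong M (super_schur xB_inv B0 B1 (lam_minus w l) :: ('a + 'b, 'r) mfps) 0"
    then have "mcong M (numerator_term A0 A1 B0 B1 l w :: ('a + 'b, 'r) mfps)
        ((- 1) ^ cox_length w * super_schur xA A0 A1 (lam_plus w l) * 0)"
      unfolding numerator_term_def by (intro mcong_mult) auto
    then show ?thesis by simp
  qed
qed

lemma ex_fits: "\<exists>p\<ge>N. fits p p l"
proof -
  have "\<exists>p\<ge>N. \<forall>x\<in>set l. - int p \<le> x \<and> x \<le> int p"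
  proof (induction l)
    case (Cons a l)
    then obtain p where p: "p \<ge> N" "\<forall>x\<in>set l. - int p \<le> x \<and> x \<le> int p" by blast
    then have "\<forall>x\<in>set (a # l). - int (p + nat \<bar>a\<bar>) \<le> x \<and> x \<le> int (p + nat \<bar>a\<bar>)" by force
    then show ?case using p(1) by (intro exI [of _ "p + nat \<bar>a\<bar>"]) simp
  qed auto
  then show ?thesis by (simp add: fits_def)
qed

text \<open>
  Modulo \<open>M\<close> only the representatives supported in the window matter, and for them the sum is the
  expansion \<open>DET_Laplace\<close>.
\<close>

theorem
  assumes ctb: "countable A0" "countable A1" "countable B0" "countable B1"
  shows numerator_summable:
      "(numerator_term A0 A1 B0 B1 l :: _ \<Rightarrow> ('a + 'b, 'r::comm_ring_1) mfps) summable_on coset_reps"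
    and numerator_det: "\<And>M p q. size M \<le> p \<Longrightarrow> size M \<le> q \<Longrightarrow> fits p q l \<Longrightarrow>
      mcong M (infsum (numerator_term A0 A1 B0 B1 l) coset_reps :: ('a + 'b, 'r) mfps)
        (DET (window p q) (col_matrix (h_series M xA A1 A0) (h_series M xB_inv B1 B0) l))"
proof -
  let ?t = "numerator_term A0 A1 B0 B1 l :: _ \<Rightarrow> ('a + 'b, 'r) mfps"
  let ?J = "\<lambda>p q. coset_reps \<inter> {w. w permutes window p q}"
  have finJ: "finite (?J p q)" for p q using finite_permutations [OF finite_window] by (rule rev_finite_subset) auto
  have fin: "finite {w \<in> coset_reps. \<not> mcong M (?t w) 0}" for M
  proof -
    obtain p where p: "p \<ge> size M" "fits p p l" using ex_fits by blast
    have "{w \<in> coset_reps. \<not> mcong M (?t w) 0} \<subseteq> ?J p p"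
      using numerator_term_zero [OF ctb p(1,1,2)] by blast
    then show ?thesis using finJ finite_subset by blast
  qed
  then show "?t summable_on coset_reps" by (rule mfps_summable)
  fix M :: "('a + 'b) multiset" and p q assume pq: "size M \<le> p" "size M \<le> q" "fits p q l"
  let ?EA = "h_series M (xA :: 'a \<Rightarrow> ('a + 'b, 'r) mfps) A1 A0" and ?EB = "h_series M (xB_inv :: 'b \<Rightarrow> ('a + 'b, 'r) mfps) B1 B0"
  let ?X = "col_matrix ?EA ?EB l"
  have "mcong M (infsum ?t coset_reps) (sum ?t (?J p q))"
    using numerator_term_zero [OF ctb pq] by (intro mcong_infsum fin finJ) auto
  also have "mcong M \<dots> (\<Sum>w\<in>?J p q. of_int (sign w) * DET {1..int q} (\<lambda>s t. ?X s (inv w t))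
      * DET {- int p..- 1} (\<lambda>s t. ?X s (inv w t)))"
  proof (intro mcong_sum)
    fix w assume "w \<in> ?J p q"
    then have w: "w \<in> coset_reps" "w permutes window p q" by auto
    have perm: "permutation w" "w 0 = 0" using w by (auto simp: coset_reps_eq)
    have "mcong M (super_schur xA A0 A1 (lam_plus w l)) (tdet q ?EA (tau w l) empty_partition)"
      unfolding lam_plus_eq using ctb tau_partition [OF w(1)] tau_zero [OF w(2) pq(3)]
      by (intro super_schur_column alphabet_xA) auto
    moreover have "mcong M (super_schur xB_inv B0 B1 (lam_minus w l)) (tdet p ?EB (sigma w l) empty_partition)"
      unfolding lam_minus_eq using ctb sigma_partition [OF w(1)] sigma_zero [OF w(2) pq(3)]
      by (intro super_schur_column alphabet_xB_inv) auto
    ultimately show "mcong M (?t w) (of_int (sign w) * DET {1..int q} (\<lambda>s t. ?X s (inv w t))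
      * DET {- int p..- 1} (\<lambda>s t. ?X s (inv w t)))"
      unfolding numerator_term_def sign_cox_length [OF perm] tdet_tau [OF w(1), where EB = ?EB]
        tdet_sigma [OF w(1), where EA = ?EA]
      by (intro mcong_mult) auto
  qed
  also have "\<dots> = DET ({1..int q} \<union> {- int p..- 1}) ?X"
    unfolding coset_reps_window by (rule DET_Laplace [symmetric]) auto
  finally show "mcong M (infsum ?t coset_reps) (DET (window p q) ?X)" by (simp add: window_def)
qed

section \<open>The character formula\<close>

definition parity :: "int \<Rightarrow> 'c::comm_ring_1" where
  "parity n = (if even n then 1 else - 1)"

lemma parity_diff: "parity (a - b) = parity a * parity b"
  and parity_square [simp]: "parity a * parity a = 1"
  and parity_0 [simp]: "parity 0 = 1"
  by (simp_all add: parity_def)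

text \<open>
  Unless \<open>\<rho>\<close> is the identity, two neighbouring values \<open>v\<close> and \<open>v + 1\<close> are taken in the wrong order.
  Exchanging them keeps \<open>\<rho>\<close> increasing on \<open>D\<close> and on the complement. As one of the two arguments lies in \<open>D\<close>
  and the other does not, both sides change sign, and the sum of the squared displacements drops.
\<close>

lemma sign_shuffle:
  fixes lo hi :: int
  assumes "\<rho> permutes {lo..hi}" "D \<subseteq> {lo..hi}" "strict_mono_on D \<rho>" "strict_mono_on ({lo..hi} - D) \<rho>"
  shows "sign \<rho> = (\<Prod>r\<in>D. parity (\<rho> r - r))"
  using assms
proof (induction "nat (\<Sum>r\<in>{lo..hi}. (\<rho> r - r)\<^sup>2)" arbitrary: \<rho> rule: less_induct)
  case less
  let ?I = "{lo..hi}"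
  have inv: "inv \<rho> permutes ?I" using less.prems(1) by (rule permutes_inv)
  show ?case
  proof (cases "\<forall>v. lo \<le> v \<and> v < hi \<longrightarrow> inv \<rho> v < inv \<rho> (v + 1)")
    case True
    have "strict_mono_on ?I (inv \<rho>)"
    proof (intro strict_mono_onI)
      fix r s assume rs: "r \<in> ?I" "s \<in> ?I" "r < s"
      show "inv \<rho> r < inv \<rho> s"
      proof (rule strict_mono_int [where g = "inv \<rho>" and P = "\<lambda>i. lo \<le> i \<and> i \<le> hi"])
        fix i assume "lo \<le> i - 1 \<and> i - 1 \<le> hi" "lo \<le> i \<and> i \<le> hi"
        then show "inv \<rho> (i - 1) < inv \<rho> i" using True [rule_format, of "i - 1"] by simp
      qed (use rs in auto)
    qed
    then have "inv \<rho> = id" by (intro strict_mono_on_permutes_id [OF _ inv]) auto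
    then have "\<rho> = id" using permutes_inv_inv [OF less.prems(1)] by (metis inv_id)
    then show ?thesis by simp
  next
    case False
    then obtain v where v: "lo \<le> v" "v < hi" "\<not> inv \<rho> v < inv \<rho> (v + 1)" by blast
    define a b where "a = inv \<rho> (v + 1)" and "b = inv \<rho> v"
    have ab: "\<rho> a = v + 1" "\<rho> b = v" by (simp_all add: a_def b_def permutes_inverses [OF less.prems(1)])
    then have "a \<noteq> b" by auto
    then have less_ab: "a < b" using v(3) by (simp add: a_def b_def)
    have abI: "a \<in> ?I" "b \<in> ?I" using v permutes_in_image [OF inv] by (auto simp: a_def b_def)
    have inj: "\<rho> x = \<rho> y \<longleftrightarrow> x = y" for x y using permutes_inj [OF less.prems(1)] by (simp add: inj_eq)
    let ?t = "transpose v (v + 1)"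
    let ?r = "?t \<circ> \<rho>"
    have ra: "?r a = v" "?r b = v + 1" by (simp_all add: ab)
    have ro: "?r x = \<rho> x" if "x \<noteq> a" "x \<noteq> b" for x
      using inj [of x a] inj [of x b] that ab by (auto simp: transpose_def)
    have perm: "?r permutes ?I" using v by (intro permutes_compose [OF less.prems(1)] permutes_swap_id) auto
    have mono: "strict_mono_on X ?r" if X: "strict_mono_on X \<rho>" for X
    proof (intro strict_mono_onI)
      fix r s assume rs: "r \<in> X" "s \<in> X" "r < s"
      then have "\<rho> r < \<rho> s" using X by (auto simp: strict_mono_on_def)
      moreover have "\<not> (\<rho> r = v \<and> \<rho> s = v + 1)"
        using inj [of r b] inj [of s a] ab less_ab rs(3) by auto
      ultimately show "?r r < ?r s" by (auto simp: transpose_def)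
    qed
    have split: "(\<Sum>r\<in>?I. f r) = f a + f b + (\<Sum>r\<in>?I - {a} - {b}. f r)" for f :: "int \<Rightarrow> int"
      using abI \<open>a \<noteq> b\<close> by (subst sum.remove [of _ a], simp, simp, subst sum.remove [of _ b]) auto
    have "(\<Sum>r\<in>?I - {a} - {b}. (?r r - r)\<^sup>2) = (\<Sum>r\<in>?I - {a} - {b}. (\<rho> r - r)\<^sup>2)"
      by (intro sum.cong refl) (use ro in auto)
    moreover have "(v - a)\<^sup>2 + (v + 1 - b)\<^sup>2 < (v + 1 - a)\<^sup>2 + (v - b)\<^sup>2"
      using less_ab by (simp add: power2_eq_square algebra_simps)
    ultimately have "(\<Sum>r\<in>?I. (?r r - r)\<^sup>2) < (\<Sum>r\<in>?I. (\<rho> r - r)\<^sup>2)"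
      unfolding split [of "\<lambda>r. (?r r - r)\<^sup>2"] split [of "\<lambda>r. (\<rho> r - r)\<^sup>2"] ra ab by linarith
    moreover have "0 \<le> (\<Sum>r\<in>?I. (?r r - r)\<^sup>2)" by (intro sum_nonneg) auto
    ultimately have "nat (\<Sum>r\<in>?I. (?r r - r)\<^sup>2) < nat (\<Sum>r\<in>?I. (\<rho> r - r)\<^sup>2)" by linarith
    from less.hyps [OF this perm less.prems(2) mono [OF less.prems(3)] mono [OF less.prems(4)]]
    have IH: "sign ?r = (\<Prod>r\<in>D. parity (?r r - r))" .
    have finD: "finite D" using less.prems(2) by (rule finite_subset) simp
    have flip: "(\<Prod>r\<in>D. parity (?r r - r) :: int) = - (\<Prod>r\<in>D. parity (\<rho> r - r))"
    proof (cases "a \<in> D")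
      case True
      have "b \<notin> D"
        using strict_mono_onD [OF less.prems(3) True _ less_ab] by (auto simp: ab)
      then have "(\<Prod>r\<in>D - {a}. parity (?r r - r) :: int) = (\<Prod>r\<in>D - {a}. parity (\<rho> r - r))"
        by (intro prod.cong refl arg_cong [where f = parity]) (metis DiffD1 DiffD2 insertCI ro)
      moreover have "parity (?r a - a) = - (parity (\<rho> a - a) :: int)"
        unfolding ra ab by (simp add: parity_def)
      ultimately show ?thesis by (simp only: prod.remove [OF finD True] mult_minus_left)
    next
      case aD: False
      have bD: "b \<in> D"
      proof (rule ccontr)
        assume "b \<notin> D"
        then have "\<rho> a < \<rho> b"
          using strict_mono_onD [OF less.prems(4), of a b] aD abI less_ab by auto
        then show False by (simp add: ab)
      qed
      have "(\<Prod>r\<in>D - {b}. parity (?r r - r) :: int) = (\<Prod>r\<in>D - {b}. parity (\<rho> r - r))"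
        using aD by (intro prod.cong refl arg_cong [where f = parity]) (metis DiffD1 DiffD2 insertCI ro)
      moreover have "parity (?r b - b) = - (parity (\<rho> b - b) :: int)"
        unfolding ra ab by (simp add: parity_def)
      ultimately show ?thesis by (simp only: prod.remove [OF finD bD] mult_minus_left)
    qed
    have "sign ?r = - sign \<rho>"
      using permutes_imp_permutation [OF _ less.prems(1)]
      by (subst sign_compose) (auto simp: permutation_swap_id sign_swap_id)
    with IH flip show ?thesis by simp
  qed
qed

lemma DET_remove_identity_rows:
  assumes "finite N" "finite I" "N \<subseteq> I" "\<And>r c. r \<in> N \<Longrightarrow> c \<in> I \<Longrightarrow> M r c = (if c = r then 1 else 0)"
  shows "DET I M = DET (I - N) M"
  using assms
proof (induction N arbitrary: I rule: finite_induct)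
  case (insert r N)
  have "DET I M = M r r * DET (I - {r}) M" using insert.prems by (intro DET_remove) auto
  also have "M r r = 1" using insert.prems by auto
  also have "DET (I - {r}) M = DET (I - {r} - N) M"
    using insert.prems insert.hyps by (intro insert.IH) auto
  also have "I - {r} - N = I - insert r N" by auto
  finally show ?case by simp
qed simp

text \<open>
  The key \<open>\<kappa>\<close> orders the indices; the rows of \<open>N\<close> are removed starting from the lowest. Applied with
  \<open>\<kappa> = id\<close> and \<open>\<kappa> = uminus\<close> it peels off a triangular block at either end of an interval.
\<close>

lemma DET_remove_triangular:
  fixes \<kappa> :: "'i \<Rightarrow> int"
  assumes "finite N" "finite I" "N \<subseteq> I" "inj_on \<kappa> I" "\<And>r. r \<in> N \<Longrightarrow> M r r = 1"
    "\<And>r c. r \<in> N \<Longrightarrow> c \<in> I \<Longrightarrow> \<kappa> r < \<kappa> c \<Longrightarrow> M r c = 0"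
    "\<And>r c. r \<in> N \<Longrightarrow> c \<in> I \<Longrightarrow> \<kappa> c < \<kappa> r \<Longrightarrow> c \<in> N"
  shows "DET I M = DET (I - N) M"
  using assms
proof (induction N arbitrary: I rule: finite_psubset_induct)
  case (psubset N)
  show ?case
  proof (cases "N = {}")
    case False
    then obtain r where r: "r \<in> N" "\<And>s. s \<in> N \<Longrightarrow> \<kappa> r \<le> \<kappa> s"
      using psubset.hyps by (metis (no_types, lifting) arg_min_if_finite(1,2) not_le)
    have "M r c = 0" if c: "c \<in> I" "c \<noteq> r" for c
    proof -
      have "\<kappa> c \<noteq> \<kappa> r" using psubset.prems(2,3) c r(1) by (metis inj_on_eq_iff subsetD)
      moreover have "\<not> \<kappa> c < \<kappa> r" using psubset.prems(6) [OF r(1) c(1)] r(2) [of c] by auto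
      ultimately show ?thesis using psubset.prems(5) [OF r(1) c(1)] by linarith
    qed
    then have "DET I M = M r r * DET (I - {r}) M" using psubset.prems r by (intro DET_remove) auto
    also have "M r r = 1" using psubset.prems r by auto
    also have "DET (I - {r}) M = DET (I - {r} - (N - {r})) M"
    proof (rule psubset.IH)
      show "N - {r} \<subset> N" using r by auto
      show "inj_on \<kappa> (I - {r})" using psubset.prems(3) by (rule inj_on_subset) auto
    qed (use psubset.prems in auto)
    also have "I - {r} - (N - {r}) = I - N" using r by auto
    finally show ?thesis by simp
  qed simp
qed

text \<open>
  The \<open>d\<close> integers that \<open>col_pos l\<close> omits: the boundary path of a partition passes each integer either
  vertically, in a row, or horizontally, in a column.
\<close>

definition row_pos :: "int list \<Rightarrow> nat \<Rightarrow> int" where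
  "row_pos l k = int k - l ! k"

lemma row_pos_ne_col_pos:
  assumes l: "l \<in> gen_partitions d" and k: "k < d" and s: "s \<noteq> 0"
  shows "row_pos l k \<noteq> col_pos l s"
proof -
  have len: "length l = d" using l by (rule gen_partitions_length)
  have card: "(P (l ! k) \<longrightarrow> k < card {k. k < length l \<and> P (l ! k)})
      \<and> (\<not> P (l ! k) \<longrightarrow> card {k. k < length l \<and> P (l ! k)} \<le> k)"
    if P: "\<And>x y. P x \<Longrightarrow> x \<le> y \<Longrightarrow> P y" for P :: "int \<Rightarrow> bool"
  proof (intro conjI impI)
    assume "P (l ! k)"
    then have "{..k} \<subseteq> {k. k < length l \<and> P (l ! k)}"
      using k gen_partitions_antimono [OF l] P by (auto simp: len)
    then have "card {..k} \<le> card {k. k < length l \<and> P (l ! k)}" by (intro card_mono) auto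
    then show "k < card {k. k < length l \<and> P (l ! k)}" by simp
  next
    assume neg: "\<not> P (l ! k)"
    have "{k. k < length l \<and> P (l ! k)} \<subseteq> {..<k}"
    proof
      fix k' assume k': "k' \<in> {k. k < length l \<and> P (l ! k)}"
      show "k' \<in> {..<k}"
      proof (rule ccontr)
        assume "k' \<notin> {..<k}"
        then have "l ! k' \<le> l ! k" using k' by (intro gen_partitions_antimono [OF l]) (auto simp: len)
        then show False using P [of "l ! k'" "l ! k"] k' neg by simp
      qed
    qed
    then have "card {k. k < length l \<and> P (l ! k)} \<le> card {..<k}" by (intro card_mono) auto
    then show "card {k. k < length l \<and> P (l ! k)} \<le> k" by simp
  qed
  show ?thesis
  proof (cases "s > 0")
    case True
    then show ?thesis using card [of "\<lambda>x. s \<le> x"] by (auto simp: row_pos_def col_pos_def)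
  next
    case False
    then show ?thesis using card [of "\<lambda>x. s < x"] by (auto simp: row_pos_def col_pos_def)
  qed
qed

text \<open>
  The inverse of \<open>base_pos d\<close> on the integers outside \<open>{0..<d}\<close>.
\<close>

definition base_index :: "nat \<Rightarrow> int \<Rightarrow> int" where
  "base_index d r = (if r < 0 then - r else int d - r - 1)"

text \<open>
  The arrangement of rows and columns of \<open>l\<close> relative to that of the zero partition, as a permutation of
  the interval of positions.
\<close>

definition shuffle :: "nat \<Rightarrow> nat \<Rightarrow> int list \<Rightarrow> int \<Rightarrow> int" where
  "shuffle p q l r =
     (if r < - int q \<or> int p + int (length l) \<le> r then r
      else if 0 \<le> r \<and> r < int (length l) then row_pos l (nat r)
      else col_pos l (base_index (length l) r))"

lemma
  assumes l: "l \<in> gen_partitions d" and fit: "fits p q l"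
  defines "I \<equiv> {- int q..int p + int d - 1}" and "D \<equiv> {0..<int d}"
  shows shuffle_permutes: "shuffle p q l permutes I"
    and shuffle_mono_rows: "strict_mono_on D (shuffle p q l)"
    and shuffle_mono_columns: "strict_mono_on (I - D) (shuffle p q l)"
proof -
  have len: "length l = d" using l by (rule gen_partitions_length)
  have bound: "- int p \<le> l ! k" "l ! k \<le> int q" if "k < d" for k
    using fit that by (auto simp: fits_def len)
  have DI: "D \<subseteq> I" by (auto simp: D_def I_def)
  have onD: "shuffle p q l r = row_pos l (nat r)" "nat r < d" if "r \<in> D" for r
    using that by (auto simp: shuffle_def D_def len)
  have onC: "shuffle p q l r = col_pos l (base_index d r)" "base_index d r \<noteq> 0" "base_index d r \<in> window p q"
    if "r \<in> I - D" for r
    using that by (auto simp: shuffle_def D_def I_def len base_index_def window_def)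
  have idx: "base_index d s < base_index d r" if "r \<in> I - D" "s \<in> I - D" "r < s" for r s
    using that by (auto simp: base_index_def D_def I_def)
  show rows: "strict_mono_on D (shuffle p q l)"
  proof (intro strict_mono_onI)
    fix r s assume rs: "r \<in> D" "s \<in> D" "r < s"
    then have "l ! nat s \<le> l ! nat r" by (intro gen_partitions_antimono [OF l]) (auto simp: D_def)
    then show "shuffle p q l r < shuffle p q l s"
      using rs by (auto simp: onD row_pos_def D_def)
  qed
  show cols: "strict_mono_on (I - D) (shuffle p q l)"
    using idx onC by (auto simp: strict_mono_on_def intro!: col_pos_strict_antimono)
  show "shuffle p q l permutes I"
  proof (rule inj_imp_permutes)
    show "inj_on (shuffle p q l) I"
    proof (rule inj_onI)
      fix r s assume rs: "r \<in> I" "s \<in> I" "shuffle p q l r = shuffle p q l s"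
      consider "r \<in> D" "s \<in> D" | "r \<in> I - D" "s \<in> I - D" | "r \<in> D" "s \<in> I - D" | "r \<in> I - D" "s \<in> D"
        using rs by auto
      then show "r = s"
      proof cases
        case 1
        then show ?thesis using strict_mono_on_imp_inj_on [OF rows] rs(3) by (auto dest: inj_onD)
      next
        case 2
        then show ?thesis using strict_mono_on_imp_inj_on [OF cols] rs(3) by (auto dest: inj_onD)
      next
        case 3
        then show ?thesis using row_pos_ne_col_pos [OF l, of "nat r" "base_index d s"] rs(3) onD onC by auto
      next
        case 4
        then show ?thesis using row_pos_ne_col_pos [OF l, of "nat s" "base_index d r"] rs(3) onD onC by metis
      qed
    qed
    fix r assume r: "r \<in> I"
    show "shuffle p q l r \<in> I"
    proof (cases "r \<in> D")
      case True
      then show ?thesis using onD [OF True] bound [of "nat r"] by (auto simp: row_pos_def I_def)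
    next
      case False
      with r have rC: "r \<in> I - D" by simp
      let ?s = "base_index d r"
      have fit': "\<forall>x\<in>set l. - int p \<le> x \<and> x \<le> int q" using fit by (simp add: fits_def)
      have "col_pos l (int q + 1) = - int q - 1"
        using col_pos_outside [OF fit', of "int q + 1"] by (simp add: base_pos_def)
      moreover have "col_pos l (- int p - 1) = int d + int p"
        using col_pos_outside [OF fit', of "- int p - 1"] by (simp add: base_pos_def len)
      moreover have "col_pos l (int q + 1) < col_pos l ?s" "col_pos l ?s < col_pos l (- int p - 1)"
        using onC(2,3) [OF rC] by (auto intro!: col_pos_strict_antimono simp: window_def)
      ultimately show ?thesis using onC(1) [OF rC] by (simp add: I_def)
    qed
  qed (auto simp: shuffle_def I_def len)
qed

text \<open>
  The \<open>d\<close> unit rows extend \<open>col_matrix\<close> to a square matrix over an interval. Reordering its columns by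
  \<open>shuffle\<close> and passing from the elementary series to the inverse series \<open>uA\<close> and \<open>wB\<close> produces the signs
  \<open>sign \<rho>\<close> and \<open>(- 1)\<^bsup>|\<lambda>|\<^esup>\<close>, which cancel by \<open>sign_shuffle\<close>. In the product with the Toeplitz matrix, a row
  of the first kind becomes a row of \<open>H\<^sub>B(1/t)\<close>, a row of the second kind one of \<open>H\<^sub>A(t)\<close>, and the unit rows
  select rows of \<open>F\<close>. The length of the interval makes the boundary terms vanish modulo \<open>M\<close>.
\<close>

lemma col_matrix_det:
  fixes hA hB EA EB uA wB :: "('v, 'r::comm_ring_1) mfps fps"
  assumes l: "l \<in> gen_partitions d" and fit: "fits p q l" and K: "size M \<le> p" "size M \<le> q"
    and gr: "graded hB" "graded uA" "graded wB" and inv: "uA * hA = 1" "wB * hB = 1"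
    and h0: "hA $ 0 = 1" "hB $ 0 = 1"
    and uA: "\<And>n. uA $ n = (- 1) ^ n * EA $ n" and wB: "\<And>n. wB $ n = (- 1) ^ n * EB $ n"
  shows "mcong M (DET (window p q) (col_matrix EA EB l)
      * DET {- int q..int p + int d - 1} (\<lambda>r c. toeplitz_coef (size M) hA hB (c - r)))
    (DET {..<d} (\<lambda>i j. toeplitz_coef (size M) hA hB (l ! i - int i + int j)))"
proof -
  let ?lo = "- int q" and ?hi = "int p + int d - 1"
  define I where "I = {?lo..?hi}"
  define D where "D = {0..<int d}"
  define f where "f = toeplitz_coef (size M) hA hB"
  let ?\<rho> = "shuffle p q l"
  define G where "G r n = (if r < 0 then icoef EA (n - r) else icoef EB (r - n))" for r n
  define full where "full r n = (if r \<in> D then (if n = ?\<rho> r then 1 else 0) else G r n)" for r n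
  define Mt where "Mt r n = (if r \<in> D then (if n = ?\<rho> r then 1 else 0)
      else if r < 0 then icoef uA (n - r) else icoef wB (r - n))" for r n
  \<comment> \<open>\<open>full\<close> has the elementary series in its rows, \<open>Mt\<close> the inverse ones, and \<open>Q\<close> is \<open>Mt T\<close> modulo \<open>M\<close>.\<close>
  define Q where "Q r c = (if r \<in> D then f (c - ?\<rho> r) else if r < 0 then icoef hB (r - c) else icoef hA (c - r))" for r c
  have len: "length l = d" using l by (rule gen_partitions_length)
  have finI: "finite I" and DI: "D \<subseteq> I" by (auto simp: I_def D_def)
  note perm = shuffle_permutes [OF l fit, folded I_def]
  have sgn: "sign ?\<rho> = (\<Prod>r\<in>D. parity (?\<rho> r - r))"
    using sign_shuffle [of ?\<rho> ?lo ?hi D] perm DI shuffle_mono_rows [OF l fit] shuffle_mono_columns [OF l fit]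
    by (simp add: I_def D_def)
  have inj: "?\<rho> r = ?\<rho> s \<longleftrightarrow> r = s" for r s using permutes_inj [OF perm] by (simp add: inj_eq)
  have bij: "bij_betw (base_index d) (I - D) (window p q)"
    by (rule bij_betw_byWitness [where f' = "base_pos d"])
       (auto simp: base_index_def base_pos_def window_def I_def D_def)
  have "DET (window p q) (col_matrix EA EB l)
      = DET (I - D) (\<lambda>r c. col_matrix EA EB l (base_index d r) (base_index d c))"
    using finI by (intro DET_reindex [OF bij]) auto
  also have "\<dots> = DET (I - D) (\<lambda>r c. full r (?\<rho> c))"
  proof (intro DET_cong)
    fix r c assume rc: "r \<in> I - D" "c \<in> I - D"
    then have "?\<rho> c = col_pos l (base_index d c)"
      by (auto simp: shuffle_def len I_def D_def)
    moreover have "base_pos d (base_index d r) = r" "base_index d r > 0 \<longleftrightarrow> r < 0"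
      using rc by (auto simp: base_pos_def base_index_def I_def D_def)
    ultimately show "col_matrix EA EB l (base_index d r) (base_index d c) = full r (?\<rho> c)"
      using rc by (simp add: col_matrix_def full_def G_def len)
  qed
  also have "\<dots> = DET I (\<lambda>r c. full r (?\<rho> c))"
    using finI DI finite_subset [OF DI finI]
    by (intro DET_remove_identity_rows [symmetric]) (auto simp: full_def inj)
  also have "\<dots> = of_int (sign ?\<rho>) * DET I full"
    by (rule DET_permute_columns [OF finI perm])
  also have "\<dots> = DET I Mt"
  proof -
    define a :: "int \<Rightarrow> ('v, 'r) mfps" where "a r = (if r \<in> D then parity (?\<rho> r) else parity r)" for r
    have signed: "icoef uA k = parity k * icoef EA k" "icoef wB k = parity k * icoef EB k" for k
      by (auto simp: icoef_def uA wB parity_def even_nat_iff)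
    have "DET I Mt = DET I (\<lambda>r n. a r * (parity n * full r n))"
      by (intro DET_cong) (auto simp: Mt_def full_def G_def a_def signed parity_diff mult_ac)
    also have "\<dots> = ((\<Prod>r\<in>I. a r) * (\<Prod>r\<in>I. parity r)) * DET I full"
      by (simp only: DET_scale_rows DET_scale_columns [OF finI] mult.assoc)
    also have "(\<Prod>r\<in>I. a r) * (\<Prod>r\<in>I. parity r) = (\<Prod>r\<in>I. a r * parity r)"
      by (simp add: prod.distrib)
    also have "\<dots> = (\<Prod>r\<in>D. a r * parity r)"
      using finI DI by (intro prod.mono_neutral_right) (auto simp: a_def)
    also have "\<dots> = (\<Prod>r\<in>D. of_int (parity (?\<rho> r - r)))"
      by (intro prod.cong refl) (auto simp: a_def parity_def)
    also have "\<dots> = of_int (sign ?\<rho>)" by (simp add: sgn)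
    finally show ?thesis by simp
  qed
  finally have win: "DET (window p q) (col_matrix EA EB l) = DET I Mt" .
  have "DET I Mt * DET I (\<lambda>r c. f (c - r)) = DET I (\<lambda>r c. \<Sum>n\<in>I. Mt r n * f (c - n))"
    by (rule DET_mult [symmetric]) (rule finI)
  also have "mcong M \<dots> (DET I Q)"
  proof (intro mcong_DET)
    fix r c assume r: "r \<in> I" and c: "c \<in> I"
    show "mcong M (\<Sum>n\<in>I. Mt r n * f (c - n)) (Q r c)"
    proof (cases "r \<in> D")
      case True
      have "?\<rho> r \<in> I" using permutes_in_image [OF perm] r by simp
      moreover have "(\<Sum>n\<in>I. Mt r n * f (c - n)) = (\<Sum>n\<in>I. if n = ?\<rho> r then f (c - n) else 0)"
        using True by (intro sum.cong) (auto simp: Mt_def)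
      ultimately show ?thesis using finI True by (simp add: Q_def)
    next
      case nD: False
      show ?thesis
      proof (cases "r < 0")
        case True
        define R where "R = nat (?hi - r)"
        have "(\<Sum>n\<in>I. Mt r n * f (c - n)) = (\<Sum>n\<in>{r..?hi}. Mt r n * f (c - n))"
          using finI nD True r by (intro sum.mono_neutral_right) (auto simp: Mt_def I_def)
        also have "\<dots> = (\<Sum>k\<le>R. uA $ k * f ((c - r) - int k))"
          by (rule sum.reindex_bij_witness [where i = "\<lambda>k. r + int k" and j = "\<lambda>n. nat (n - r)"])
             (use nD True in \<open>auto simp: Mt_def R_def icoef_def algebra_simps\<close>)
        also have "mcong M \<dots> (icoef hB (- (c - r)))"
          unfolding f_def using gr inv K True by (intro toeplitz_coef_inverse_left) (auto simp: R_def)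
        finally show ?thesis using nD True by (simp add: Q_def)
      next
        case False
        then have rd: "int d \<le> r" using nD by (auto simp: D_def)
        define R where "R = nat (r - ?lo)"
        have "(\<Sum>n\<in>I. Mt r n * f (c - n)) = (\<Sum>n\<in>{?lo..r}. Mt r n * f (c - n))"
          using finI nD False r by (intro sum.mono_neutral_right) (auto simp: Mt_def I_def)
        also have "\<dots> = (\<Sum>k\<le>R. wB $ k * f ((c - r) + int k))"
          by (rule sum.reindex_bij_witness [where i = "\<lambda>k. r - int k" and j = "\<lambda>n. nat (r - n)"])
             (use nD False rd in \<open>auto simp: Mt_def R_def icoef_def algebra_simps\<close>)
        also have "mcong M \<dots> (icoef hA (c - r))"
          unfolding f_def using gr inv K rd by (intro toeplitz_coef_inverse_right) (auto simp: R_def)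
        finally show ?thesis using nD False by (simp add: Q_def)
      qed
    qed
  qed
  \<comment> \<open>The rows below \<open>0\<close> are lower, those from \<open>d\<close> on upper unitriangular.\<close>
  also have "DET I Q = DET (I - {?lo..- 1}) Q"
    by (rule DET_remove_triangular [where \<kappa> = id]) (auto simp: I_def Q_def D_def h0)
  also have "\<dots> = DET (I - {?lo..- 1} - {int d..?hi}) Q"
    by (rule DET_remove_triangular [where \<kappa> = uminus]) (auto simp: I_def Q_def D_def h0)
  also have "I - {?lo..- 1} - {int d..?hi} = D" by (auto simp: I_def D_def)
  also have "DET D Q = DET {..<d} (\<lambda>i j. Q (int i) (int j))"
  proof (rule DET_reindex)
    show "bij_betw int {..<d} D"
      by (rule bij_betw_byWitness [where f' = nat]) (auto simp: D_def)
  qed simp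
  also have "\<dots> = DET {..<d} (\<lambda>i j. f (l ! i - int i + int j))"
  proof (intro DET_cong)
    fix i j assume "i \<in> {..<d}" "j \<in> {..<d}"
    then have "Q (int i) (int j) = f (int j - row_pos l i)"
      by (simp add: Q_def D_def shuffle_def len)
    also have "int j - row_pos l i = l ! i - int i + int j" by (simp add: row_pos_def)
    finally show "Q (int i) (int j) = f (l ! i - int i + int j)" .
  qed
  finally show ?thesis unfolding win by (simp add: I_def f_def)
qed


lemma
  fixes u :: "'i \<Rightarrow> ('v, 'r::comm_ring_1) mfps"
  assumes u: "alphabet u"
  shows infprod_alphabet: "\<And>M J. finite J \<Longrightarrow> visible M u I \<subseteq> J \<Longrightarrow> J \<subseteq> I \<Longrightarrow>
      mcong M (infprod (\<lambda>i. 1 + u i) I) (\<Prod>i\<in>J. 1 + u i)"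
    and infprod_alphabet_unit: "infprod (\<lambda>i. 1 + u i) I * inverse (infprod (\<lambda>i. 1 + u i) I) = 1"
proof -
  have one: "mcong M (1 + u i) 1" if "i \<in> I - visible M u I" for i M
    using mcong_add [of M 1 1 "u i" 0] that by (simp add: visible_def)
  show F: "mcong M (infprod (\<lambda>i. 1 + u i) I) (\<Prod>i\<in>J. 1 + u i)"
    if J: "finite J" "visible M u I \<subseteq> J" "J \<subseteq> I" for M J
  proof (rule mcong_infprod)
    fix M
    show "finite {i \<in> I. \<not> mcong M (1 + u i) 1}"
      using one alphabet_finite [OF u, of M I] by (rule_tac finite_subset [of _ "visible M u I"]) blast+
  qed (use J one in auto)
  have "visible {#} u I = {}"
    using alphabet_ord [OF u] order_ge_mcong_zero [of 1 _ "{#}"] by (auto simp: visible_def)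
  then have "mcoeff (infprod (\<lambda>i. 1 + u i) I) {#} = 1"
    using mcong_imp_coeff [OF F [of "{}" "{#}"]] by (simp add: mcoeff_one)
  then show "infprod (\<lambda>i. 1 + u i) I * inverse (infprod (\<lambda>i. 1 + u i) I) = 1" by (rule mfps_right_inverse)
qed

lemma alphabet_scale:
  fixes x :: "'i \<Rightarrow> ('v, 'r::comm_ring_1) mfps" and y :: "'j \<Rightarrow> ('v, 'r) mfps"
  assumes x: "alphabet x"
  shows "alphabet (\<lambda>a. x a * z)" and "alphabet y \<Longrightarrow> alphabet (\<lambda>(a, b). s * (x a * y b))"
proof -
  have zero: "mcong M (f * g) 0" if "mcong M f 0 \<or> mcong M g 0" for M and f g :: "('v, 'r) mfps"
    using that mcong_mult [of M f 0 g g] mcong_mult [of M f f g 0] by auto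
  have ord: "order_ge 1 (x a * g)" for a g
    using order_ge_mult [OF alphabet_ord [OF x] order_ge_0, of a g] by simp
  have "visible M (\<lambda>a. x a * z) I \<subseteq> visible M x I" for M I
    using zero by (auto simp: visible_def)
  then show "alphabet (\<lambda>a. x a * z)"
    unfolding alphabet_def using alphabet_finite [OF x] ord by (meson finite_subset)
  assume y: "alphabet y"
  let ?u = "\<lambda>(a, b). s * (x a * y b)"
  have "visible M ?u I \<subseteq> visible M x UNIV \<times> visible M y UNIV" for M I
  proof
    fix c assume c: "c \<in> visible M ?u I"
    obtain a b where ab: "c = (a, b)" by (cases c)
    then have "\<not> mcong M (x a * y b) 0" using c zero [of M s "x a * y b"] by (auto simp: visible_def)
    then show "c \<in> visible M x UNIV \<times> visible M y UNIV" using zero by (auto simp: visible_def ab)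
  qed
  moreover have "finite (visible M x UNIV \<times> visible M y UNIV)" for M using x y by simp
  moreover have "order_ge 1 (?u c)" for c
    using ord [of "fst c" "s * y (snd c)"] by (simp add: case_prod_unfold mult_ac)
  ultimately show "alphabet ?u" unfolding alphabet_def by (meson finite_subset)
qed

lemma infprod_pairs:
  fixes x :: "'i \<Rightarrow> ('v, 'r::comm_ring_1) mfps" and y :: "'j \<Rightarrow> ('v, 'r) mfps"
  assumes x: "alphabet x" and y: "alphabet y" and disj: "A0 \<inter> A1 = {}"
  shows "mcong M (infprod (\<lambda>c. 1 + (case c of (a, b) \<Rightarrow> s * (x a * y b))) (A0 \<times> B0 \<union> A1 \<times> B1))
    ((\<Prod>a\<in>visible M x A0. \<Prod>b\<in>visible M y B0. 1 + s * (x a * y b))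
      * (\<Prod>a\<in>visible M x A1. \<Prod>b\<in>visible M y B1. 1 + s * (x a * y b)))"
proof -
  let ?u = "\<lambda>(a, b). s * (x a * y b)"
  let ?J0 = "visible M x A0 \<times> visible M y B0" and ?J1 = "visible M x A1 \<times> visible M y B1"
  have "mcong M (infprod (\<lambda>c. 1 + ?u c) (A0 \<times> B0 \<union> A1 \<times> B1)) (\<Prod>c\<in>?J0 \<union> ?J1. 1 + ?u c)"
  proof (rule infprod_alphabet [OF alphabet_scale(2) [OF x y]])
    show "visible M ?u (A0 \<times> B0 \<union> A1 \<times> B1) \<subseteq> ?J0 \<union> ?J1"
    proof
      fix c assume c: "c \<in> visible M ?u (A0 \<times> B0 \<union> A1 \<times> B1)"
      obtain a b where ab: "c = (a, b)" by (cases c)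
      have "mcong M (s * (x a * y b)) 0" if "mcong M (x a) 0 \<or> mcong M (y b) 0"
        using that mcong_mult [OF mcong_refl, of M "x a * y b" 0 s]
          mcong_mult [of M "x a" 0 "y b" "y b"] mcong_mult [of M "x a" "x a" "y b" 0] by auto
      then show "c \<in> ?J0 \<union> ?J1" using c by (auto simp: visible_def ab)
    qed
    show "?J0 \<union> ?J1 \<subseteq> A0 \<times> B0 \<union> A1 \<times> B1" by (auto simp: visible_def)
  qed (use x y in auto)
  also have "(\<Prod>c\<in>?J0 \<union> ?J1. 1 + ?u c) = (\<Prod>c\<in>?J0. 1 + ?u c) * (\<Prod>c\<in>?J1. 1 + ?u c)"
  proof (rule prod.union_disjoint)
    show "?J0 \<inter> ?J1 = {}" using disj by (auto simp: visible_def)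
  qed (use x y in auto)
  finally show ?thesis by (simp add: prod.cartesian_product case_prod_unfold)
qed

text \<open>
  With \<open>\<Delta> = P1 / P2\<close>, the determinants give \<open>S P1 = N P2\<close>: the numerator \<open>N\<close> times \<open>det T\<close> is \<open>S\<close>, and \<open>det T\<close>
  times \<open>P1\<close> is \<open>P2\<close>. The factors \<open>P1\<close> and \<open>P2\<close> have constant term 1 and can be inverted.
\<close>

theorem rational_super_schur_character:
  fixes A0 A1 :: "'a set" and B0 B1 :: "'b set"
  assumes ctb: "countable A0" "countable A1" "countable B0" "countable B1"
    and disj: "A0 \<inter> A1 = {}" and l: "l \<in> gen_partitions d"
  shows "(rational_super_schur A0 A1 B0 B1 d l :: ('a + 'b, 'r::comm_ring_1) mfps)
    = infsum (numerator_term A0 A1 B0 B1 l) coset_reps / Delta A0 A1 B0 B1"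
proof -
  let ?S = "rational_super_schur A0 A1 B0 B1 d l :: ('a + 'b, 'r) mfps"
  let ?N = "infsum (numerator_term A0 A1 B0 B1 l) coset_reps :: ('a + 'b, 'r) mfps"
  let ?x = "xA :: 'a \<Rightarrow> ('a + 'b, 'r) mfps" and ?y = "xB_inv :: 'b \<Rightarrow> ('a + 'b, 'r) mfps"
  define P1 where "P1 = infprod (\<lambda>c. 1 + (case c of (a, b) \<Rightarrow> (- 1) * (?x a * ?y b))) (A0 \<times> B0 \<union> A1 \<times> B1)"
  define P2 where "P2 = infprod (\<lambda>c. 1 + (case c of (a, b) \<Rightarrow> 1 * (?x a * ?y b))) (A0 \<times> B1 \<union> A1 \<times> B0)"
  have units: "P1 * inverse P1 = 1" "P2 * inverse P2 = 1"
    unfolding P1_def P2_def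
    by (rule infprod_alphabet_unit alphabet_scale(2) alphabet_xA alphabet_xB_inv)+
  have Delta: "Delta A0 A1 B0 B1 = P1 * inverse P2"
    by (simp add: Delta_def P1_def P2_def divide_mfps_def case_prod_unfold)
  have "?S * P1 = ?N * P2"
  proof (rule mfps_eqI)
    fix M :: "('a + 'b) multiset"
    obtain p where p: "p \<ge> Suc (size M)" "fits p p l" using ex_fits by blast
    let ?hA = "h_series M ?x A0 A1" and ?hB = "h_series M ?y B0 B1"
    let ?EA = "h_series M ?x A1 A0" and ?EB = "h_series M ?y B1 B0"
    let ?uA = "h_series M (\<lambda>i. - ?x i) A1 A0" and ?wB = "h_series M (\<lambda>i. - ?y i) B1 B0"
    let ?C = "DET (window p p) (col_matrix ?EA ?EB l)"
    let ?T = "DET {- int p..int p + int d - 1} (\<lambda>r c. toeplitz_coef (size M) ?hA ?hB (c - r))"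
    let ?Sd = "DET {..<d} (\<lambda>i j. toeplitz_coef (size M) ?hA ?hB (l ! i - int i + int j))"
    have neg: "alphabet (\<lambda>i. - ?x i)" "alphabet (\<lambda>i. - ?y i)"
      using alphabet_xA alphabet_xB_inv by (auto simp: alphabet_def visible_uminus intro: order_ge_uminus)
    let ?P = "\<lambda>I J s. \<Prod>a\<in>visible M ?x I. \<Prod>b\<in>visible M ?y J. 1 + s * (?x a * ?y b)"
    have P1: "mcong M P1 (?P A0 B0 (- 1) * ?P A1 B1 (- 1))"
      unfolding P1_def using disj by (intro infprod_pairs alphabet_xA alphabet_xB_inv)
    have P2: "mcong M P2 (?P A0 B1 1 * ?P A1 B0 1)"
      unfolding P2_def using disj by (intro infprod_pairs alphabet_xA alphabet_xB_inv)
    have T: "mcong M (?T * (?P A0 B0 (- 1) * ?P A1 B1 (- 1))) (?P A0 B1 1 * ?P A1 B0 1)"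
      using p by (intro Toeplitz_Delta [where R = "Suc (size M)"] alphabet_xA alphabet_xB_inv) auto
    have N: "mcong M ?N ?C" using p by (intro numerator_det ctb) auto
    have S: "mcong M ?S ?Sd" by (rule rational_super_schur_det [OF ctb l])
    have CT: "mcong M (?C * ?T) ?Sd"
    proof (rule col_matrix_det [OF l p(2)])
      show "?uA * ?hA = 1" "?wB * ?hB = 1"
        using h_series_inverse [OF alphabet_xA] h_series_inverse [OF alphabet_xB_inv] by (simp_all add: mult.commute)
    qed (use p neg alphabet_xB_inv in \<open>auto simp: h_series_nth_0 h_series_uminus_nth intro: graded_h_series\<close>)
    have "mcong M (?S * P1) (?Sd * P1)" using S by (rule mcong_mult) simp
    also have "mcong M \<dots> ((?C * ?T) * (?P A0 B0 (- 1) * ?P A1 B1 (- 1)))"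
      by (rule mcong_mult [OF mcong_sym [OF CT] P1])
    also have "\<dots> = ?C * (?T * (?P A0 B0 (- 1) * ?P A1 B1 (- 1)))" by (simp only: mult.assoc)
    also have "mcong M \<dots> (?C * (?P A0 B1 1 * ?P A1 B0 1))" by (rule mcong_mult [OF mcong_refl T])
    also have "mcong M \<dots> (?N * P2)" by (rule mcong_mult [OF mcong_sym [OF N] mcong_sym [OF P2]])
    finally show "mcong M (?S * P1) (?N * P2)" .
  qed
  have "inverse (Delta A0 A1 B0 B1 :: ('a + 'b, 'r) mfps) = P2 * inverse P1"
  proof (rule mfps_inverse_unique)
    have "Delta A0 A1 B0 B1 * (P2 * inverse P1) = (P1 * inverse P1) * (P2 * inverse P2)"
      unfolding Delta by (simp only: mult_ac)
    then show "Delta A0 A1 B0 B1 * (P2 * inverse P1) = 1" by (simp add: units)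
  qed
  then have "?N / Delta A0 A1 B0 B1 = (?N * P2) * inverse P1"
    by (simp add: divide_mfps_def mult.assoc)
  also have "\<dots> = ?S * (P1 * inverse P1)" by (simp only: \<open>?S * P1 = ?N * P2\<close> [symmetric] mult.assoc)
  finally show ?thesis by (simp add: units)
qed

section \<open>The Cauchy identity\<close>

lemma lin_prod_degree:
  fixes y :: "'i \<Rightarrow> 'c::comm_ring_1"
  assumes "finite J" "card J < r"
  shows "(\<Prod>m\<in>J. lin (y m)) $ r = 0"
  using assms
proof (induction J arbitrary: r rule: finite_induct)
  case (insert m J)
  then obtain r' where r: "r = Suc r'" "card J < r'" by (cases r) auto
  then show ?case using insert by (simp add: lin_def distrib_right mult.assoc)
qed simp

text \<open>
  Multiplying \<open>H(t) = \<Prod> 1 / (1 - y\<^sub>m t)\<close> by the polynomial \<open>\<Prod>\<^bsub>m \<noteq> k\<^esub> (1 - y\<^sub>m t)\<close> leaves \<open>1 / (1 - y\<^sub>k t)\<close>. So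
  the matrix of powers of the \<open>y\<^sub>k\<close> is the Jacobi-Trudi matrix times a matrix \<open>B\<close> that is the same for all
  shapes, and the empty shape identifies \<open>det B\<close> as the Vandermonde determinant.
\<close>

lemma bialternant:
  fixes y :: "nat \<Rightarrow> 'c::comm_ring_1" and d :: nat
  defines "H \<equiv> \<Prod>k<d. geo (y k)"
  shows "tdet d H la empty_partition * DET {..<d} (\<lambda>i k. y k ^ (d - 1 - i))
    = DET {..<d} (\<lambda>i k. y k ^ (la i + (d - 1 - i)))"
proof -
  define E where "E k = (\<Prod>m\<in>{..<d} - {k}. lin (- y m))" for k
  define B where "B j k = E k $ (d - 1 - j)" for j k
  have HE: "H * E k = geo (y k)" if "k < d" for k
  proof -
    have "H = geo (y k) * (\<Prod>m\<in>{..<d} - {k}. geo (y m))" unfolding H_def using that by (simp add: prod.remove)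
    then have "H * E k = geo (y k) * (\<Prod>m\<in>{..<d} - {k}. geo (y m) * lin (- y m))"
      by (simp add: E_def prod.distrib mult.assoc)
    then show ?thesis by (simp add: geo_lin)
  qed
  have power: "y k ^ (la i + (d - 1 - i)) = (\<Sum>j<d. icoef H (int (la i) - int i - (0 - int j)) * B j k)"
    if i: "i < d" and k: "k < d" for la :: "nat \<Rightarrow> nat" and i k
  proof -
    let ?n = "la i + (d - 1 - i)"
    have cardE: "E k $ r = 0" if "r \<ge> d" for r
      unfolding E_def using that k by (intro lin_prod_degree) auto
    have n: "int ?n = int (la i) + int d - 1 - int i" using i by (simp add: of_nat_diff)
    have "E k * H = geo (y k)" using HE [OF k] by (simp only: mult.commute)
    then have "y k ^ ?n = icoef (E k * H) (int ?n - 0)" by (simp only: diff_zero icoef_nat geo_nth)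
    also have "\<dots> = (\<Sum>c\<in>{min 0 (int ?n - int d + 1)..int ?n}. icoef (E k) (int ?n - c) * icoef H (c - 0))"
      by (rule icoef_mult) auto
    also have "\<dots> = (\<Sum>c\<in>{int ?n - int d + 1..int ?n}. icoef (E k) (int ?n - c) * icoef H (c - 0))"
      by (rule sum.mono_neutral_right) (auto simp: icoef_def cardE)
    also have "\<dots> = (\<Sum>j<d. icoef H (int (la i) - int i - (0 - int j)) * B j k)"
    proof (rule sum.reindex_bij_witness [where i = "\<lambda>j. int ?n - int d + 1 + int j"
          and j = "\<lambda>c. nat (c - (int ?n - int d + 1))"])
      fix c assume c: "c \<in> {int ?n - int d + 1..int ?n}"
      define m where "m = nat (c - (int ?n - int d + 1))"
      have m: "int m = c - (int ?n - int d + 1)" "m < d" using c by (auto simp: m_def)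
      then have "int ?n - c = int (d - 1 - m)" by (simp add: of_nat_diff)
      moreover have "int (la i) - int i - (0 - int m) = c - 0" using m(1) n by linarith
      ultimately show "icoef H (int (la i) - int i - (0 - int (nat (c - (int ?n - int d + 1)))))
          * B (nat (c - (int ?n - int d + 1))) k = icoef (E k) (int ?n - c) * icoef H (c - 0)"
        unfolding m_def [symmetric] by (simp only: B_def icoef_nat mult.commute)
    qed auto
    finally show ?thesis .
  qed
  have *: "DET {..<d} (\<lambda>i k. y k ^ (la i + (d - 1 - i))) = tdet d H la empty_partition * DET {..<d} B" for la
  proof -
    have "DET {..<d} (\<lambda>i k. y k ^ (la i + (d - 1 - i)))
        = DET {..<d} (\<lambda>i k. \<Sum>j\<in>{..<d}. icoef H (int (la i) - int i - (0 - int j)) * B j k)"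
    proof (intro DET_cong)
      fix i k assume "i \<in> {..<d}" "k \<in> {..<d}"
      then show "y k ^ (la i + (d - 1 - i)) = (\<Sum>j\<in>{..<d}. icoef H (int (la i) - int i - (0 - int j)) * B j k)"
        by (intro power) auto
    qed
    then show ?thesis by (subst (asm) DET_mult) (simp_all add: tdet_def empty_partition_def)
  qed
  have H0: "H $ 0 = 1"
  proof -
    have "(\<Prod>k\<in>J. geo (y k)) $ 0 = 1" for J :: "nat set"
      by (induction J rule: infinite_finite_induct) auto
    then show ?thesis by (simp add: H_def)
  qed
  have "tdet d H empty_partition empty_partition
      = (\<Prod>i<d. icoef H (int (empty_partition i) - int i - (int (empty_partition i) - int i)))"
    unfolding tdet_def by (rule DET_upper_triangular) (auto simp: empty_partition_def)
  then have "tdet d H empty_partition empty_partition = 1" by (simp add: H0)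
  then have base: "DET {..<d} (\<lambda>i k. y k ^ (d - 1 - i)) = DET {..<d} B"
    using * [of empty_partition] by (simp add: empty_partition_def)
  show ?thesis by (simp only: * [of la] base)
qed


definition zmono :: "nat \<Rightarrow> int \<Rightarrow> laurent" where
  "zmono k n = Poly_Mapping.single (Poly_Mapping.single k n) 1"

definition zpow :: "nat \<Rightarrow> int \<Rightarrow> ('v, laurent) mfps" where
  "zpow k n = mconst (zmono k n)"

lemma zmono_add: "zmono k (m + n) = zmono k m * zmono k n"
  by (simp add: zmono_def mult_single single_add)

lemma zpow_add: "zpow k (m + n) = (zpow k m * zpow k n :: ('v, laurent) mfps)"
  by (simp add: zpow_def zmono_add mconst_mult)

lemma zpow_0 [simp]: "zpow k 0 = (1 :: ('v, laurent) mfps)"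
  by (simp add: zpow_def zmono_def)

lemma zvar_eq: "zvar k = zpow k 1" and zvar_inv_eq: "zvar_inv k = zpow k (- 1)"
  by (simp_all add: zvar_def zvar_inv_def zpow_def zmono_def)

lemma zvar_power: "zvar k ^ n = (zpow k (int n) :: ('v, laurent) mfps)"
proof (induction n)
  case (Suc n)
  have "int (Suc n) = 1 + int n" by simp
  then show ?case using Suc by (simp only: power_Suc zvar_eq zpow_add)
qed simp

lemma zvar_inv_power: "zvar_inv k ^ n = (zpow k (- int n) :: ('v, laurent) mfps)"
proof (induction n)
  case (Suc n)
  have "- int (Suc n) = - 1 + - int n" by simp
  then show ?case using Suc by (simp only: power_Suc zvar_inv_eq zpow_add)
qed simp

text \<open>
  The alternant \<open>det (z\<^sub>k\<^bsup>\<lambda>\<^sub>i + d - i\<^esup>)\<close>. The entries \<open>i\<close> and \<open>k\<close> are counted from \<open>0\<close>, whereas the variables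
  are \<open>z\<^sub>1, \<dots>, z\<^sub>d\<close>.
\<close>

definition zalternant :: "nat \<Rightarrow> int list \<Rightarrow> ('v, laurent) mfps" where
  "zalternant d l = DET {..<d} (\<lambda>i k. zpow (Suc k) (l ! i - int i + int d - 1))"

text \<open>
  The monomials belonging to different permutations are different, so the one of the identity has
  coefficient 1.
\<close>

lemma zmono_Vandermonde_nonzero: "DET {..<d} (\<lambda>i k. zmono (Suc k) (int (d - 1 - i))) \<noteq> 0"
proof -
  define key where "key p = (\<Sum>i<d. Poly_Mapping.single (Suc (p i)) (int (d - 1 - i)))" for p :: "nat \<Rightarrow> nat"
  have prod: "(\<Prod>i\<in>J. zmono (Suc (p i)) (int (d - 1 - i)))
      = Poly_Mapping.single (\<Sum>i\<in>J. Poly_Mapping.single (Suc (p i)) (int (d - 1 - i))) 1"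
    if "finite J" for J and p :: "nat \<Rightarrow> nat"
    using that by (induction J rule: finite_induct) (auto simp: zmono_def mult_single)
  have key: "p = id" if p: "p permutes {..<d}" and eq: "key p = key id" for p
  proof -
    have look: "Poly_Mapping.lookup (key q) (Suc (q i)) = int (d - 1 - i)"
      if q: "q permutes {..<d}" and i: "i < d" for q i
    proof -
      have "Poly_Mapping.lookup (key q) (Suc (q i)) = (\<Sum>j<d. if j = i then int (d - 1 - j) else 0)"
        unfolding key_def lookup_sum
        by (intro sum.cong refl) (auto simp: lookup_single when_def inj_eq [OF permutes_inj [OF q]])
      then show ?thesis using i by simp
    qed
    have "p i = i" if i: "i < d" for i
    proof -
      have pi: "p i < d" using permutes_in_image [OF p, of i] i by simp
      have "int (d - 1 - i) = int (d - 1 - p i)"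
        using look [OF p i] look [OF permutes_id pi] eq by simp
      then show ?thesis using i pi by simp
    qed
    then show ?thesis using permutes_not_in [OF p] by (auto simp: fun_eq_iff)
  qed
  have "Poly_Mapping.lookup (DET {..<d} (\<lambda>i k. zmono (Suc k) (int (d - 1 - i)))) (key id)
      = (\<Sum>p | p permutes {..<d}. if p = id then 1 else 0)"
    unfolding DET_def lookup_sum
  proof (intro sum.cong refl)
    fix p assume "p \<in> {p. p permutes {..<d}}"
    then have p: "p permutes {..<d}" by simp
    have prd: "(\<Prod>i<d. zmono (Suc (p i)) (int (d - 1 - i))) = Poly_Mapping.single (key p) 1"
      unfolding key_def by (rule prod) simp
    have look: "Poly_Mapping.lookup (of_int (sign p) * Poly_Mapping.single (key p) (1 :: int)) (key id)
        = sign p * (if key p = key id then 1 else 0)"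
      by (cases p rule: sign_cases) (auto simp: lookup_single when_def)
    then show "Poly_Mapping.lookup (of_int (sign p) * (\<Prod>i<d. zmono (Suc (p i)) (int (d - 1 - i)))) (key id)
        = (if p = id then 1 else 0)"
      unfolding prd look using key [OF p] by auto
  qed
  also have "\<dots> = 1"
    using finite_permutations [of "{..<d}"] by simp
  finally show ?thesis by auto
qed

lemma zalternant_zero:
  "zalternant d (replicate d 0) = mconst (DET {..<d} (\<lambda>i k. zmono (Suc k) (int (d - 1 - i))))"
  unfolding zalternant_def mconst_DET
  by (intro DET_cong) (simp add: zpow_def of_nat_diff algebra_simps)

text \<open>
  The Vandermonde determinant is a constant of the power series ring, hence it multiplies each
  coefficient by the same nonzero element of an integral domain.
\<close>

lemma zalternant_cancel:
  assumes "mcong M (zalternant d (replicate d 0) * F) (zalternant d (replicate d 0) * G)"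
  shows "mcong M F G"
  using assms zmono_Vandermonde_nonzero [of d]
  by (simp add: mcong_def zalternant_zero mcoeff_mconst_mult)

lemma rational_schur_alternant:
  assumes l: "l \<in> gen_partitions d"
  shows "rational_schur d l * zalternant d (replicate d 0) = (zalternant d l :: ('v, laurent) mfps)"
proof -
  let ?p = "min_shift l"
  let ?la = "shift l ?p"
  let ?y = "\<lambda>k. zvar (Suc k) :: ('v, laurent) mfps"
  have len: "length l = d" using l by (rule gen_partitions_length)
  have l0: "0 \<le> l ! i + int ?p" if "i < d" for i using min_shift_nonneg [of i l] that len by simp
  have la: "is_partition ?la" using l l0 by (rule shift_partition)
  have zero: "zalternant d (replicate d 0) = DET {..<d} (\<lambda>i k. ?y k ^ (d - 1 - i))"
    unfolding zalternant_def
    by (intro DET_cong) (simp add: zvar_power of_nat_diff algebra_simps)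
  have "skew_schur zvar {1..d} ?la empty_partition
      = (tableau_sum zvar (to_nat_on {1..d}) {1..d} ?la empty_partition :: ('v, laurent) mfps)"
    unfolding skew_schur_def tableau_sum_def ssyt_eq_tableaux
    using finite_tableaux [OF _ la, of "{1..d}" "to_nat_on {1..d}" empty_partition] by (simp add: infsum_finite)
  also have "\<dots> = tdet d (\<Prod>k\<in>{1..d}. geo (zvar k)) ?la empty_partition"
    using la shift_zero [OF l] by (intro Jacobi_Trudi inj_on_to_nat_on) auto
  also have "(\<Prod>k\<in>{1..d}. geo (zvar k :: ('v, laurent) mfps)) = (\<Prod>k<d. geo (?y k))"
    by (rule prod.reindex_bij_witness [where i = Suc and j = "\<lambda>k. k - 1"]) auto
  finally have "skew_schur zvar {1..d} ?la empty_partition * zalternant d (replicate d 0)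
      = tdet d (\<Prod>k<d. geo (?y k)) ?la empty_partition * DET {..<d} (\<lambda>i k. ?y k ^ (d - 1 - i))"
    by (simp only: zero)
  also have "\<dots> = DET {..<d} (\<lambda>i k. ?y k ^ (?la i + (d - 1 - i)))"
    by (rule bialternant)
  also have "\<dots> = DET {..<d} (\<lambda>i k. zpow (Suc k) (int ?p) * zpow (Suc k) (l ! i - int i + int d - 1))"
  proof (intro DET_cong)
    fix i k assume i: "i \<in> {..<d}"
    have "int (?la i + (d - 1 - i)) = int ?p + (l ! i - int i + int d - 1)"
      using i shift_nth [OF l _ l0, of i] by (simp add: of_nat_diff)
    then show "?y k ^ (?la i + (d - 1 - i)) = zpow (Suc k) (int ?p) * zpow (Suc k) (l ! i - int i + int d - 1)"
      by (simp only: zvar_power zpow_add)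
  qed
  also have "\<dots> = (\<Prod>k<d. zpow (Suc k) (int ?p)) * zalternant d l"
    unfolding zalternant_def by (rule DET_scale_columns) simp
  finally have *: "skew_schur zvar {1..d} ?la empty_partition * zalternant d (replicate d 0)
      = (\<Prod>k<d. zpow (Suc k) (int ?p)) * (zalternant d l :: ('v, laurent) mfps)" .
  have "(\<Prod>k\<in>{1..d}. zvar_inv k :: ('v, laurent) mfps) = (\<Prod>k<d. zvar_inv (Suc k))"
    by (rule prod.reindex_bij_witness [where i = Suc and j = "\<lambda>k. k - 1"]) auto
  then have inv: "(\<Prod>k\<in>{1..d}. zvar_inv k :: ('v, laurent) mfps) ^ ?p = (\<Prod>k<d. zpow (Suc k) (- int ?p))"
    by (simp add: prod_power_distrib zvar_inv_power)
  have "(\<Prod>k<d. zpow (Suc k) (- int ?p)) * (\<Prod>k<d. zpow (Suc k) (int ?p)) = (1 :: ('v, laurent) mfps)"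
    by (simp add: prod.distrib [symmetric] zpow_add [symmetric])
  then show ?thesis
    unfolding rational_schur_def Let_def inv mult.assoc * by (simp add: mult.assoc [symmetric])
qed


lemma trunc_eval_truncate:
  fixes F :: "('v, 'r::comm_ring_1) mfps fps"
  assumes "graded F" "size M \<le> R"
  shows "mcong M (trunc_eval R F y) (trunc_eval (size M) F y)"
  unfolding trunc_eval_def
proof (rule mcong_sum_neutral)
  fix k assume "k \<in> {..R} - {..size M}"
  then have "mcong M (F $ k * y ^ k) (0 * y ^ k)" using assms by (intro mcong_mult graded_mcong_zero) auto
  then show "mcong M (F $ k * y ^ k) 0" by simp
qed (use assms in auto)

lemma trunc_eval_infprod:
  fixes x :: "'i \<Rightarrow> ('v, 'r::comm_ring_1) mfps"
  assumes x: "alphabet x"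
  shows "mcong M (trunc_eval (size M) (h_series M x I0 I1) y * infprod (\<lambda>a. 1 - x a * y) I0)
    (infprod (\<lambda>a. 1 + x a * y) I1)"
proof -
  have inf: "mcong M (infprod (\<lambda>a. 1 + x a * z) I) (\<Prod>a\<in>visible M x I. 1 + x a * z)" for z I
  proof (rule infprod_alphabet [OF alphabet_scale(1) [OF x]])
    have "mcong M (x a * z) 0" if "mcong M (x a) 0" for a
      using mcong_mult [OF that mcong_refl, of z] by simp
    then show "visible M (\<lambda>a. x a * z) I \<subseteq> visible M x I" by (auto simp: visible_def)
    show "visible M x I \<subseteq> I" by (rule visible_subset)
  qed (use x in auto)
  have "mcong M (trunc_eval (size M) (h_series M x I0 I1) y * infprod (\<lambda>a. 1 - x a * y) I0)
      (trunc_eval (Suc (size M)) (h_series M x I0 I1) y * (\<Prod>a\<in>visible M x I0. 1 - x a * y))"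
    using x inf [of "- y" I0] by (intro mcong_mult mcong_sym [OF trunc_eval_truncate] graded_h_series) auto
  also have "mcong M \<dots> (\<Prod>a\<in>visible M x I1. 1 + x a * y)"
    using x by (intro trunc_eval_h_series) auto
  also have "mcong M \<dots> (infprod (\<lambda>a. 1 + x a * y) I1)"
    by (rule mcong_sym [OF inf])
  finally show ?thesis .
qed

lemma toeplitz_coef_large:
  fixes F G :: "('v, 'r::comm_ring_1) mfps fps"
  assumes "graded F" "int (size M) < \<bar>k\<bar>"
  shows "mcong M (toeplitz_coef (size M) F G k) 0"
proof -
  have "mcong M (toeplitz_coef (size M) F G k) (\<Sum>j\<le>size M. 0 * G $ j)"
    unfolding toeplitz_coef_def
  proof (intro mcong_sum mcong_mult mcong_refl)
    fix j assume j: "j \<in> {..size M}"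
    show "mcong M (icoef F (k + int j)) 0"
    proof (cases "k < 0")
      case True
      then show ?thesis using assms j by simp
    next
      case False
      then show ?thesis using assms by (intro graded_icoef_mcong_zero) auto
    qed
  qed
  then show ?thesis by simp
qed

text \<open>
  Modulo \<open>M\<close> the two-sided series \<open>F(t) G(1/t)\<close> is a finite sum and can be evaluated at \<open>t = z\<^sub>k\<close>.
\<close>

lemma toeplitz_coef_generating:
  fixes F G :: "('v, laurent) mfps fps"
  assumes F: "graded F" and C: "finite C" "{- int (size M)..int (size M)} \<subseteq> C"
  shows "mcong M (\<Sum>n\<in>C. toeplitz_coef (size M) F G n * zpow k n)
    (trunc_eval (size M) F (zvar k) * trunc_eval (size M) G (zvar_inv k))"
proof -
  let ?K = "size M"
  have "(\<Sum>n\<in>C. toeplitz_coef ?K F G n * zpow k n) = (\<Sum>j\<le>?K. (G $ j * zpow k (- int j)) * (\<Sum>n\<in>C. icoef F (n + int j) * zpow k (n + int j)))"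
    unfolding toeplitz_coef_def sum_distrib_right sum_distrib_left
    by (subst sum.swap, intro sum.cong refl)
       (simp add: mult_ac zpow_add, simp add: mult.assoc [symmetric] zpow_add [symmetric])
  also have "mcong M \<dots> (\<Sum>j\<le>?K. (G $ j * zpow k (- int j)) * trunc_eval ?K F (zvar k))"
  proof (intro mcong_sum mcong_mult mcong_refl)
    fix j assume j: "j \<in> {..?K}"
    have "mcong M (\<Sum>n\<in>C. icoef F (n + int j) * zpow k (n + int j))
        (\<Sum>n\<in>{- int j..int ?K - int j}. icoef F (n + int j) * zpow k (n + int j))"
    proof (rule mcong_sum_neutral)
      show "{- int j..int ?K - int j} \<subseteq> C" using C j by auto
      fix n assume n: "n \<in> C - {- int j..int ?K - int j}"
      have "mcong M (icoef F (n + int j)) 0"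
      proof (cases "n + int j < 0")
        case False
        then show ?thesis using n by (intro graded_icoef_mcong_zero F) auto
      qed simp
      then have "mcong M (icoef F (n + int j) * zpow k (n + int j)) (0 * zpow k (n + int j))"
        by (intro mcong_mult) auto
      then show "mcong M (icoef F (n + int j) * zpow k (n + int j)) 0" by simp
    qed (rule C)
    also have "(\<Sum>n\<in>{- int j..int ?K - int j}. icoef F (n + int j) * zpow k (n + int j)) = trunc_eval ?K F (zvar k)"
      unfolding trunc_eval_def zvar_power
      by (rule sum.reindex_bij_witness [where i = "\<lambda>m. int m - int j" and j = "\<lambda>n. nat (n + int j)"])
         (auto simp: icoef_def)
    finally show "mcong M (\<Sum>n\<in>C. icoef F (n + int j) * zpow k (n + int j)) (trunc_eval ?K F (zvar k))" .
  qed
  also have "(\<Sum>j\<le>?K. (G $ j * zpow k (- int j)) * trunc_eval ?K F (zvar k)) = trunc_eval ?K F (zvar k) * trunc_eval ?K G (zvar_inv k)"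
    by (simp add: trunc_eval_def [of _ G] sum_distrib_left zvar_inv_power mult_ac)
  finally show ?thesis .
qed

text \<open>
  After multiplication by the Vandermonde determinant, the sum over \<open>\<lambda>\<close> of products of determinants
  is a Cauchy-Binet sum. Its value has the entries \<open>z\<^sub>k\<^bsup>d - i\<^esup> F(z\<^sub>k)\<close>, and the factor \<open>F(z\<^sub>k)\<close> comes out of
  each column.
\<close>

theorem rational_Cauchy_identity:
  fixes A0 A1 :: "'a set" and B0 B1 :: "'b set"
  assumes ctb: "countable A0" "countable A1" "countable B0" "countable B1"
  shows "((\<lambda>l. (rational_super_schur A0 A1 B0 B1 d l :: ('a + 'b, laurent) mfps) * rational_schur d l)
      has_sum
        (\<Prod>k\<in>{1..d}.
          (infprod (\<lambda>a. 1 + xA a * zvar k) A1 * infprod (\<lambda>b. 1 + xB_inv b * zvar_inv k) B1)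
          / (infprod (\<lambda>a. 1 - xA a * zvar k) A0 * infprod (\<lambda>b. 1 - xB_inv b * zvar_inv k) B0)))
      (gen_partitions d)"
proof (rule has_sum_mcongI)
  fix M :: "('a + 'b) multiset"
  let ?x = "xA :: 'a \<Rightarrow> ('a + 'b, laurent) mfps" and ?y = "xB_inv :: 'b \<Rightarrow> ('a + 'b, laurent) mfps"
  let ?S = "\<lambda>l. rational_super_schur A0 A1 B0 B1 d l :: ('a + 'b, laurent) mfps"
  let ?K = "size M"
  let ?hA = "h_series M ?x A0 A1" and ?hB = "h_series M ?y B0 B1"
  define f where "f = toeplitz_coef ?K ?hA ?hB"
  \<comment> \<open>The coefficients \<open>f n\<close> vanish modulo \<open>M\<close> for \<open>|n| > size M\<close>; the column shift \<open>j < d\<close> adds \<open>d\<close> at the lower end.\<close>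
  define C where "C = {- int ?K - int d..int ?K}"
  let ?L = "{l \<in> gen_partitions d. \<forall>i<d. l ! i - int i \<in> C}"
  let ?X1 = "\<lambda>k. infprod (\<lambda>a. 1 + ?x a * zvar k) A1" and ?Y1 = "\<lambda>k. infprod (\<lambda>b. 1 + ?y b * zvar_inv k) B1"
  let ?X0 = "\<lambda>k. infprod (\<lambda>a. 1 - ?x a * zvar k) A0" and ?Y0 = "\<lambda>k. infprod (\<lambda>b. 1 - ?y b * zvar_inv k) B0"
  let ?a = "zalternant d (replicate d 0) :: ('a + 'b, laurent) mfps"
  let ?R = "\<Prod>k\<in>{1..d}. (?X1 k * ?Y1 k) / (?X0 k * ?Y0 k)"
  let ?\<Phi> = "\<lambda>k. trunc_eval ?K ?hA (zvar k) * trunc_eval ?K ?hB (zvar_inv k)"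
  have S: "mcong M (?S l) (DET {..<d} (\<lambda>i j. f (l ! i - int i + int j)))" if "l \<in> gen_partitions d" for l
    unfolding f_def by (rule rational_super_schur_det [OF ctb that])
  have factor: "mcong M (?\<Phi> k) ((?X1 k * ?Y1 k) / (?X0 k * ?Y0 k))" for k
  proof -
    have units: "?X0 k * inverse (?X0 k) = 1" "?Y0 k * inverse (?Y0 k) = 1"
      using infprod_alphabet_unit [OF alphabet_scale(1) [OF alphabet_xA], of "- zvar k" A0]
        infprod_alphabet_unit [OF alphabet_scale(1) [OF alphabet_xB_inv], of "- zvar_inv k" B0] by simp_all
    have "(?X0 k * ?Y0 k) * (inverse (?X0 k) * inverse (?Y0 k))
        = (?X0 k * inverse (?X0 k)) * (?Y0 k * inverse (?Y0 k))" by (simp only: mult_ac)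
    then have inv: "(?X0 k * ?Y0 k) * (inverse (?X0 k) * inverse (?Y0 k)) = 1" by (simp add: units)
    then have "inverse (?X0 k * ?Y0 k) = inverse (?X0 k) * inverse (?Y0 k)" by (rule mfps_inverse_unique)
    then have div: "(?X1 k * ?Y1 k) / (?X0 k * ?Y0 k) = (?X1 k * ?Y1 k) * (inverse (?X0 k) * inverse (?Y0 k))"
      by (simp add: divide_mfps_def)
    have expand: "?\<Phi> k = ((trunc_eval ?K ?hA (zvar k) * ?X0 k) * (trunc_eval ?K ?hB (zvar_inv k) * ?Y0 k)) * (inverse (?X0 k) * inverse (?Y0 k))"
    proof -
      have "?\<Phi> k * ((?X0 k * ?Y0 k) * (inverse (?X0 k) * inverse (?Y0 k)))
          = ((trunc_eval ?K ?hA (zvar k) * ?X0 k) * (trunc_eval ?K ?hB (zvar_inv k) * ?Y0 k)) * (inverse (?X0 k) * inverse (?Y0 k))"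
        by (simp only: mult_ac)
      then show ?thesis unfolding inv mult_1_right .
    qed
    show ?thesis
      unfolding div expand
      by (intro mcong_mult mcong_refl trunc_eval_infprod alphabet_xA alphabet_xB_inv)
  qed
  show "\<exists>J. finite J \<and> J \<subseteq> gen_partitions d \<and> (\<forall>l\<in>gen_partitions d - J. mcong M (?S l * rational_schur d l) 0)
      \<and> mcong M (\<Sum>l\<in>J. ?S l * rational_schur d l) ?R"
  proof (intro exI conjI ballI)
    show "finite ?L" by (rule finite_gen_partitions) (simp add: C_def)
    show "?L \<subseteq> gen_partitions d" by auto
    fix l assume l: "l \<in> gen_partitions d - ?L"
    then obtain i where i: "i < d" "l ! i - int i \<notin> C" by auto
    have "mcong M (DET {..<d} (\<lambda>i j. f (l ! i - int i + int j)))
        (DET {..<d} (\<lambda>i' j. if i' = i then 0 else f (l ! i' - int i' + int j)))"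
    proof (intro mcong_DET)
      fix i' j assume ij: "i' \<in> {..<d}" "j \<in> {..<d}"
      have "mcong M (f (l ! i - int i + int j)) 0"
        unfolding f_def using i ij by (intro toeplitz_coef_large graded_h_series alphabet_xA) (auto simp: C_def)
      then show "mcong M (f (l ! i' - int i' + int j)) (if i' = i then 0 else f (l ! i' - int i' + int j))" by simp
    qed
    also have "DET {..<d} (\<lambda>i' j. if i' = i then 0 else f (l ! i' - int i' + int j)) = 0"
      using i by (intro DET_zero_row [of _ i]) auto
    finally have "mcong M (?S l) 0" using S [of l] l by (auto intro: mcong_trans)
    then have "mcong M (?S l * rational_schur d l) (0 * rational_schur d l)" by (intro mcong_mult) auto
    then show "mcong M (?S l * rational_schur d l) 0" by simp
  next
    have "?a * (\<Sum>l\<in>?L. ?S l * rational_schur d l) = (\<Sum>l\<in>?L. ?S l * (rational_schur d l * ?a))"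
      by (simp add: sum_distrib_left mult_ac)
    also have "\<dots> = (\<Sum>l\<in>?L. ?S l * zalternant d l)"
      by (intro sum.cong refl) (simp add: rational_schur_alternant)
    also have "mcong M \<dots> (\<Sum>l\<in>?L. DET {..<d} (\<lambda>i j. f (l ! j - int j + int i)) * zalternant d l)"
    proof (intro mcong_sum mcong_mult mcong_refl)
      fix l assume "l \<in> ?L"
      then show "mcong M (?S l) (DET {..<d} (\<lambda>i j. f (l ! j - int j + int i)))"
        using S [of l] DET_transpose [of "{..<d}" "\<lambda>i j. f (l ! i - int i + int j)"] by simp
    qed
    also have "(\<Sum>l\<in>?L. DET {..<d} (\<lambda>i j. f (l ! j - int j + int i)) * zalternant d l)
        = DET {..<d} (\<lambda>i k. \<Sum>c\<in>C. f (c + int i) * zpow (Suc k) (c + int d - 1))"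
      by (subst Cauchy_Binet_gen_partitions) (simp_all add: C_def zalternant_def)
    also have "mcong M \<dots> (DET {..<d} (\<lambda>i k. ?\<Phi> (Suc k) * zpow (Suc k) (0 - int i + int d - 1)))"
    proof (intro mcong_DET)
      fix i k assume i: "i \<in> {..<d}"
      let ?C = "(\<lambda>c. c + int i) ` C"
      have "(\<Sum>c\<in>C. f (c + int i) * zpow (Suc k) (c + int d - 1))
          = (\<Sum>c\<in>C. f (c + int i) * zpow (Suc k) (c + int i)) * zpow (Suc k) (0 - int i + int d - 1)"
        unfolding sum_distrib_right mult.assoc zpow_add [symmetric]
        by (intro sum.cong refl) (simp add: algebra_simps)
      also have "(\<Sum>c\<in>C. f (c + int i) * zpow (Suc k) (c + int i)) = (\<Sum>n\<in>?C. f n * zpow (Suc k) n)"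
        by (subst sum.reindex) (auto simp: inj_on_def)
      also have "mcong M ((\<Sum>n\<in>?C. f n * zpow (Suc k) n) * zpow (Suc k) (0 - int i + int d - 1))
          (?\<Phi> (Suc k) * zpow (Suc k) (0 - int i + int d - 1))"
        unfolding f_def
      proof (intro mcong_mult mcong_refl toeplitz_coef_generating graded_h_series alphabet_xA)
        show "finite ?C" by (simp add: C_def)
        show "{- int ?K..int ?K} \<subseteq> ?C"
        proof
          fix n assume "n \<in> {- int ?K..int ?K}"
          then have "n - int i \<in> C" using i by (auto simp: C_def)
          then show "n \<in> ?C" by (intro image_eqI [where x = "n - int i"]) auto
        qed
      qed
      finally show "mcong M (\<Sum>c\<in>C. f (c + int i) * zpow (Suc k) (c + int d - 1))
          (?\<Phi> (Suc k) * zpow (Suc k) (0 - int i + int d - 1))" .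
    qed
    also have "DET {..<d} (\<lambda>i k. ?\<Phi> (Suc k) * zpow (Suc k) (0 - int i + int d - 1))
        = (\<Prod>k<d. ?\<Phi> (Suc k)) * DET {..<d} (\<lambda>i k. zpow (Suc k) (0 - int i + int d - 1))"
      by (rule DET_scale_columns) simp
    also have "DET {..<d} (\<lambda>i k. zpow (Suc k) (0 - int i + int d - 1)) = ?a"
      unfolding zalternant_def by (intro DET_cong) simp
    also have "(\<Prod>k<d. ?\<Phi> (Suc k)) = (\<Prod>k\<in>{1..d}. ?\<Phi> k)"
      by (rule prod.reindex_bij_witness [where i = "\<lambda>k. k - 1" and j = Suc]) auto
    also have "mcong M ((\<Prod>k\<in>{1..d}. ?\<Phi> k) * ?a) (?R * ?a)"
      by (intro mcong_mult mcong_prod factor) auto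
    also have "?R * ?a = ?a * ?R" by (rule mult.commute)
    finally show "mcong M (\<Sum>l\<in>?L. ?S l * rational_schur d l) ?R" by (rule zalternant_cancel)
  qed
qed

section \<open>The theorem\<close>

theorem theorem3p10:
  fixes A0 A1 :: "'a set" and B0 B1 :: "'b set" and d :: nat
  assumes "countable A0" "countable A1" "A0 \<inter> A1 = {}"
    and "countable B0" "countable B1" "B0 \<inter> B1 = {}"
    and "d \<ge> 1"
  shows "(\<forall>l\<in>gen_partitions d.
      (\<lambda>w. (- 1) ^ cox_length w * super_schur xA A0 A1 (lam_plus w l)
              * super_schur xB_inv B0 B1 (lam_minus w l) :: ('a + 'b, int) mfps)
        summable_on coset_reps \<and>
      (rational_super_schur A0 A1 B0 B1 d l :: ('a + 'b, int) mfps) =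
        (\<Sum>\<^sub>\<infinity>w\<in>coset_reps. (- 1) ^ cox_length w * super_schur xA A0 A1 (lam_plus w l)
              * super_schur xB_inv B0 B1 (lam_minus w l))
          / Delta A0 A1 B0 B1) \<and>
    ((\<lambda>l. (rational_super_schur A0 A1 B0 B1 d l :: ('a + 'b, laurent) mfps) * rational_schur d l)
      has_sum
        (\<Prod>k\<in>{1..d}.
          (infprod (\<lambda>a. 1 + xA a * zvar k) A1 * infprod (\<lambda>b. 1 + xB_inv b * zvar_inv k) B1)
          / (infprod (\<lambda>a. 1 - xA a * zvar k) A0 * infprod (\<lambda>b. 1 - xB_inv b * zvar_inv k) B0)))
      (gen_partitions d)"
proof (intro conjI ballI)
  fix l assume l: "l \<in> gen_partitions d"
  have summand: "(\<lambda>w. (- 1) ^ cox_length w * super_schur xA A0 A1 (lam_plus w l)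
              * super_schur xB_inv B0 B1 (lam_minus w l) :: ('a + 'b, int) mfps)
      = numerator_term A0 A1 B0 B1 l"
    by (simp add: numerator_term_def fun_eq_iff)
  show "(\<lambda>w. (- 1) ^ cox_length w * super_schur xA A0 A1 (lam_plus w l)
              * super_schur xB_inv B0 B1 (lam_minus w l) :: ('a + 'b, int) mfps) summable_on coset_reps"
    unfolding summand by (rule numerator_summable [OF assms(1,2,4,5)])
  show "(rational_super_schur A0 A1 B0 B1 d l :: ('a + 'b, int) mfps)
      = (\<Sum>\<^sub>\<infinity>w\<in>coset_reps. (- 1) ^ cox_length w * super_schur xA A0 A1 (lam_plus w l)
              * super_schur xB_inv B0 B1 (lam_minus w l)) / Delta A0 A1 B0 B1"
    unfolding summand by (rule rational_super_schur_character [OF assms(1,2,4,5,3) l])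
qed (rule rational_Cauchy_identity [OF assms(1,2,4,5)])

end
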